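(* For all $\mathbf v_h\in\mathbf V_h^e$, $$\|\mathbf v_h\|_{\mathbf H(\operatorname{curl};\Omega)}\lesssim|||\mathbf v_h|||_e,$$ where $|||\mathbf v_h|||_e^2:=a_h^e(\mathbf v_h,\mathbf v_h)$.
   Context: **Geometry.** $\Omega\subset\mathbb R^2$ is a simply connected convex polygon, separated by a closed $C^{1,1}$ curve $\Gamma$ into $\Omega^+,\Omega^-$; $\alpha,\beta$ are positive and equal to constants $\alpha^\pm,\beta^\pm$ on $\Omega^\pm$. $\operatorname{curl}\mathbf v=\partial_{x_1}v_2-\partial_{x_2}v_1$; $\mathbf t$ denotes unit tangents. $\mathcal T_h$ is a shape regular triangulation of $\Omega$ with mesh size $h\lesssim1$, not necessarily fitted to $\Gamma$. A triangle $K$ is an interface element ($K\in\mathcal T_h^i$) if $|K\cap\Omega^+|>0$ and $|K\cap\Omega^-|>0$; otherwise $K\in\mathcal T_h^n$. The mesh is fine enough that $\Gamma$ meets each interface triangle's boundary in two distinct points $\mathbf b_1,\mathbf b_2$ on two different edges. $\Gamma_h^K$ is the segment $\mathbf b_1\mathbf b_2$, with unit normal $\bar{\mathbf n}$; it splits $K$ into open polygons $K_h^\pm$ approximating $K\cap\Omega^\pm$. $\mathcal E_K$ is the set of segments into which the vertices of $K$ and $\mathbf b_1,\mathbf b_2$ divide $\partial K$. $\alpha_h=\alpha^\pm,\beta_h=\beta^\pm$ on $K_h^\pm$ for interface elements; $\alpha_h=\alpha,\beta_h=\beta$ on non-interface elements; $\beta_e=\beta_h|_e$. **Spaces.** For $K\in\mathcal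 T_h^i$, $\mathbf V_h^e(K)$ is the set of $\mathbf v\in\mathbf H(\operatorname{curl};K)$ with $\beta_h\mathbf v\in\mathbf H(\operatorname{div};K)$, $\operatorname{div}(\beta_h\mathbf v)=0$, $\alpha_h\operatorname{curl}\mathbf v\in\mathbb P_0(K)$, and $\mathbf v\cdot\mathbf t_e|_e\in\mathbb P_0(e)$ for all $e\in\mathcal E_K$. $\mathbf V_h^e$ is the set of $\mathbf v\in\mathbf H(\operatorname{curl};\Omega)$ with $\mathbf v|_K\in\mathbf V_h^e(K)$ for $K\in\mathcal T_h^i$ and $\mathbf v|_K\in\mathcal{ND}_0(K)$ (lowest-order Nédélec space) for $K\in\mathcal T_h^n$. $S_h^n(K)$, $K\in\mathcal T_h^i$, consists of functions $v$ with $v|_{K_h^\pm}\in\mathbb P_1(K_h^\pm)$, $v^+=v^-$ and $\beta^+\nabla v^+\cdot\bar{\mathbf n}=\beta^-\nabla v^-\cdot\bar{\mathbf n}$ on $\Gamma_h^K$. **Projection and bilinear form.** For $K\in\mathcal T_h^i$, $\mathbf\Pi_K:L^2(K)^2\to\nabla S_h^n(K)$ is defined by $(\beta_h\mathbf\Pi_K\mathbf u,\mathbf v)_K=(\beta_h\mathbf u,\mathbf v)_K$ for all $\mathbf v\in\nabla S_h^n(K)$, and $a_h^{e,K}(\mathbf u,\mathbf v)=(\alpha_h\operatorname{curl}\mathbf u,\operatorname{curl}\mathbf v)_K+(\beta_h\mathbf\Pi_K\mathbf u,\mathbf\Pi_K\mathbf v)_K+\sum_{e\in\mathcal E_K}\beta_e\big((\mathbf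 u-\mathbf\Pi_K\mathbf u)\cdot\mathbf t,(\mathbf v-\mathbf\Pi_K\mathbf v)\cdot\mathbf t\big)_{0,e}$. For $K\in\mathcal T_h^n$, $a_h^{e,K}(\mathbf u,\mathbf v)=(\alpha_h\operatorname{curl}\mathbf u,\operatorname{curl}\mathbf v)_K+(\beta_h\mathbf u,\mathbf v)_K$. $a_h^e=\sum_Ka_h^{e,K}$. **Convention.** $A\lesssim B$ means $A\le CB$ with $C$ possibly depending on $\alpha,\beta$ (and $\Omega$, $\Gamma$, shape regularity) but not on $h$ or on the location of the cut points. *)

theory Defs
  imports "HOL-Analysis.Analysis"
begin

type_synonym plane = "real ^ 2"
type_synonym scalar_field = "plane \<Rightarrow> real"
type_synonym vector_field = "plane \<Rightarrow> plane"


section \<open>Square integrable functions, weak curl and weak divergence\<close>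

definition L2 :: "'a::euclidean_space set \<Rightarrow> ('a \<Rightarrow> 'b::euclidean_space) \<Rightarrow> bool" where
  "L2 D f \<longleftrightarrow> f \<in> borel_measurable (lebesgue_on D) \<and>
     integrable (lebesgue_on D) (\<lambda>x. (norm (f x))\<^sup>2)"

definition ip :: "'a::euclidean_space set \<Rightarrow> ('a \<Rightarrow> 'b::euclidean_space) \<Rightarrow> ('a \<Rightarrow> 'b) \<Rightarrow> real" where
  "ip D f g = (LINT x|lebesgue_on D. f x \<bullet> g x)"

definition C1_with_gradient :: "scalar_field \<Rightarrow> vector_field \<Rightarrow> bool" where
  "C1_with_gradient \<phi> g \<longleftrightarrow> (\<forall>x. GDERIV \<phi> x :> g x) \<and> continuous_on UNIV g"

definition compact_support_in :: "plane set \<Rightarrow> scalar_field \<Rightarrow> bool" where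
  "compact_support_in D \<phi> \<longleftrightarrow>
     compact (closure {x. \<phi> x \<noteq> 0}) \<and> closure {x. \<phi> x \<noteq> 0} \<subseteq> D"

(* rotate (grad phi) is the vector curl of phi, the formal adjoint of the scalar curl *)
definition rotate :: "plane \<Rightarrow> plane" where
  "rotate g = vector [g $ 2, - (g $ 1)]"

(* Weak derivatives are tested against compactly supported C^1 functions; for the square
   integrable fields used here this is the distributional derivative. *)
definition has_weak_curl :: "plane set \<Rightarrow> vector_field \<Rightarrow> scalar_field \<Rightarrow> bool" where
  "has_weak_curl D v c \<longleftrightarrow> L2 D v \<and> L2 D c \<and>
     (\<forall>\<phi> g. C1_with_gradient \<phi> g \<and> compact_support_in D \<phi> \<longrightarrow>
        ip D c \<phi> = ip D v (\<lambda>x. rotate (g x)))"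

definition has_weak_div :: "plane set \<Rightarrow> vector_field \<Rightarrow> scalar_field \<Rightarrow> bool" where
  "has_weak_div D v d \<longleftrightarrow> L2 D v \<and> L2 D d \<and>
     (\<forall>\<phi> g. C1_with_gradient \<phi> g \<and> compact_support_in D \<phi> \<longrightarrow>
        ip D d \<phi> = - ip D v g)"

definition Hcurl :: "plane set \<Rightarrow> vector_field set" where
  "Hcurl D = {v. \<exists>c. has_weak_curl D v c}"

(* determined up to a null set *)
definition weak_curl :: "plane set \<Rightarrow> vector_field \<Rightarrow> scalar_field" where
  "weak_curl D v = (SOME c. has_weak_curl D v c)"

definition Hcurl_norm :: "plane set \<Rightarrow> vector_field \<Rightarrow> real" where
  "Hcurl_norm D v = sqrt (ip D v v + ip D (weak_curl D v) (weak_curl D v))"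


section \<open>Tangential traces\<close>

(* An oriented segment is the pair of its end points. *)
type_synonym oseg = "plane \<times> plane"

definition edge_point :: "oseg \<Rightarrow> real \<Rightarrow> plane" where
  "edge_point e s = fst e + s *\<^sub>R (snd e - fst e)"

(* integral with respect to arc length *)
definition edge_ip :: "oseg \<Rightarrow> scalar_field \<Rightarrow> scalar_field \<Rightarrow> real" where
  "edge_ip e f g = dist (fst e) (snd e) *
     ip {0..1} (\<lambda>s. f (edge_point e s)) (\<lambda>s. g (edge_point e s))"

(* The segments into which the finite set N divides the boundary of the triangle K, each
   oriented counterclockwise (K lies to the left). *)
definition boundary_segments :: "plane set \<Rightarrow> plane set \<Rightarrow> oseg set" where
  "boundary_segments K N = {(a, b). a \<in> N \<and> b \<in> N \<and> a \<noteq> b \<and>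
     closed_segment a b \<subseteq> frontier K \<and> open_segment a b \<inter> N = {} \<and>
     (\<forall>x\<in>K. (b - a) $ 1 * (x - a) $ 2 - (b - a) $ 2 * (x - a) $ 1 \<ge> 0)}"

(* g is the tangential trace of v along the counterclockwise unit tangent: Green's formula, which
   is the definition of this trace for v in H(curl; K). E is a subdivision of the boundary of K. *)
definition has_tangential_trace ::
  "plane set \<Rightarrow> oseg set \<Rightarrow> vector_field \<Rightarrow> scalar_field \<Rightarrow> bool" where
  "has_tangential_trace K E v g \<longleftrightarrow> v \<in> Hcurl (interior K) \<and>
     (\<forall>e\<in>E. L2 {0..1} (\<lambda>s. g (edge_point e s))) \<and>
     (\<forall>\<phi> \<phi>'. C1_with_gradient \<phi> \<phi>' \<longrightarrow>
        (\<Sum>e\<in>E. edge_ip e g \<phi>) =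
        ip (interior K) (weak_curl (interior K) v) \<phi> -
        ip (interior K) v (\<lambda>x. rotate (\<phi>' x)))"

definition tangential_trace :: "plane set \<Rightarrow> oseg set \<Rightarrow> vector_field \<Rightarrow> scalar_field" where
  "tangential_trace K E v = (SOME g. has_tangential_trace K E v g)"


section \<open>The interface problem\<close>

record interface_problem =
  Omega :: "plane set"
  Gamma :: "plane set"
  Omega_p :: "plane set"
  Omega_m :: "plane set"
  alpha_p :: real
  alpha_m :: real
  beta_p :: real
  beta_m :: real

definition convex_polygon :: "plane set \<Rightarrow> bool" where
  "convex_polygon S \<longleftrightarrow> S \<noteq> {} \<and> simply_connected S \<and> (\<exists>Q. polytope Q \<and> S = interior Q)"

(* range of a 1-periodic regular parametrisation with Lipschitz derivative, injective on a period *)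
definition closed_C11_curve :: "plane set \<Rightarrow> bool" where
  "closed_C11_curve G \<longleftrightarrow> (\<exists>\<gamma> \<gamma>' L.
     G = range \<gamma> \<and> (\<forall>t. \<gamma> (t + 1) = \<gamma> t) \<and> inj_on \<gamma> {0..<1} \<and>
     (\<forall>t. (\<gamma> has_vector_derivative \<gamma>' t) (at t)) \<and> (\<forall>t. \<gamma>' t \<noteq> 0) \<and>
     L-lipschitz_on (UNIV :: real set) \<gamma>')"

definition valid_problem :: "interface_problem \<Rightarrow> bool" where
  "valid_problem P \<longleftrightarrow>
     convex_polygon (Omega P) \<and> closed_C11_curve (Gamma P) \<and> Gamma P \<subseteq> Omega P \<and>
     open (Omega_p P) \<and> connected (Omega_p P) \<and> Omega_p P \<noteq> {} \<and>
     open (Omega_m P) \<and> connected (Omega_m P) \<and> Omega_m P \<noteq> {} \<and>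
     Omega_p P \<inter> Omega_m P = {} \<and> Omega_p P \<union> Omega_m P = Omega P - Gamma P \<and>
     alpha_p P > 0 \<and> alpha_m P > 0 \<and> beta_p P > 0 \<and> beta_m P > 0"


section \<open>Unfitted meshes\<close>

definition mesh_of :: "plane set \<Rightarrow> plane set set \<Rightarrow> bool" where
  "mesh_of D T \<longleftrightarrow> triangulation T \<and> (\<forall>K\<in>T. 2 simplex K) \<and> \<Union>T = closure D"

definition shape_regular :: "real \<Rightarrow> plane set set \<Rightarrow> bool" where
  "shape_regular \<sigma> T \<longleftrightarrow> (\<forall>K\<in>T. \<exists>x r. r > 0 \<and> cball x r \<subseteq> K \<and> diameter K \<le> \<sigma> * r)"

definition mesh_size :: "plane set set \<Rightarrow> real" where
  "mesh_size T = Max (diameter ` T)"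

definition interface_element :: "interface_problem \<Rightarrow> plane set \<Rightarrow> bool" where
  "interface_element P K \<longleftrightarrow>
     measure lebesgue (K \<inter> Omega_p P) > 0 \<and> measure lebesgue (K \<inter> Omega_m P) > 0"

definition cut_points :: "interface_problem \<Rightarrow> plane set \<Rightarrow> plane set" where
  "cut_points P K = Gamma P \<inter> frontier K"

definition Gamma_h :: "interface_problem \<Rightarrow> plane set \<Rightarrow> plane set" where
  "Gamma_h P K = convex hull (cut_points P K)"

(* Unit normal of Gamma_h, directed so that the vertices of K lying on the plus (minus) side of
   the exact interface lie on the plus (minus) side of Gamma_h. *)
definition segment_normal :: "interface_problem \<Rightarrow> plane set \<Rightarrow> plane \<Rightarrow> bool" where
  "segment_normal P K n \<longleftrightarrow> norm n = 1 \<and>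
     (\<forall>y\<in>Gamma_h P K. \<forall>z\<in>Gamma_h P K. n \<bullet> (y - z) = 0) \<and>
     (\<forall>a y. a extreme_point_of K \<and> y \<in> Gamma_h P K \<longrightarrow>
        (a \<in> closure (Omega_p P) \<longrightarrow> n \<bullet> (a - y) \<ge> 0) \<and>
        (a \<in> closure (Omega_m P) \<longrightarrow> n \<bullet> (a - y) \<le> 0))"

definition resolved_mesh :: "interface_problem \<Rightarrow> plane set set \<Rightarrow> bool" where
  "resolved_mesh P T \<longleftrightarrow> (\<forall>K\<in>T. interface_element P K \<longrightarrow>
     (\<exists>b1 b2 e1 e2. cut_points P K = {b1, b2} \<and> b1 \<noteq> b2 \<and>
        e1 edge_of K \<and> e2 edge_of K \<and> e1 \<noteq> e2 \<and> b1 \<in> e1 \<and> b2 \<in> e2) \<and>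
     (\<exists>n. segment_normal P K n))"

definition nbar :: "interface_problem \<Rightarrow> plane set \<Rightarrow> plane" where
  "nbar P K = (SOME n. segment_normal P K n)"

definition K_hp :: "interface_problem \<Rightarrow> plane set \<Rightarrow> plane set" where
  "K_hp P K = {x \<in> interior K. \<forall>y\<in>Gamma_h P K. nbar P K \<bullet> (x - y) > 0}"

definition K_hm :: "interface_problem \<Rightarrow> plane set \<Rightarrow> plane set" where
  "K_hm P K = {x \<in> interior K. \<forall>y\<in>Gamma_h P K. nbar P K \<bullet> (x - y) < 0}"

definition edges :: "interface_problem \<Rightarrow> plane set \<Rightarrow> oseg set" where
  "edges P K = boundary_segments K ({a. a extreme_point_of K} \<union> cut_points P K)"

(* values on Gamma and Gamma_h are irrelevant *)
definition coeff_h :: "interface_problem \<Rightarrow> real \<Rightarrow> real \<Rightarrow> plane set \<Rightarrow> scalar_field" where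
  "coeff_h P cp cm K x =
     (if interface_element P K then (if x \<in> K_hp P K then cp else cm)
      else (if x \<in> Omega_p P then cp else cm))"

definition alpha_h :: "interface_problem \<Rightarrow> plane set \<Rightarrow> scalar_field" where
  "alpha_h P = coeff_h P (alpha_p P) (alpha_m P)"

definition beta_h :: "interface_problem \<Rightarrow> plane set \<Rightarrow> scalar_field" where
  "beta_h P = coeff_h P (beta_p P) (beta_m P)"

(* each e in edges P K lies in the closure of one of K_hp, K_hm *)
definition beta_edge :: "interface_problem \<Rightarrow> plane set \<Rightarrow> oseg \<Rightarrow> real" where
  "beta_edge P K e =
     (if closed_segment (fst e) (snd e) \<subseteq> closure (K_hp P K) then beta_p P else beta_m P)"


section \<open>Discrete spaces\<close>

definition Ve_local :: "interface_problem \<Rightarrow> plane set \<Rightarrow> vector_field set" where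
  "Ve_local P K = {v. v \<in> Hcurl (interior K) \<and>
     has_weak_div (interior K) (\<lambda>x. beta_h P K x *\<^sub>R v x) (\<lambda>x. 0) \<and>
     (\<exists>c. AE x in lebesgue_on (interior K). alpha_h P K x * weak_curl (interior K) v x = c) \<and>
     (\<exists>g. has_tangential_trace K (edges P K) v g \<and>
        (\<forall>e\<in>edges P K. \<exists>c. \<forall>x\<in>open_segment (fst e) (snd e). g x = c))}"

definition ND0 :: "plane set \<Rightarrow> vector_field set" where
  "ND0 K = {v. \<exists>a b. AE x in lebesgue_on (interior K). v x = a + b *\<^sub>R rotate x}"

definition Ve :: "interface_problem \<Rightarrow> plane set set \<Rightarrow> vector_field set" where
  "Ve P T = {v. v \<in> Hcurl (Omega P) \<and>
     (\<forall>K\<in>T. if interface_element P K then v \<in> Ve_local P K else v \<in> ND0 K)}"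

definition Sn_local :: "interface_problem \<Rightarrow> plane set \<Rightarrow> scalar_field set" where
  "Sn_local P K = {v. \<exists>cp gp cm gm.
     (\<forall>x\<in>K_hp P K. v x = cp + gp \<bullet> x) \<and>
     (\<forall>x\<in>K_hm P K. v x = cm + gm \<bullet> x) \<and>
     (\<forall>x\<in>Gamma_h P K. cp + gp \<bullet> x = cm + gm \<bullet> x) \<and>
     beta_p P * (gp \<bullet> nbar P K) = beta_m P * (gm \<bullet> nbar P K)}"

definition grad_Sn_local :: "interface_problem \<Rightarrow> plane set \<Rightarrow> vector_field set" where
  "grad_Sn_local P K = {w. \<exists>v\<in>Sn_local P K. \<forall>x\<in>K_hp P K \<union> K_hm P K. GDERIV v x :> w x}"


section \<open>Projection, bilinear form and energy norm\<close>

definition proj :: "interface_problem \<Rightarrow> plane set \<Rightarrow> vector_field \<Rightarrow> vector_field" where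
  "proj P K u = (SOME w. w \<in> grad_Sn_local P K \<and>
     (\<forall>z\<in>grad_Sn_local P K.
        ip (interior K) (\<lambda>x. beta_h P K x *\<^sub>R w x) z =
        ip (interior K) (\<lambda>x. beta_h P K x *\<^sub>R u x) z))"

definition residual_trace :: "interface_problem \<Rightarrow> plane set \<Rightarrow> vector_field \<Rightarrow> scalar_field" where
  "residual_trace P K u = tangential_trace K (edges P K) (\<lambda>x. u x - proj P K u x)"

definition a_local :: "interface_problem \<Rightarrow> plane set \<Rightarrow> vector_field \<Rightarrow> vector_field \<Rightarrow> real" where
  "a_local P K u v =
     ip (interior K) (\<lambda>x. alpha_h P K x * weak_curl (interior K) u x) (weak_curl (interior K) v) +
     (if interface_element P K then
        ip (interior K) (\<lambda>x. beta_h P K x *\<^sub>R proj P K u x) (proj P K v) +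
        (\<Sum>e\<in>edges P K. beta_edge P K e *
           edge_ip e (residual_trace P K u) (residual_trace P K v))
      else ip (interior K) (\<lambda>x. beta_h P K x *\<^sub>R u x) v)"

definition a_h :: "interface_problem \<Rightarrow> plane set set \<Rightarrow> vector_field \<Rightarrow> vector_field \<Rightarrow> real" where
  "a_h P T u v = (\<Sum>K\<in>T. a_local P K u v)"

definition energy_norm :: "interface_problem \<Rightarrow> plane set set \<Rightarrow> vector_field \<Rightarrow> real" where
  "energy_norm P T v = sqrt (a_h P T v v)"

end

theory Submission
  imports Defs
begin

text \<open>
  Away from the interface the energy norm contains the square integrals of the field and of its curl,
  so everything happens on an interface triangle \<open>K\<close>. There the energy only sees the projection of
  \<open>v\<close>, its curl, and the tangential trace of the residual \<open>w\<close>, that is, of \<open>v\<close> minus its projection.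
  The task is to bound the residual itself by its curl and its trace, with a constant that does not
  depend on how the interface cuts \<open>K\<close>.

  The reason why this is possible is a duality argument. The field \<open>F = \<beta>\<^sub>h w\<close> is divergence free:
  \<open>\<beta>\<^sub>h v\<close> is so by definition of the space, and for the projection the normal flux is continuous
  across the cut. On the convex set \<open>K\<close> one has \<open>F = rotate (\<nabla>\<psi>)\<close> for a stream function \<open>\<psi>\<close>, and
  Green's formula gives
  \<open>\<integral>\<^sub>K F \<bullet> w = \<integral>\<^sub>K \<psi> curl w - \<integral>\<^bsub>\<partial>K\<^esub> \<psi> (w \<bullet> t)\<close>.
  After subtraction of a constant from \<open>\<psi>\<close>, the Poincare and the trace inequality bound \<open>\<psi>\<close> in \<open>K\<close>
  and on its boundary by \<open>\<nabla>\<psi>\<close>, that is, by \<open>F\<close>; the left-hand side controls \<open>F\<close> because \<open>\<beta>\<^sub>h\<close> is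
  bounded above and below. The cut enters through \<open>\<beta>\<^sub>h\<close> only, hence not at all into the constant. This
  is \<open>curl_and_trace_control\<close>; with the curl and the trace bounded by the energy it becomes
  \<open>local_estimate\<close>, and summation over the mesh gives the theorem.

  Since \<open>F\<close> is merely square integrable and the trace is defined by testing with functions that are
  continuously differentiable on the whole plane, \<open>\<psi>\<close> is replaced by approximations
  (\<open>divergence_free_approximation\<close>). They come from averaging \<open>F\<close> over small contracted copies of a disc
  inside \<open>K\<close>, which keeps the field divergence free and makes it smooth, and from integrating the
  result along rays. The same averages show that weak curls are unique.

  The trace of the residual only exists once the piecewise constant projection is known to have one.
  This is Green's formula for a field with a jump across a line and continuous tangential component
  (\<open>green_formula_ridge_field\<close>). It is reduced to Green's formula for constant fields on a triangle
  whose boundary is subdivided by finitely many nodes (\<open>green_formula\<close>), which also yields the trace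
  inequality.
\<close>


section \<open>Approximation in the mean square\<close>

lemma nn_integral_affine:
  fixes f :: "'a::euclidean_space \<Rightarrow> ennreal"
  assumes [measurable]: "f \<in> borel_measurable borel" and c: "c \<noteq> 0"
  shows "(\<integral>\<^sup>+x. f x \<partial>lborel) = ennreal (\<bar>c\<bar> ^ DIM('a)) * (\<integral>\<^sup>+x. f (t + c *\<^sub>R x) \<partial>lborel)"
  by (subst lborel_affine[OF c, of t])
     (simp add: nn_integral_density nn_integral_distr nn_integral_cmult)

lemma lborel_integrable_affine:
  fixes f :: "'a::euclidean_space \<Rightarrow> real"
  assumes f: "integrable lborel f" and c: "c \<noteq> 0"
  shows "integrable lborel (\<lambda>x. f (t + c *\<^sub>R x))"
  using f f[THEN borel_measurable_integrable] c unfolding integrable_iff_bounded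
  by (subst (asm) nn_integral_affine[where c=c and t=t]) (auto simp: ennreal_mult_less_top)

lemma lborel_integral_affine:
  fixes f :: "'a::euclidean_space \<Rightarrow> real"
  assumes c: "c \<noteq> 0" and f[measurable]: "integrable lborel f"
  shows "(LINT x|lborel. f x) = \<bar>c\<bar> ^ DIM('a) * (LINT x|lborel. f (t + c *\<^sub>R x))"
  using c f[THEN borel_measurable_integrable] lborel_integrable_affine[OF f c, of t]
  by (subst lborel_affine[OF c, of t]) (simp add: integral_density integral_distr)

lemma integral_lebesgue_on_borel:
  fixes f :: "'a::euclidean_space \<Rightarrow> real"
  assumes [measurable]: "f \<in> borel_measurable borel" "S \<in> sets borel"
  shows "(LINT x|lebesgue_on S. f x) = (LINT x|lborel. indicator S x * f x)"
  by (subst integral_restrict_space) (auto simp: integral_completion)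

lemma integrable_lebesgue_on_borel:
  fixes f :: "'a::euclidean_space \<Rightarrow> real"
  assumes [measurable]: "f \<in> borel_measurable borel" "S \<in> sets borel"
  shows "integrable (lebesgue_on S) f \<longleftrightarrow> integrable lborel (\<lambda>x. indicator S x * f x)"
  by (subst integrable_restrict_space) (auto simp: integrable_completion)

text \<open>A Borel representative on the whole space makes Fubini's theorem and affine substitutions
  available, which refer to the Borel measure \<open>lborel\<close>.\<close>

lemma L2_borel_representative:
  fixes f :: "'a::euclidean_space \<Rightarrow> real"
  assumes f: "L2 S f" and S[measurable]: "S \<in> sets borel"
  obtains f' where "f' \<in> borel_measurable borel" "AE x in lebesgue_on S. f x = f' x"
    "\<And>x. x \<notin> S \<Longrightarrow> f' x = 0" "integrable lborel (\<lambda>x. (f' x)\<^sup>2)"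
proof -
  have meas: "(\<lambda>x. indicator S x *\<^sub>R f x) \<in> borel_measurable lebesgue"
    using f by (auto simp: L2_def borel_measurable_restrict_space_iff)
  obtain g where g[measurable]: "g \<in> borel_measurable borel"
    and fg: "AE x in lborel. indicator S x *\<^sub>R f x = g x"
    using completion_ex_borel_measurable_real[OF meas] by auto
  define f' where "f' x = indicator S x * g x" for x
  have f'[measurable]: "f' \<in> borel_measurable borel" by (simp add: f'_def[abs_def])
  have "AE x in lebesgue. indicator S x *\<^sub>R f x = g x"
    using fg by (rule AE_completion)
  then have ae: "AE x in lebesgue_on S. f x = f' x"
    by (subst AE_restrict_space_iff) (auto simp: f'_def elim!: eventually_mono)
  have "integrable (lebesgue_on S) (\<lambda>x. (norm (f x))\<^sup>2)" using f by (simp add: L2_def)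
  then have "integrable (lebesgue_on S) (\<lambda>x. (f' x)\<^sup>2)"
    by (rule integrable_cong_AE_imp)
      (use ae in \<open>auto simp: measurable_restrict_space1 measurable_completion elim!: eventually_mono\<close>)
  then have "integrable lborel (\<lambda>x. indicator S x * (f' x)\<^sup>2)"
    by (subst (asm) integrable_lebesgue_on_borel) auto
  moreover have "(\<lambda>x. indicator S x * (f' x)\<^sup>2) = (\<lambda>x. (f' x)\<^sup>2)"
    by (auto simp: f'_def indicator_def)
  ultimately have "integrable lborel (\<lambda>x. (f' x)\<^sup>2)" by simp
  with f' ae show ?thesis by (intro that[of f']) (auto simp: f'_def)
qed

lemma square_sum2_le: "(a + b)\<^sup>2 \<le> 2 * a\<^sup>2 + 2 * (b::real)\<^sup>2"
  using sum_squares_bound[of a b] by (simp add: power2_sum)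

lemma square_sum3_le: "(a + b + c)\<^sup>2 \<le> 3 * a\<^sup>2 + 3 * b\<^sup>2 + 3 * (c::real)\<^sup>2"
  using sum_squares_bound[of a b] sum_squares_bound[of a c] sum_squares_bound[of b c]
  by (simp add: power2_sum algebra_simps power2_eq_square)

definition clip :: "real \<Rightarrow> real \<Rightarrow> real" where
  "clip m t = max (- m) (min m t)"

lemma clip_measurable[measurable]: "clip m \<in> borel_measurable borel"
  by (simp add: clip_def[abs_def])

lemma continuous_on_clip: "continuous_on A f \<Longrightarrow> continuous_on A (\<lambda>x. clip m (f x))"
  unfolding clip_def by (intro continuous_intros)

text \<open>Measurable functions are almost everywhere limits of continuous ones. Clipping both sides at a
  height at which little of the square integral is lost turns this into convergence in the mean
  square on bounded sets.\<close>

lemma continuous_dense_in_L2: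
  fixes f :: "'a::euclidean_space \<Rightarrow> real"
  assumes f[measurable]: "f \<in> borel_measurable borel" and int: "integrable lborel (\<lambda>x. (f x)\<^sup>2)"
    and S[measurable]: "S \<in> sets borel" and bS: "bounded S" and e: "e > 0"
  obtains g where "continuous_on UNIV g" "integrable lborel (\<lambda>x. indicator S x * (f x - g x)\<^sup>2)"
    "(LINT x|lborel. indicator S x * (f x - g x)\<^sup>2) < e"
proof -
  have iS: "integrable lborel (indicator S :: _ \<Rightarrow> real)"
    using bS by (intro integrable_real_indicator) (auto intro: emeasure_bounded_finite simp flip: infinity_ennreal_def)
  have sub: "(f x - clip (real n) (f x))\<^sup>2 \<le> (f x)\<^sup>2" for n x
    by (rule abs_le_square_iff[THEN iffD1]) (auto simp: clip_def)
  have "(\<lambda>n. LINT x|lborel. (f x - clip (real n) (f x))\<^sup>2) \<longlonglongrightarrow> (LINT x::'a|lborel. 0)"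
  proof (rule integral_dominated_convergence[OF _ _ int])
    show "AE x in lborel. (\<lambda>n. (f x - clip (real n) (f x))\<^sup>2) \<longlonglongrightarrow> 0"
    proof (rule AE_I2)
      fix x
      have "(f x - clip (real n) (f x))\<^sup>2 = 0" if "n \<ge> nat \<lceil>\<bar>f x\<bar>\<rceil>" for n
        using that by (auto simp: clip_def max_def min_def)
      then show "(\<lambda>n. (f x - clip (real n) (f x))\<^sup>2) \<longlonglongrightarrow> 0"
        by (intro tendsto_eventually eventually_sequentiallyI[of "nat \<lceil>\<bar>f x\<bar>\<rceil>"]) simp
    qed
  qed (auto simp: sub)
  then have "\<forall>\<^sub>F n in sequentially. (LINT x|lborel. (f x - clip (real n) (f x))\<^sup>2) < e / 4"
    using e by (intro order_tendstoD(2)) auto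
  then obtain n where n: "(LINT x|lborel. (f x - clip (real n) (f x))\<^sup>2) < e / 4"
    by (auto simp: eventually_at_top_linorder)
  define m where "m = real n"
  have m0: "m \<ge> 0" by (simp add: m_def)
  have "f measurable_on UNIV"
    by (intro lebesgue_measurable_imp_measurable_on) (auto simp: measurable_completion)
  then obtain N h where N: "negligible N" and h: "\<And>n::nat. continuous_on UNIV (h n)"
    and lim: "\<And>x. x \<notin> N \<Longrightarrow> (\<lambda>n. h n x) \<longlonglongrightarrow> f x"
    unfolding measurable_on_def by auto
  have hm[measurable]: "h n \<in> borel_measurable borel" for n
    using h by (rule borel_measurable_continuous_onI)
  have AEN: "AE x in lborel. x \<notin> N"
  proof -
    have "AE x in lebesgue. x \<notin> N"
      using N by (intro AE_not_in) (simp add: negligible_iff_null_sets)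
    then show ?thesis by (simp add: AE_completion_iff)
  qed
  have "(\<lambda>n. LINT x|lborel. indicator S x * (clip m (f x) - clip m (h n x))\<^sup>2) \<longlonglongrightarrow> (LINT x::'a|lborel. 0)"
  proof (rule integral_dominated_convergence[where w="\<lambda>x. (2 * m)\<^sup>2 * indicator S x"])
    show "integrable lborel (\<lambda>x. (2 * m)\<^sup>2 * indicator S x)" using iS by simp
    show "AE x in lborel. (\<lambda>n. indicator S x * (clip m (f x) - clip m (h n x))\<^sup>2) \<longlonglongrightarrow> 0"
      using AEN
    proof eventually_elim
      fix x assume "x \<notin> N"
      from lim[OF this] have "(\<lambda>n. indicator S x * (clip m (f x) - clip m (h n x))\<^sup>2) \<longlonglongrightarrow>
         indicator S x * (clip m (f x) - clip m (f x))\<^sup>2"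
        unfolding clip_def by (intro tendsto_intros)
      then show "(\<lambda>n. indicator S x * (clip m (f x) - clip m (h n x))\<^sup>2) \<longlonglongrightarrow> 0" by simp
    qed
    have "(clip m s - clip m t)\<^sup>2 \<le> (2 * m)\<^sup>2" for s t
      using m0 by (intro abs_le_square_iff[THEN iffD1]) (auto simp: clip_def)
    then show "AE x in lborel. norm (indicator S x * (clip m (f x) - clip m (h n x))\<^sup>2) \<le> (2 * m)\<^sup>2 * indicator S x" for n
      by (auto simp: indicator_def)
  qed auto
  then have "\<forall>\<^sub>F n in sequentially. (LINT x|lborel. indicator S x * (clip m (f x) - clip m (h n x))\<^sup>2) < e / 4"
    using e by (intro order_tendstoD(2)) auto
  then obtain k where k: "(LINT x|lborel. indicator S x * (clip m (f x) - clip m (h k x))\<^sup>2) < e / 4"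
    by (auto simp: eventually_at_top_linorder)
  let ?g = "\<lambda>x. clip m (h k x)"
  have i1: "integrable lborel (\<lambda>x. (f x - clip m (f x))\<^sup>2)"
    using sub by (intro Bochner_Integration.integrable_bound[OF int]) (auto simp: m_def)
  have i2: "integrable lborel (\<lambda>x. indicator S x * (clip m (f x) - ?g x)\<^sup>2)"
  proof (rule Bochner_Integration.integrable_bound[where f="\<lambda>x. (2 * m)\<^sup>2 * indicator S x"])
    have "(clip m s - clip m t)\<^sup>2 \<le> (2 * m)\<^sup>2" for s t
      using m0 by (intro abs_le_square_iff[THEN iffD1]) (auto simp: clip_def)
    then show "AE x in lborel. norm (indicator S x * (clip m (f x) - ?g x)\<^sup>2) \<le> norm ((2 * m)\<^sup>2 * indicator S x)"
      by (auto simp: indicator_def)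
  qed (use iS in auto)
  have le: "indicator S x * (f x - ?g x)\<^sup>2 \<le>
      2 * (f x - clip m (f x))\<^sup>2 + 2 * (indicator S x * (clip m (f x) - ?g x)\<^sup>2)" for x
    using square_sum2_le[of "f x - clip m (f x)" "clip m (f x) - ?g x"]
    by (auto simp: indicator_def)
  have i3: "integrable lborel (\<lambda>x. indicator S x * (f x - ?g x)\<^sup>2)"
    by (rule Bochner_Integration.integrable_bound[where
          f="\<lambda>x. 2 * (f x - clip m (f x))\<^sup>2 + 2 * (indicator S x * (clip m (f x) - ?g x)\<^sup>2)"])
      (use i1 i2 le in \<open>auto intro!: AE_I2 simp: abs_mult\<close>)
  have "(LINT x|lborel. indicator S x * (f x - ?g x)\<^sup>2) \<le>
      (LINT x|lborel. 2 * (f x - clip m (f x))\<^sup>2 + 2 * (indicator S x * (clip m (f x) - ?g x)\<^sup>2))"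
    by (rule integral_mono) (use i1 i2 i3 le in auto)
  also have "\<dots> < e" using n k i1 i2 by (simp add: m_def)
  finally show ?thesis using i3 continuous_on_clip[OF h] by (intro that[of ?g]) auto
qed

section \<open>Smoothing by contraction towards a point\<close>

text \<open>A nonnegative continuously differentiable kernel of total mass one, supported inside a bounded
  convex open set. The quadratic Taylor bound is what allows differentiation under the integral
  sign against functions that are merely integrable.\<close>

locale smoothing_kernel =
  fixes S :: "plane set" and k :: scalar_field and k' :: vector_field and L B :: real
  assumes open_S: "open S" and bounded_S: "bounded S" and convex_S: "convex S"
    and k_nonneg: "\<And>x. 0 \<le> k x" and k_le: "\<And>x. k x \<le> B" and k'_le: "\<And>x. norm (k' x) \<le> B"
    and k_C1: "C1_with_gradient k k'"
    and k_support: "compact_support_in S k"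
    and k_taylor: "\<And>x h. \<bar>k (x + h) - k x - k' x \<bullet> h\<bar> \<le> L * (norm h)\<^sup>2"
    and k_mass: "(LINT x|lborel. k x) = 1"

text \<open>The square of the positive part is just smooth enough: it has a Lipschitz continuous derivative,
  with explicit bounds.\<close>

definition bump :: "plane \<Rightarrow> real" where
  "bump x = (max 0 (1 - x \<bullet> x))\<^sup>2"

definition bump_grad :: "plane \<Rightarrow> plane" where
  "bump_grad x = (- 4 * max 0 (1 - x \<bullet> x)) *\<^sub>R x"

lemma max_square_taylor:
  fixes s d :: real
  shows "\<bar>(max 0 (s + d))\<^sup>2 - (max 0 s)\<^sup>2 - 2 * max 0 s * d\<bar> \<le> d\<^sup>2"
proof -
  consider "s \<ge> 0" "s + d \<ge> 0" | "s \<ge> 0" "s + d < 0" | "s < 0" "s + d \<ge> 0" | "s < 0" "s + d < 0"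
    by linarith
  then show ?thesis
  proof cases
    case 2
    have "(s + d)\<^sup>2 \<le> d\<^sup>2" using 2 by (intro abs_le_square_iff[THEN iffD1]) auto
    moreover have "- s\<^sup>2 - 2 * s * d = d\<^sup>2 - (s + d)\<^sup>2" by (simp add: power2_eq_square algebra_simps)
    moreover have "(s + d)\<^sup>2 \<ge> 0" by simp
    ultimately show ?thesis using 2 by (auto simp: abs_le_iff)
  next
    case 3
    have "(s + d)\<^sup>2 \<le> d\<^sup>2" using 3 by (intro abs_le_square_iff[THEN iffD1]) auto
    then show ?thesis using 3 by auto
  qed (auto simp: power2_eq_square algebra_simps)
qed

text \<open>Near the unit disc the Taylor bound of the squared positive part is used; further away both
  values and the gradient vanish.\<close>

lemma bump_taylor:
  assumes h: "norm h \<le> 1"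
  shows "\<bar>bump (x + h) - bump x - bump_grad x \<bullet> h\<bar> \<le> 100 * (norm h)\<^sup>2"
proof (cases "norm x \<le> 2")
  case True
  define d where "d = - (2 * (x \<bullet> h)) - h \<bullet> h"
  have e: "bump (x + h) - bump x - bump_grad x \<bullet> h =
      ((max 0 ((1 - x \<bullet> x) + d))\<^sup>2 - (max 0 (1 - x \<bullet> x))\<^sup>2 - 2 * max 0 (1 - x \<bullet> x) * d)
      - 2 * (max 0 (1 - x \<bullet> x) * (h \<bullet> h))"
    by (simp add: bump_def bump_grad_def d_def inner_add algebra_simps inner_commute)
  have "\<bar>d\<bar> \<le> 2 * (norm x * norm h) + norm h * norm h"
    using Cauchy_Schwarz_ineq2[of x h] by (simp add: d_def dot_square_norm power2_eq_square abs_le_iff) (smt (verit) zero_le_square)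
  also have "\<dots> \<le> 2 * (2 * norm h) + 1 * norm h"
    using True h by (intro add_mono mult_left_mono mult_right_mono) auto
  finally have "\<bar>d\<bar> \<le> 5 * norm h" by simp
  then have "\<bar>d\<bar>\<^sup>2 \<le> (5 * norm h)\<^sup>2" by (intro power_mono) auto
  then have d2: "d\<^sup>2 \<le> 25 * (norm h)\<^sup>2" by (simp add: power_mult_distrib)
  have "max 0 (1 - x \<bullet> x) * (h \<bullet> h) \<le> 1 * (h \<bullet> h)"
    by (intro mult_right_mono) auto
  moreover have "0 \<le> max 0 (1 - x \<bullet> x) * (h \<bullet> h)" by simp
  moreover have "\<bar>a - 2 * b\<bar> \<le> 100 * c" if "\<bar>a\<bar> \<le> d\<^sup>2" "0 \<le> b" "b \<le> 1 * c" "d\<^sup>2 \<le> 25 * c" for a b c :: real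
    using that by linarith
  ultimately show ?thesis
    using max_square_taylor[of "1 - x \<bullet> x" d] d2 unfolding e dot_square_norm[of h] by blast
next
  case False
  have "norm (x + h) \<ge> 1" using False h norm_triangle_ineq4[of "x + h" h] by simp
  then have "(x + h) \<bullet> (x + h) \<ge> 1" by (simp add: dot_square_norm one_le_power)
  moreover have "x \<bullet> x \<ge> 1" using False by (simp add: dot_square_norm one_le_power)
  ultimately show ?thesis by (simp add: bump_def bump_grad_def)
qed

lemma bump_grad_le: "norm (bump_grad x) \<le> 4"
proof (cases "norm x \<le> 1")
  case True
  have "max 0 (1 - x \<bullet> x) * norm x \<le> 1 * 1" using True by (intro mult_mono) auto
  then show ?thesis by (simp add: bump_grad_def)
next
  case False
  then have "x \<bullet> x \<ge> 1" by (simp add: dot_square_norm one_le_power)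
  then show ?thesis by (simp add: bump_grad_def)
qed

lemma bump_bounds: "0 \<le> bump x" "bump x \<le> 1"
  by (auto simp: bump_def intro!: power_le_one)

lemma bump_taylor_global: "\<bar>bump (x + h) - bump x - bump_grad x \<bullet> h\<bar> \<le> 100 * (norm h)\<^sup>2"
proof (cases "norm h \<le> 1")
  case False
  have "\<bar>bump_grad x \<bullet> h\<bar> \<le> 4 * norm h"
    using Cauchy_Schwarz_ineq2[of "bump_grad x" h] mult_right_mono[OF bump_grad_le, of "norm h" x] by simp
  then have "\<bar>bump (x + h) - bump x - bump_grad x \<bullet> h\<bar> \<le> 1 + 4 * norm h"
    using bump_bounds[of x] bump_bounds[of "x + h"] by (auto simp: abs_le_iff)
  also have "\<dots> \<le> 5 * norm h" using False by simp
  also have "\<dots> \<le> 100 * (norm h)\<^sup>2"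
    using False mult_right_mono[of 1 "norm h" "norm h"] by (simp add: power2_eq_square)
  finally show ?thesis .
qed (rule bump_taylor)

lemma continuous_bump: "continuous_on UNIV bump" "continuous_on UNIV bump_grad"
  unfolding bump_def[abs_def] bump_grad_def[abs_def] by (intro continuous_intros)+

lemma has_derivative_of_quadratic_remainder:
  fixes f :: "'a::real_normed_vector \<Rightarrow> 'b::real_normed_vector"
  assumes lin: "bounded_linear D" and rem: "\<And>h. norm (f (x + h) - f x - D h) \<le> L * (norm h)\<^sup>2"
  shows "(f has_derivative D) (at x)"
  unfolding has_derivative_at
proof (intro conjI lin)
  have "(\<lambda>h. norm (f (x + h) - f x - D h) / norm h) \<midarrow>0\<rightarrow> 0"
  proof (rule Lim_null_comparison[where g="\<lambda>h. L * norm h"])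
    show "\<forall>\<^sub>F h in at 0. norm (norm (f (x + h) - f x - D h) / norm h) \<le> L * norm h"
      using rem by (intro always_eventually) (auto simp: divide_simps power2_eq_square mult.assoc)
    show "(\<lambda>h::'a. L * norm h) \<midarrow>0\<rightarrow> 0"
      by (auto intro!: tendsto_eq_intros)
  qed
  then show "(\<lambda>h. norm (f (x + h) - f x - D h) / norm h) \<midarrow>0\<rightarrow> 0" .
qed

lemma GDERIV_of_quadratic_remainder:
  assumes "\<And>h. \<bar>f (x + h) - f x - g \<bullet> h\<bar> \<le> L * (norm h)\<^sup>2"
  shows "GDERIV f x :> (g :: 'a::real_inner)"
  unfolding gderiv_def
  by (rule has_derivative_of_quadratic_remainder[where L=L])
     (use assms in \<open>auto simp: inner_commute intro: bounded_linear_inner_left\<close>)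

lemma smoothing_kernel_exists:
  fixes S :: "plane set"
  assumes S: "open S" "bounded S" "convex S" and c: "ball c r \<subseteq> S" "r > 0"
  obtains k k' L B where "smoothing_kernel S k k' L B"
proof -
  define s where "s = r / 2"
  have s: "s > 0" using c by (simp add: s_def)
  define b where "b x = bump ((x - c) /\<^sub>R s)" for x
  have cont: "continuous_on UNIV b"
    unfolding b_def by (intro continuous_on_compose2[OF continuous_bump(1)] continuous_intros) auto
  have out: "b x = 0" if "x \<notin> cball c s" for x
  proof -
    have "norm ((x - c) /\<^sub>R s) = dist c x / s" using s by (simp add: dist_norm norm_minus_commute divide_inverse_commute)
    then have "norm ((x - c) /\<^sub>R s) \<ge> 1" using that s by simp
    then have "((x - c) /\<^sub>R s) \<bullet> ((x - c) /\<^sub>R s) \<ge> 1" by (subst dot_square_norm) (simp add: one_le_power)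
    then show ?thesis by (simp only: b_def bump_def) simp
  qed
  have cs: "closure {x. b x \<noteq> 0} \<subseteq> cball c s"
    using out by (intro closure_minimal) (auto simp del: mem_cball)
  have sub: "cball c s \<subseteq> S" using c by (auto simp: s_def subset_iff)
  have bpos: "b x \<ge> 0" for x using bump_bounds by (simp add: b_def)
  have int: "integrable lborel b"
  proof -
    have "integrable lborel (\<lambda>x. indicator (cball c s) x *\<^sub>R b x)"
      using cont by (intro borel_integrable_compact continuous_on_subset[OF cont]) auto
    moreover have "(\<lambda>x. indicator (cball c s) x *\<^sub>R b x) = b"
      using out by (intro ext) (auto simp: indicator_def simp del: mem_cball)
    ultimately show ?thesis by simp
  qed
  define m where "m = (LINT x|lborel. b x)"
  have m: "m > 0"
  proof -
    have "m \<noteq> 0"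
    proof
      assume "m = 0"
      then have "AE x in lborel. b x = 0"
        unfolding m_def by (subst (asm) integral_nonneg_eq_0_iff_AE[OF int]) (use bpos in auto)
      then have "AE x in lborel. x \<notin> ball c s"
      proof eventually_elim
        fix x assume b0: "b x = 0"
        show "x \<notin> ball c s"
        proof
          assume "x \<in> ball c s"
          moreover have "norm ((x - c) /\<^sub>R s) = dist c x / s" using s by (simp add: dist_norm norm_minus_commute divide_inverse_commute)
          ultimately have "norm ((x - c) /\<^sub>R s) < 1" using s by simp
          then have "((x - c) /\<^sub>R s) \<bullet> ((x - c) /\<^sub>R s) < 1" 
            by (subst dot_square_norm) (simp add: power_less_one_iff)
          moreover have "(max 0 (1 - q))\<^sup>2 \<noteq> 0" if "q < 1" for q :: real using that by simp
          ultimately have "b x \<noteq> 0" unfolding b_def bump_def by blast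
          then show False using b0 by simp
        qed
      qed
      then have "emeasure lborel (ball c s) = 0"
        by (subst (asm) AE_iff_measurable[where N="ball c s"]) auto
      then have "ball c s \<in> null_sets lebesgue" by (auto intro: null_sets_completionI)
      then have "negligible (ball c s)" by (simp add: negligible_iff_null_sets)
      then show False using s open_not_negligible[of "ball c s"] by auto
    qed
    moreover have "m \<ge> 0" unfolding m_def using bpos by simp
    ultimately show ?thesis by simp
  qed
  define k where "k x = b x / m" for x
  define k' where "k' x = (1 / (m * s)) *\<^sub>R bump_grad ((x - c) /\<^sub>R s)" for x
  have tay: "\<bar>k (x + h) - k x - k' x \<bullet> h\<bar> \<le> (100 / (m * s\<^sup>2)) * (norm h)\<^sup>2" for x h
  proof -
    have "k (x + h) - k x - k' x \<bullet> h =
      (bump ((x - c) /\<^sub>R s + h /\<^sub>R s) - bump ((x - c) /\<^sub>R s) - bump_grad ((x - c) /\<^sub>R s) \<bullet> (h /\<^sub>R s)) / m"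
      using m s by (simp add: k_def b_def k'_def field_simps scaleR_diff_right scaleR_add_right)
    also have "\<bar>\<dots>\<bar> \<le> 100 * (norm (h /\<^sub>R s))\<^sup>2 / m"
      using bump_taylor_global[of "(x - c) /\<^sub>R s" "h /\<^sub>R s"] m by (simp add: divide_right_mono)
    also have "\<dots> = (100 / (m * s\<^sup>2)) * (norm h)\<^sup>2"
      using m s by (simp add: power_mult_distrib field_simps)
    finally show ?thesis .
  qed
  define B where "B = max (1 / m) (4 / (m * s))"
  have "smoothing_kernel S k k' (100 / (m * s\<^sup>2)) B"
  proof
    show "0 \<le> k x" for x using bpos m by (simp add: k_def)
    have "k x \<le> 1 / m" for x using bump_bounds m by (simp add: k_def b_def divide_right_mono)
    then show "k x \<le> B" for x by (simp add: B_def le_max_iff_disj)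
    have "norm (k' x) \<le> 4 / (m * s)" for x
      using bump_grad_le[of "(x - c) /\<^sub>R s"] m s by (simp add: k'_def divide_right_mono)
    then show "norm (k' x) \<le> B" for x by (simp add: B_def le_max_iff_disj)
    show "C1_with_gradient k k'"
      unfolding C1_with_gradient_def
    proof (intro conjI allI)
      show "GDERIV k x :> k' x" for x by (rule GDERIV_of_quadratic_remainder[OF tay])
      show "continuous_on UNIV k'"
        unfolding k'_def by (intro continuous_on_scaleR continuous_on_const continuous_on_compose2[OF continuous_bump(2)] continuous_intros) auto
    qed
    have "{x. k x \<noteq> 0} = {x. b x \<noteq> 0}" using m by (auto simp: k_def)
    then show "compact_support_in S k"
      using cs sub bounded_subset[OF bounded_cball cs]
      by (simp only: compact_support_in_def compact_eq_bounded_closed closed_closure) blast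
    show "(LINT x|lborel. k x) = 1" using m by (simp add: k_def m_def)
  qed (use S tay in auto)
  then show ?thesis by (rule that)
qed

context smoothing_kernel
begin

lemma k_continuous: "continuous_on UNIV k"
  using k_C1 unfolding C1_with_gradient_def
  by (auto simp: continuous_on_eq_continuous_at gderiv_def intro: has_derivative_continuous)

lemma k'_continuous: "continuous_on UNIV k'"
  using k_C1 unfolding C1_with_gradient_def by simp

lemma k_measurable[measurable]: "k \<in> borel_measurable borel" "k' \<in> borel_measurable borel"
  using k_continuous k'_continuous by (auto intro: borel_measurable_continuous_onI)

lemma S_measurable[measurable]: "S \<in> sets borel" using open_S by simp

lemma k_integrable: "integrable lborel k"
  using k_mass not_integrable_integral_eq by fastforce

lemma k_zero: "x \<notin> S \<Longrightarrow> k x = 0"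
  using k_support closure_subset[of "{x. k x \<noteq> 0}"] by (auto simp: compact_support_in_def)

lemma S_integrable: "integrable lborel (indicator S :: plane \<Rightarrow> real)"
  using bounded_S by (intro integrable_real_indicator)
    (auto intro: emeasure_bounded_finite simp flip: infinity_ennreal_def)

text \<open>The mean of \<open>f\<close> over points between \<open>x\<close> and the support of the kernel. For \<open>l\<close> close to one
  they are close to \<open>x\<close>, and by convexity they stay in \<open>S\<close> when \<open>x\<close> is there. So, in contrast to a
  convolution, values of \<open>f\<close> outside \<open>S\<close> never enter at points of \<open>S\<close>, up to the boundary.\<close>

definition smooth :: "real \<Rightarrow> scalar_field \<Rightarrow> scalar_field" where
  "smooth l f x = (LINT z|lborel. f (l *\<^sub>R x + (1 - l) *\<^sub>R z) * k z)"

definition square_integrable :: "scalar_field \<Rightarrow> bool" where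
  "square_integrable f \<longleftrightarrow> f \<in> borel_measurable borel \<and> integrable lborel (\<lambda>x. (f x)\<^sup>2)"

lemma square_integrable_affine:
  assumes "square_integrable f" "c \<noteq> 0"
  shows "square_integrable (\<lambda>x. f (t + c *\<^sub>R x))"
proof -
  have [measurable]: "f \<in> borel_measurable borel" using assms by (simp add: square_integrable_def)
  show ?thesis using assms lborel_integrable_affine[of "\<lambda>x. (f x)\<^sup>2" c t]
    by (auto simp: square_integrable_def)
qed

lemma abs_le_square_plus_one: "\<bar>a::real\<bar> \<le> a\<^sup>2 + 1"
  using sum_squares_bound[of "\<bar>a\<bar>" 1] zero_le_power2[of a] by (simp del: zero_le_power2)

lemma square_integrable_times_k:
  assumes f: "square_integrable f"
  shows "integrable lborel (\<lambda>z. f z * k z)" "integrable lborel (\<lambda>z. (f z)\<^sup>2 * k z)"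
proof -
  have fm[measurable]: "f \<in> borel_measurable borel" using f by (simp add: square_integrable_def)
  show i2: "integrable lborel (\<lambda>z. (f z)\<^sup>2 * k z)"
  proof (rule Bochner_Integration.integrable_bound[where f="\<lambda>z. B * (f z)\<^sup>2"])
    show "integrable lborel (\<lambda>z. B * (f z)\<^sup>2)" using f by (simp add: square_integrable_def)
    show "AE z in lborel. norm ((f z)\<^sup>2 * k z) \<le> norm (B * (f z)\<^sup>2)"
    proof (rule AE_I2)
      fix z
      have "(f z)\<^sup>2 * k z \<le> B * (f z)\<^sup>2" using k_le by (subst mult.commute) (intro mult_right_mono, auto)
      moreover have "0 \<le> (f z)\<^sup>2 * k z" using k_nonneg by simp
      ultimately show "norm ((f z)\<^sup>2 * k z) \<le> norm (B * (f z)\<^sup>2)" by simp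
    qed
  qed simp
  show "integrable lborel (\<lambda>z. f z * k z)"
  proof (rule Bochner_Integration.integrable_bound[where f="\<lambda>z. (f z)\<^sup>2 * k z + k z"])
    show "integrable lborel (\<lambda>z. (f z)\<^sup>2 * k z + k z)" using i2 k_integrable by simp
    show "AE z in lborel. norm (f z * k z) \<le> norm ((f z)\<^sup>2 * k z + k z)"
    proof (rule AE_I2)
      fix z
      have "\<bar>f z\<bar> * k z \<le> ((f z)\<^sup>2 + 1) * k z"
        using abs_le_square_plus_one k_nonneg by (intro mult_right_mono)
      then show "norm (f z * k z) \<le> norm ((f z)\<^sup>2 * k z + k z)"
        using k_nonneg[of z] by (simp add: abs_mult algebra_simps)
    qed
  qed simp
qed

lemma smooth_integrable:
  assumes "square_integrable f" "l < 1"
  shows "integrable lborel (\<lambda>z. f (l *\<^sub>R x + (1 - l) *\<^sub>R z) * k z)"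
    "integrable lborel (\<lambda>z. (f (l *\<^sub>R x + (1 - l) *\<^sub>R z))\<^sup>2 * k z)"
  using square_integrable_times_k[OF square_integrable_affine[OF assms(1), of "1 - l" "l *\<^sub>R x"]] assms(2)
  by auto

lemma smooth_measurable[measurable]:
  assumes [measurable]: "f \<in> borel_measurable borel"
  shows "smooth l f \<in> borel_measurable borel"
  unfolding smooth_def[abs_def] by measurable

lemma smooth_diff:
  assumes "square_integrable f" "square_integrable g" "l < 1"
  shows "smooth l (\<lambda>x. f x - g x) x = smooth l f x - smooth l g x"
  unfolding smooth_def using smooth_integrable(1)[OF assms(1,3)] smooth_integrable(1)[OF assms(2,3)]
  by (subst Bochner_Integration.integral_diff[symmetric]) (auto simp: algebra_simps)

text \<open>Jensen's inequality for the probability density \<open>k\<close>.\<close>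

lemma smooth_square_le:
  assumes f: "square_integrable f" and l: "l < 1"
  shows "(smooth l f x)\<^sup>2 \<le> (LINT z|lborel. (f (l *\<^sub>R x + (1 - l) *\<^sub>R z))\<^sup>2 * k z)"
proof -
  let ?h = "\<lambda>z. f (l *\<^sub>R x + (1 - l) *\<^sub>R z)"
  let ?m = "smooth l f x"
  note i = smooth_integrable[OF f l, of x] k_integrable
  have "0 \<le> (LINT z|lborel. (?h z - ?m)\<^sup>2 * k z)" using k_nonneg by simp
  also have "(\<lambda>z. (?h z - ?m)\<^sup>2 * k z) = (\<lambda>z. (?h z)\<^sup>2 * k z - 2 * ?m * (?h z * k z) + ?m\<^sup>2 * k z)"
    by (auto simp: power2_eq_square algebra_simps)
  also have "(LINT z|lborel. (?h z)\<^sup>2 * k z - 2 * ?m * (?h z * k z) + ?m\<^sup>2 * k z) =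
      (LINT z|lborel. (?h z)\<^sup>2 * k z) - 2 * ?m * (LINT z|lborel. ?h z * k z) + ?m\<^sup>2 * (LINT z|lborel. k z)"
    using i by simp
  also have "\<dots> = (LINT z|lborel. (?h z)\<^sup>2 * k z) - ?m\<^sup>2"
    using k_mass by (simp add: smooth_def power2_eq_square)
  finally show ?thesis by simp
qed

text \<open>After Jensen's inequality and exchange of the integrals, the inner integral is that of a function
  dilated by the factor \<open>l\<close>, which costs \<open>1 / l\<^sup>2 \<le> 4\<close>.\<close>

lemma smooth_L2_bound:
  assumes f: "square_integrable f" and l: "1 / 2 \<le> l" "l < 1"
  shows "square_integrable (smooth l f)"
    "(LINT x|lborel. (smooth l f x)\<^sup>2) \<le> 4 * (LINT x|lborel. (f x)\<^sup>2)"
proof -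
  have fm[measurable]: "f \<in> borel_measurable borel" using f by (simp add: square_integrable_def)
  have if2: "integrable lborel (\<lambda>x. (f x)\<^sup>2)" using f by (simp add: square_integrable_def)
  let ?F = "\<integral>\<^sup>+x. ennreal ((f x)\<^sup>2) \<partial>lborel"
  have F: "?F = ennreal (LINT x|lborel. (f x)\<^sup>2)"
    using if2 by (simp add: nn_integral_eq_integral)
  have inner: "(\<integral>\<^sup>+x. ennreal ((f (l *\<^sub>R x + (1 - l) *\<^sub>R z))\<^sup>2) \<partial>lborel) \<le> 4 * ?F" for z
  proof -
    have eq: "?F = ennreal (\<bar>l\<bar> ^ DIM(plane)) * (\<integral>\<^sup>+x. ennreal ((f ((1 - l) *\<^sub>R z + l *\<^sub>R x))\<^sup>2) \<partial>lborel)"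
      using l by (intro nn_integral_affine) auto
    have l2: "1 \<le> 4 * l\<^sup>2" using l power_mono[of "1/2" l 2] by (simp add: power2_eq_square)
    have "(\<integral>\<^sup>+x. ennreal ((f (l *\<^sub>R x + (1 - l) *\<^sub>R z))\<^sup>2) \<partial>lborel) =
        1 * (\<integral>\<^sup>+x. ennreal ((f ((1 - l) *\<^sub>R z + l *\<^sub>R x))\<^sup>2) \<partial>lborel)"
      by (simp add: add.commute)
    also have "\<dots> \<le> ennreal (4 * l\<^sup>2) * (\<integral>\<^sup>+x. ennreal ((f ((1 - l) *\<^sub>R z + l *\<^sub>R x))\<^sup>2) \<partial>lborel)"
      using l2 by (intro mult_right_mono) (auto simp flip: ennreal_1 intro: ennreal_leI)
    also have "\<dots> = 4 * ?F"
      using l unfolding eq by (simp add: ennreal_mult' mult.assoc)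
    finally show ?thesis .
  qed
  have "(\<integral>\<^sup>+x. ennreal ((smooth l f x)\<^sup>2) \<partial>lborel) \<le>
      (\<integral>\<^sup>+x. (\<integral>\<^sup>+z. ennreal ((f (l *\<^sub>R x + (1 - l) *\<^sub>R z))\<^sup>2) * ennreal (k z) \<partial>lborel) \<partial>lborel)"
  proof (rule nn_integral_mono)
    fix x
    have "ennreal ((smooth l f x)\<^sup>2) \<le> ennreal (LINT z|lborel. (f (l *\<^sub>R x + (1 - l) *\<^sub>R z))\<^sup>2 * k z)"
      using smooth_square_le[OF f l(2)] by (rule ennreal_leI)
    also have "\<dots> = (\<integral>\<^sup>+z. ennreal ((f (l *\<^sub>R x + (1 - l) *\<^sub>R z))\<^sup>2 * k z) \<partial>lborel)"
      using smooth_integrable(2)[OF f l(2)] k_nonneg by (intro nn_integral_eq_integral[symmetric]) auto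
    finally show "ennreal ((smooth l f x)\<^sup>2) \<le>
        (\<integral>\<^sup>+z. ennreal ((f (l *\<^sub>R x + (1 - l) *\<^sub>R z))\<^sup>2) * ennreal (k z) \<partial>lborel)"
      using k_nonneg by (simp add: ennreal_mult)
  qed
  also have "\<dots> = (\<integral>\<^sup>+z. (\<integral>\<^sup>+x. ennreal ((f (l *\<^sub>R x + (1 - l) *\<^sub>R z))\<^sup>2) * ennreal (k z) \<partial>lborel) \<partial>lborel)"
    by (rule lborel_pair.Fubini') measurable
  also have "\<dots> = (\<integral>\<^sup>+z. (\<integral>\<^sup>+x. ennreal ((f (l *\<^sub>R x + (1 - l) *\<^sub>R z))\<^sup>2) \<partial>lborel) * ennreal (k z) \<partial>lborel)"
    by (intro nn_integral_cong nn_integral_multc) measurable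
  also have "\<dots> \<le> (\<integral>\<^sup>+z. (4 * ?F) * ennreal (k z) \<partial>lborel)"
    using inner by (intro nn_integral_mono mult_right_mono) auto
  also have "\<dots> = 4 * ?F * (\<integral>\<^sup>+z. ennreal (k z) \<partial>lborel)"
    by (rule nn_integral_cmult) simp
  also have "\<dots> = 4 * ?F"
    using k_mass k_integrable k_nonneg by (simp add: nn_integral_eq_integral)
  finally have le: "(\<integral>\<^sup>+x. ennreal ((smooth l f x)\<^sup>2) \<partial>lborel) \<le> 4 * ?F" .
  have i: "integrable lborel (\<lambda>x. (smooth l f x)\<^sup>2)"
    unfolding integrable_iff_bounded using le
    by (auto simp: F ennreal_mult_less_top intro!: le_less_trans[OF le])
  then show "square_integrable (smooth l f)" by (simp add: square_integrable_def)
  have "ennreal (LINT x|lborel. (smooth l f x)\<^sup>2) \<le> ennreal (4 * (LINT x|lborel. (f x)\<^sup>2))"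
    using le nn_integral_eq_integral[OF i] by (simp add: F ennreal_mult')
  then show "(LINT x|lborel. (smooth l f x)\<^sup>2) \<le> 4 * (LINT x|lborel. (f x)\<^sup>2)"
    by (subst (asm) ennreal_le_iff) auto
qed

text \<open>The smoothing only averages over points that are close to the given one and, by convexity, remain
  in \<open>S\<close>, where \<open>g\<close> is uniformly continuous.\<close>

lemma smooth_uniform:
  assumes g: "continuous_on UNIV g" and e: "e > 0"
  shows "\<forall>\<^sub>F l in at_left 1. \<forall>x\<in>S. \<bar>smooth l (\<lambda>y. indicator S y * g y) x - g x\<bar> \<le> e"
proof -
  have "compact (closure S)" using bounded_S by (simp add: compact_closure)
  then have "uniformly_continuous_on (closure S) g"
    using g by (intro compact_uniformly_continuous continuous_on_subset[OF g]) auto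
  then obtain d where d: "d > 0"
    and close: "\<And>x y. x \<in> closure S \<Longrightarrow> y \<in> closure S \<Longrightarrow> dist x y < d \<Longrightarrow> dist (g x) (g y) < e"
    unfolding uniformly_continuous_on_def using e by metis
  obtain R where R: "R > 0" "\<And>x. x \<in> S \<Longrightarrow> norm x \<le> R"
    using bounded_S unfolding bounded_pos by auto
  define \<delta> where "\<delta> = min (1/2) (d / (3 * R))"
  have \<delta>: "\<delta> > 0" using d R by (simp add: \<delta>_def)
  have main: "\<bar>smooth l (\<lambda>y. indicator S y * g y) x - g x\<bar> \<le> e" if l: "1 - \<delta> < l" "l < 1" and x: "x \<in> S" for l x
  proof -
    let ?y = "\<lambda>z. l *\<^sub>R x + (1 - l) *\<^sub>R z"
    have yS: "?y z \<in> S" if "z \<in> S" for z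
      using convexD[OF convex_S x that, of l "1 - l"] l by (auto simp: \<delta>_def)
    have yd: "dist (?y z) x < d" if z: "z \<in> S" for z
    proof -
      have "?y z - x = (1 - l) *\<^sub>R (z - x)" by (simp add: algebra_simps)
      then have "dist (?y z) x = (1 - l) * norm (z - x)" using l by (simp add: dist_norm)
      also have "\<dots> \<le> (1 - l) * (2 * R)"
        using R(2)[OF x] R(2)[OF z] norm_triangle_ineq4[of z x] l by (intro mult_left_mono) auto
      also have "\<dots> \<le> \<delta> * (2 * R)" using l R by (intro mult_right_mono) auto
      also have "\<dots> \<le> d / (3 * R) * (2 * R)" using R by (intro mult_right_mono) (auto simp: \<delta>_def)
      also have "\<dots> < d" using d R by simp
      finally show ?thesis .
    qed
    have b: "\<bar>(indicator S (?y z) * g (?y z) - g x) * k z\<bar> \<le> e * k z" for z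
    proof (cases "z \<in> S")
      case True
      then have "\<bar>g (?y z) - g x\<bar> < e"
        using close[of "?y z" x] yS yd x closure_subset by (auto simp: dist_real_def)
      then show ?thesis using yS[OF True] k_nonneg[of z] by (auto simp: abs_mult intro: mult_right_mono)
    qed (simp add: k_zero)
    have [measurable]: "g \<in> borel_measurable borel" using g by (rule borel_measurable_continuous_onI)
    have i: "integrable lborel (\<lambda>z. (indicator S (?y z) * g (?y z) - g x) * k z)"
      by (rule Bochner_Integration.integrable_bound[where f="\<lambda>z. e * k z"])
        (use b k_integrable k_nonneg e in \<open>auto intro!: AE_I2 simp: abs_mult\<close>)
    then have "integrable lborel (\<lambda>z. (indicator S (?y z) * g (?y z) - g x) * k z + g x * k z)"
      using k_integrable by simp
    then have i': "integrable lborel (\<lambda>z. indicator S (?y z) * g (?y z) * k z)"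
      by (simp add: algebra_simps)
    have "smooth l (\<lambda>y. indicator S y * g y) x - g x =
        (LINT z|lborel. indicator S (?y z) * g (?y z) * k z) - (LINT z|lborel. g x * k z)"
      using k_mass by (simp add: smooth_def)
    also have "\<dots> = (LINT z|lborel. (indicator S (?y z) * g (?y z) - g x) * k z)"
      using i' k_integrable by (subst Bochner_Integration.integral_diff[symmetric]) (auto simp: algebra_simps)
    also have "\<bar>\<dots>\<bar> \<le> (LINT z|lborel. e * k z)"
      using i k_integrable b by (intro order_trans[OF integral_abs_bound] integral_mono) auto
    also have "\<dots> = e" using k_mass by simp
    finally show ?thesis .
  qed
  show ?thesis unfolding eventually_at_left_field using \<delta> main
    by (intro exI[of _ "1 - \<delta>"]) auto
qed

text \<open>By density it suffices that the smoothing converges on continuous functions and is bounded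
  uniformly in \<open>l\<close>.\<close>

lemma smooth_tendsto_L2:
  assumes f: "square_integrable f" and f0: "\<And>x. x \<notin> S \<Longrightarrow> f x = 0"
  shows "((\<lambda>l. LINT x|lborel. indicator S x * (smooth l f x - f x)\<^sup>2) \<longlongrightarrow> 0) (at_left 1)"
proof (rule tendstoI)
  fix e :: real assume e: "e > 0"
  have fm[measurable]: "f \<in> borel_measurable borel" and if2: "integrable lborel (\<lambda>x. (f x)\<^sup>2)"
    using f by (auto simp: square_integrable_def)
  define M where "M = measure lborel S"
  have M0: "M \<ge> 0" by (simp add: M_def)
  obtain g where g: "continuous_on UNIV g"
    and ig: "integrable lborel (\<lambda>x. indicator S x * (f x - g x)\<^sup>2)"
    and ge: "(LINT x|lborel. indicator S x * (f x - g x)\<^sup>2) < e / 30"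
    using continuous_dense_in_L2[OF fm if2 S_measurable bounded_S, of "e / 30"] e by auto
  have gm[measurable]: "g \<in> borel_measurable borel" using g by (rule borel_measurable_continuous_onI)
  define g0 where "g0 x = indicator S x * g x" for x
  define d where "d x = f x - g0 x" for x
  have [measurable]: "g0 \<in> borel_measurable borel" unfolding g0_def[abs_def] by measurable
  have d2: "(\<lambda>x. (d x)\<^sup>2) = (\<lambda>x. indicator S x * (f x - g x)\<^sup>2)"
    using f0 by (auto simp: d_def g0_def indicator_def)
  have sd: "square_integrable d"
    using ig unfolding square_integrable_def d2[symmetric] by (auto simp: d_def[abs_def])
  have sg: "square_integrable g0"
  proof -
    have "integrable lborel (\<lambda>x. 2 * (f x)\<^sup>2 + 2 * (d x)\<^sup>2)" using if2 sd by (simp add: square_integrable_def)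
    then have "integrable lborel (\<lambda>x. (g0 x)\<^sup>2)"
      by (rule Bochner_Integration.integrable_bound)
        (use square_sum2_le[of "f x" "- d x" for x] in \<open>auto intro!: AE_I2 simp: d_def power2_commute\<close>)
    then show ?thesis by (simp add: square_integrable_def)
  qed
  define \<delta> where "\<delta> = sqrt (e / (30 * (M + 1)))"
  have \<delta>: "\<delta> > 0" "\<delta>\<^sup>2 = e / (30 * (M + 1))" using e M0 by (auto simp: \<delta>_def)
  have "\<delta>\<^sup>2 * M \<le> \<delta>\<^sup>2 * (M + 1)" by (intro mult_left_mono) auto
  also have "\<dots> = e / 30" using M0 unfolding \<delta>(2) by (simp add: field_simps)
  finally have dM: "\<delta>\<^sup>2 * M \<le> e / 30" .
  have "\<forall>\<^sub>F l in at_left 1. 1/2 < l \<and> l < 1 \<and> (\<forall>x\<in>S. \<bar>smooth l g0 x - g x\<bar> \<le> \<delta>)"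
    using smooth_uniform[OF g \<delta>(1)] eventually_at_left_real[of "1/2" "1::real"]
    unfolding g0_def by (auto elim: eventually_elim2)
  then show "\<forall>\<^sub>F l in at_left 1. dist (LINT x|lborel. indicator S x * (smooth l f x - f x)\<^sup>2) 0 < e"
  proof eventually_elim
    case (elim l)
    then have l: "1/2 \<le> l" "l < 1" and u: "\<And>x. x \<in> S \<Longrightarrow> \<bar>smooth l g0 x - g x\<bar> \<le> \<delta>" by auto
    let ?R = "\<lambda>x. 3 * (smooth l d x)\<^sup>2 + 3 * \<delta>\<^sup>2 * indicator S x + 3 * (d x)\<^sup>2"
    have pt: "indicator S x * (smooth l f x - f x)\<^sup>2 \<le> ?R x" for x
    proof (cases "x \<in> S")
      case True
      have "smooth l f x - f x = smooth l d x + (smooth l g0 x - g x) + - d x"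
        using True smooth_diff[OF f sg l(2), of x] by (simp add: d_def[abs_def] g0_def)
      then have "(smooth l f x - f x)\<^sup>2 \<le> 3 * (smooth l d x)\<^sup>2 + 3 * (smooth l g0 x - g x)\<^sup>2 + 3 * (d x)\<^sup>2"
        using square_sum3_le[of "smooth l d x" "smooth l g0 x - g x" "- d x"] by simp
      moreover have "(smooth l g0 x - g x)\<^sup>2 \<le> \<delta>\<^sup>2"
        using u[OF True] \<delta> by (intro abs_le_square_iff[THEN iffD1]) auto
      ultimately show ?thesis using True by simp
    qed simp
    note sl = smooth_L2_bound[OF sd l]
    have iR: "integrable lborel ?R"
      using sl(1) sd S_integrable by (auto simp: square_integrable_def)
    have iL: "integrable lborel (\<lambda>x. indicator S x * (smooth l f x - f x)\<^sup>2)"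
      by (rule Bochner_Integration.integrable_bound[OF iR]) (use pt in \<open>auto intro!: AE_I2 simp: abs_mult\<close>)
    have "(LINT x|lborel. indicator S x * (smooth l f x - f x)\<^sup>2) \<le> (LINT x|lborel. ?R x)"
      using iL iR pt by (intro integral_mono) auto
    also have "\<dots> = 3 * (LINT x|lborel. (smooth l d x)\<^sup>2) + 3 * \<delta>\<^sup>2 * M + 3 * (LINT x|lborel. (d x)\<^sup>2)"
      using sl(1) sd S_integrable by (simp add: square_integrable_def M_def)
    also have "\<dots> < e" using sl(2) dM ge e unfolding d2 mult.assoc by linarith
    finally show ?case by (simp add: dist_real_def)
  qed
qed

end

context smoothing_kernel
begin

text \<open>Seen as a function of the integration point, the kernel of the smoothing operator at a point of
  \<open>S\<close> is an admissible test function. Hence weak identities on \<open>S\<close> become pointwise ones.\<close>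

definition shifted_kernel :: "real \<Rightarrow> plane \<Rightarrow> scalar_field" where
  "shifted_kernel l x y = k ((y - l *\<^sub>R x) /\<^sub>R (1 - l))"

definition shifted_kernel_grad :: "real \<Rightarrow> plane \<Rightarrow> vector_field" where
  "shifted_kernel_grad l x y = k' ((y - l *\<^sub>R x) /\<^sub>R (1 - l)) /\<^sub>R (1 - l)"

lemma shifted_kernel_C1:
  assumes l: "l < 1"
  shows "C1_with_gradient (shifted_kernel l x) (shifted_kernel_grad l x)"
  unfolding C1_with_gradient_def
proof (intro conjI allI)
  fix y
  have "GDERIV k ((y - l *\<^sub>R x) /\<^sub>R (1 - l)) :> k' ((y - l *\<^sub>R x) /\<^sub>R (1 - l))"
    using k_C1 by (simp add: C1_with_gradient_def)
  then have d: "(k has_derivative (\<lambda>h. h \<bullet> k' ((y - l *\<^sub>R x) /\<^sub>R (1 - l)))) (at ((y - l *\<^sub>R x) /\<^sub>R (1 - l)))"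
    by (simp add: gderiv_def)
  have "((\<lambda>y. (y - l *\<^sub>R x) /\<^sub>R (1 - l)) has_derivative (\<lambda>h. h /\<^sub>R (1 - l))) (at y)"
    by (auto intro!: derivative_eq_intros)
  from has_derivative_compose[OF this d]
  show "GDERIV (shifted_kernel l x) y :> shifted_kernel_grad l x y"
    unfolding gderiv_def shifted_kernel_def[abs_def] shifted_kernel_grad_def by simp
next
  show "continuous_on UNIV (shifted_kernel_grad l x)"
    unfolding shifted_kernel_grad_def[abs_def]
    by (intro continuous_on_scaleR continuous_on_const continuous_on_compose2[OF k'_continuous] continuous_intros) auto
qed

lemma shifted_kernel_support:
  assumes l: "0 < l" "l < 1" and x: "x \<in> S"
  shows "compact_support_in S (shifted_kernel l x)"
proof -
  let ?C = "closure {x. k x \<noteq> 0}"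
  let ?g = "\<lambda>z. l *\<^sub>R x + (1 - l) *\<^sub>R z"
  have C: "compact ?C" "?C \<subseteq> S" using k_support by (auto simp: compact_support_in_def)
  have im: "compact (?g ` ?C)" using C(1) by (intro compact_continuous_image continuous_intros)
  have "y \<in> ?g ` ?C" if "shifted_kernel l x y \<noteq> 0" for y
  proof
    show "y = ?g ((y - l *\<^sub>R x) /\<^sub>R (1 - l))" using l by simp
    show "(y - l *\<^sub>R x) /\<^sub>R (1 - l) \<in> ?C"
      using that closure_subset[of "{x. k x \<noteq> 0}"] by (auto simp: shifted_kernel_def)
  qed
  then have sub: "closure {y. shifted_kernel l x y \<noteq> 0} \<subseteq> ?g ` ?C"
    using compact_imp_closed[OF im] by (intro closure_minimal) auto
  moreover have "?g ` ?C \<subseteq> S" using C(2) convexD[OF convex_S x, of _ l "1 - l"] l by auto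
  moreover have "compact (closure {y. shifted_kernel l x y \<noteq> 0})"
    using bounded_subset[OF compact_imp_bounded[OF im] sub] by (simp only: compact_eq_bounded_closed closed_closure)
  ultimately show ?thesis unfolding compact_support_in_def by blast
qed

lemma smooth_eq_shifted:
  assumes f: "square_integrable f" and l: "l < 1"
  shows "integrable lborel (\<lambda>y. f y * shifted_kernel l x y)"
    "smooth l f x = (LINT y|lborel. f y * shifted_kernel l x y) / (1 - l)\<^sup>2"
proof -
  let ?h = "\<lambda>z. f (l *\<^sub>R x + (1 - l) *\<^sub>R z) * k z"
  have "integrable lborel (\<lambda>y. ?h (- (l / (1 - l)) *\<^sub>R x + (1 / (1 - l)) *\<^sub>R y))"
    using smooth_integrable(1)[OF f l] l by (intro lborel_integrable_affine) auto
  moreover have "?h (- (l / (1 - l)) *\<^sub>R x + (1 / (1 - l)) *\<^sub>R y) = f y * shifted_kernel l x y" for y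
  proof -
    have "- (l / (1 - l)) *\<^sub>R x + (1 / (1 - l)) *\<^sub>R y = (y - l *\<^sub>R x) /\<^sub>R (1 - l)"
      using l by (simp add: divide_inverse scaleR_diff_right mult.commute)
    moreover have "l *\<^sub>R x + (1 - l) *\<^sub>R ((y - l *\<^sub>R x) /\<^sub>R (1 - l)) = y" using l by simp
    ultimately show ?thesis unfolding shifted_kernel_def by metis
  qed
  ultimately show i: "integrable lborel (\<lambda>y. f y * shifted_kernel l x y)" by simp
  have "(LINT y|lborel. f y * shifted_kernel l x y) =
      \<bar>1 - l\<bar> ^ DIM(plane) * (LINT z|lborel. f (l *\<^sub>R x + (1 - l) *\<^sub>R z) * shifted_kernel l x (l *\<^sub>R x + (1 - l) *\<^sub>R z))"
    using l i by (intro lborel_integral_affine) auto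
  also have "(\<lambda>z. f (l *\<^sub>R x + (1 - l) *\<^sub>R z) * shifted_kernel l x (l *\<^sub>R x + (1 - l) *\<^sub>R z)) = ?h"
    using l by (auto simp: shifted_kernel_def)
  finally show "smooth l f x = (LINT y|lborel. f y * shifted_kernel l x y) / (1 - l)\<^sup>2"
    using l by (simp add: smooth_def)
qed

text \<open>The factor is \<open>- l\<close> from differentiating the shifted kernel with respect to the shift, times the
  normalisation of the substitution.\<close>

definition smooth_grad :: "real \<Rightarrow> scalar_field \<Rightarrow> vector_field" where
  "smooth_grad l f x = (- l / (1 - l)\<^sup>2) *\<^sub>R (LINT y|lborel. f y *\<^sub>R shifted_kernel_grad l x y)"

lemma integrable_of_square_integrable:
  assumes f: "square_integrable f" and f0: "\<And>x. x \<notin> S \<Longrightarrow> f x = 0"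
  shows "integrable lborel f"
proof (rule Bochner_Integration.integrable_bound[where f="\<lambda>x. (f x)\<^sup>2 + indicator S x"])
  show "integrable lborel (\<lambda>x. (f x)\<^sup>2 + indicator S x)"
    using f S_integrable by (simp add: square_integrable_def)
  show "AE x in lborel. norm (f x) \<le> norm ((f x)\<^sup>2 + indicator S x)"
  proof (rule AE_I2)
    fix x show "norm (f x) \<le> norm ((f x)\<^sup>2 + indicator S x)"
      using abs_le_square_plus_one[of "f x"] f0[of x] by (cases "x \<in> S") auto
  qed
qed (use f in \<open>simp add: square_integrable_def\<close>)

text \<open>The kernel has a Taylor expansion whose remainder is quadratic uniformly in the integration
  point, so it can be integrated against \<open>f\<close>.\<close>

lemma smooth_C1:
  assumes f: "square_integrable f" and f0: "\<And>x. x \<notin> S \<Longrightarrow> f x = 0" and l: "l < 1"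
  shows "C1_with_gradient (smooth l f) (smooth_grad l f)"
proof -
  have fm[measurable]: "f \<in> borel_measurable borel" using f by (simp add: square_integrable_def)
  have fi: "integrable lborel f" using integrable_of_square_integrable[OF f f0] .
  define q where "q = l / (1 - l)"
  have [measurable]: "shifted_kernel_grad l x \<in> borel_measurable borel" for x
    unfolding shifted_kernel_grad_def[abs_def] by measurable
  have gle: "norm (f y *\<^sub>R shifted_kernel_grad l x y) \<le> \<bar>f y\<bar> * (B / (1 - l))" for x y
  proof -
    have "norm (f y *\<^sub>R shifted_kernel_grad l x y) = \<bar>f y\<bar> * (norm (k' ((y - l *\<^sub>R x) /\<^sub>R (1 - l))) / (1 - l))"
      using l by (simp add: shifted_kernel_grad_def divide_inverse_commute abs_mult)
    also have "\<dots> \<le> \<bar>f y\<bar> * (B / (1 - l))"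
      using l k'_le by (intro mult_left_mono divide_right_mono) auto
    finally show ?thesis .
  qed
  have B0: "B \<ge> 0" using k_nonneg k_le order_trans by blast
  have gi: "integrable lborel (\<lambda>y. f y *\<^sub>R shifted_kernel_grad l x y)" for x
    by (rule Bochner_Integration.integrable_bound[where f="\<lambda>y. \<bar>f y\<bar> * (B / (1 - l))"])
      (use fi gle l B0 in \<open>auto intro!: AE_I2 simp: abs_mult\<close>)
  have tay: "\<bar>shifted_kernel l (x + h) y - shifted_kernel l x y + l * (shifted_kernel_grad l x y \<bullet> h)\<bar>
      \<le> L * q\<^sup>2 * (norm h)\<^sup>2" for x h y
  proof -
    let ?u = "(y - l *\<^sub>R x) /\<^sub>R (1 - l)"
    have "(y - l *\<^sub>R (x + h)) /\<^sub>R (1 - l) = ?u + (- q) *\<^sub>R h"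
      by (simp add: q_def divide_inverse algebra_simps)
    then show ?thesis using k_taylor[of ?u "(- q) *\<^sub>R h"]
      by (simp add: shifted_kernel_def shifted_kernel_grad_def power_mult_distrib q_def divide_inverse algebra_simps)
  qed
  have rem: "\<bar>smooth l f (x + h) - smooth l f x - smooth_grad l f x \<bullet> h\<bar> \<le>
     ((LINT y|lborel. \<bar>f y\<bar>) * (L * q\<^sup>2) / (1 - l)\<^sup>2) * (norm h)\<^sup>2" for x h
  proof -
    let ?r = "\<lambda>y. f y * (shifted_kernel l (x + h) y - shifted_kernel l x y + l * (shifted_kernel_grad l x y \<bullet> h))"
    note i1 = smooth_eq_shifted(1)[OF f l, of "x + h"] and i2 = smooth_eq_shifted(1)[OF f l, of x]
    have i3: "integrable lborel (\<lambda>y. f y * (shifted_kernel_grad l x y \<bullet> h))"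
      using integrable_inner_left[OF gi[of x], of h] by simp
    have e3: "(LINT y|lborel. f y *\<^sub>R shifted_kernel_grad l x y) \<bullet> h = (LINT y|lborel. f y * (shifted_kernel_grad l x y \<bullet> h))"
      using integral_inner_left[OF gi[of x], of h] by simp
    have re: "?r = (\<lambda>y. f y * shifted_kernel l (x + h) y - f y * shifted_kernel l x y + l * (f y * (shifted_kernel_grad l x y \<bullet> h)))"
      by (auto simp: algebra_simps)
    have ir: "integrable lborel ?r" unfolding re using i1 i2 i3 by simp
    have "smooth l f (x + h) - smooth l f x - smooth_grad l f x \<bullet> h = (LINT y|lborel. ?r y) / (1 - l)\<^sup>2"
      unfolding re smooth_eq_shifted(2)[OF f l] smooth_grad_def using i1 i2 i3 l e3
      by (simp add: field_simps)
    moreover have "\<bar>LINT y|lborel. ?r y\<bar> \<le> (LINT y|lborel. \<bar>f y\<bar> * (L * q\<^sup>2 * (norm h)\<^sup>2))"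
    proof (rule order_trans[OF integral_abs_bound integral_mono])
      show "integrable lborel (\<lambda>y. \<bar>?r y\<bar>)" using ir by (rule integrable_abs)
      show "\<bar>?r y\<bar> \<le> \<bar>f y\<bar> * (L * q\<^sup>2 * (norm h)\<^sup>2)" for y
        unfolding abs_mult using tay by (intro mult_left_mono) auto
    qed (use fi in simp)
    ultimately show ?thesis
      by (simp add: abs_divide divide_right_mono algebra_simps)
  qed
  have cont: "continuous_on UNIV (smooth_grad l f)"
  proof (rule continuous_on_sequentiallyI)
    fix u :: "nat \<Rightarrow> plane" and a assume u: "u \<longlonglongrightarrow> a"
    have "(\<lambda>n. LINT y|lborel. f y *\<^sub>R shifted_kernel_grad l (u n) y) \<longlonglongrightarrow> (LINT y|lborel. f y *\<^sub>R shifted_kernel_grad l a y)"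
    proof (rule integral_dominated_convergence[where w="\<lambda>y. \<bar>f y\<bar> * (B / (1 - l))"])
      show "AE y in lborel. (\<lambda>n. f y *\<^sub>R shifted_kernel_grad l (u n) y) \<longlonglongrightarrow> f y *\<^sub>R shifted_kernel_grad l a y"
      proof (rule AE_I2)
        fix y
        have "isCont k' ((y - l *\<^sub>R a) /\<^sub>R (1 - l))"
          using k'_continuous by (simp add: continuous_on_eq_continuous_at)
        moreover have "(\<lambda>n. (y - l *\<^sub>R u n) /\<^sub>R (1 - l)) \<longlonglongrightarrow> (y - l *\<^sub>R a) /\<^sub>R (1 - l)"
          using u by (intro tendsto_intros)
        ultimately have "(\<lambda>n. k' ((y - l *\<^sub>R u n) /\<^sub>R (1 - l))) \<longlonglongrightarrow> k' ((y - l *\<^sub>R a) /\<^sub>R (1 - l))"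
          by (rule isCont_tendsto_compose)
        then show "(\<lambda>n. f y *\<^sub>R shifted_kernel_grad l (u n) y) \<longlonglongrightarrow> f y *\<^sub>R shifted_kernel_grad l a y"
          unfolding shifted_kernel_grad_def by (intro tendsto_intros)
      qed
    qed (use fi gle in auto)
    then show "(\<lambda>n. smooth_grad l f (u n)) \<longlonglongrightarrow> smooth_grad l f a"
      unfolding smooth_grad_def by (intro tendsto_intros)
  qed
  show ?thesis unfolding C1_with_gradient_def
    using GDERIV_of_quadratic_remainder[OF rem] cont by auto
qed

end

text \<open>The fundamental lemma of the calculus of variations: the smoothings of a function that
  annihilates all test functions vanish, and they converge to it.\<close>

lemma (in smoothing_kernel) annihilates_test_functions_imp_zero:
  assumes f: "square_integrable f" and f0: "\<And>x. x \<notin> S \<Longrightarrow> f x = 0"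
    and ann: "\<And>\<phi> g. C1_with_gradient \<phi> g \<Longrightarrow> compact_support_in S \<phi> \<Longrightarrow> (LINT y|lborel. f y * \<phi> y) = 0"
  shows "AE x in lborel. f x = 0"
proof -
  have fm[measurable]: "f \<in> borel_measurable borel" and if2: "integrable lborel (\<lambda>x. (f x)\<^sup>2)"
    using f by (auto simp: square_integrable_def)
  have z: "smooth l f x = 0" if "0 < l" "l < 1" "x \<in> S" for l x
    using ann[OF shifted_kernel_C1 shifted_kernel_support] that smooth_eq_shifted(2)[OF f] by simp
  have "\<forall>\<^sub>F l in at_left 1. 0 < l \<and> l < (1::real)"
    using eventually_at_left_real[of 0 "1::real"] by (auto elim: eventually_mono)
  then have "\<forall>\<^sub>F l in at_left 1. (LINT x|lborel. indicator S x * (smooth l f x - f x)\<^sup>2) = (LINT x|lborel. (f x)\<^sup>2)"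
  proof eventually_elim
    case (elim l)
    have "indicator S x * (smooth l f x - f x)\<^sup>2 = (f x)\<^sup>2" for x
      using z[of l x] f0[of x] elim by (cases "x \<in> S") auto
    then show ?case by simp
  qed
  then have "((\<lambda>l::real. LINT x|lborel. (f x)\<^sup>2) \<longlongrightarrow> 0) (at_left 1)"
    using smooth_tendsto_L2[OF f f0] by (rule Lim_transform_eventually[rotated])
  then have "(LINT x|lborel. (f x)\<^sup>2) = 0"
    by (simp add: tendsto_const_iff)
  then show ?thesis
    by (subst (asm) integral_nonneg_eq_0_iff_AE[OF if2]) auto
qed

section \<open>Potentials of divergence free fields\<close>

text \<open>The potential is the line integral of the rotated field along rays from a fixed point of \<open>S\<close>. It
  is continuously differentiable on the whole plane, also where the divergence does not vanish; only
  the formula for its gradient needs the vanishing divergence along the ray.\<close>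

lemma divergence_free_potential:
  fixes F1 F2 :: scalar_field and S :: "plane set"
  assumes F1: "C1_with_gradient F1 G1" and F2: "C1_with_gradient F2 G2"
    and S: "convex S" "c \<in> S" and div0: "\<And>x. x \<in> S \<Longrightarrow> G1 x $ 1 + G2 x $ 2 = 0"
  obtains \<psi> g where "C1_with_gradient \<psi> g" "\<And>x. x \<in> S \<Longrightarrow> rotate (g x) = vector [F1 x, F2 x]"
proof -
  have d1: "(F1 has_derivative (\<lambda>h. h \<bullet> G1 x)) (at x)" and d2: "(F2 has_derivative (\<lambda>h. h \<bullet> G2 x)) (at x)" for x
    using F1 F2 by (auto simp: C1_with_gradient_def gderiv_def)
  have cG: "continuous_on UNIV G1" "continuous_on UNIV G2"
    using F1 F2 by (auto simp: C1_with_gradient_def)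
  have cF: "continuous_on UNIV F1" "continuous_on UNIV F2"
    using d1 d2 by (auto simp: continuous_on_eq_continuous_at intro: has_derivative_continuous)
  define A :: vector_field where "A x = (- F2 x) *\<^sub>R axis 1 1 + F1 x *\<^sub>R axis 2 1" for x
  define p where "p x t = c + t *\<^sub>R (x - c)" for x :: plane and t :: real
  define f where "f x t = (x - c) \<bullet> A (p x t)" for x t
  define D where "D x t = A (p x t) + t *\<^sub>R ((x - c) $ 2 *\<^sub>R G1 (p x t) - (x - c) $ 1 *\<^sub>R G2 (p x t))" for x t
  have inner_A: "v \<bullet> A x = - v $ 1 * F2 x + v $ 2 * F1 x" for v x
    by (simp add: A_def inner_diff_right inner_axis)
  have cp: "continuous_on X (\<lambda>(x, t). p x t)" for X
    unfolding p_def case_prod_beta by (intro continuous_intros)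
  have cont_p: "continuous_on X (\<lambda>y. G (p (fst y) (snd y)))" if "continuous_on UNIV G"
    for G :: "plane \<Rightarrow> 'z::topological_space" and X
    using continuous_on_compose2[OF that, of X "\<lambda>y. p (fst y) (snd y)"] cp by (simp add: case_prod_beta)
  have contA: "continuous_on UNIV A" unfolding A_def using cF by (intro continuous_intros)
  have contD: "continuous_on X (\<lambda>(x, t). D x t)" for X
    unfolding D_def case_prod_beta by (intro continuous_intros cont_p cG contA)
  have contD1: "continuous_on {0..1} (D x)" for x
    using continuous_on_compose2[OF contD[of UNIV], of "{0..1}" "\<lambda>t. (x, t)"]
    by (simp add: continuous_on_Pair[OF continuous_on_const continuous_on_id])
  define g where "g x = integral {0..1} (D x)" for x
  define \<psi> where "\<psi> x = integral {0..1} (f x)" for x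
  have deriv: "((\<lambda>x. f x t) has_derivative blinfun_apply (blinfun_inner_left (D x t))) (at x)" for x t
  proof -
    have "((\<lambda>x. p x t) has_derivative (\<lambda>h. t *\<^sub>R h)) (at x)"
      unfolding p_def by (auto intro!: derivative_eq_intros)
    then have e: "((\<lambda>x. F1 (p x t)) has_derivative (\<lambda>h. (t *\<^sub>R h) \<bullet> G1 (p x t))) (at x)"
      "((\<lambda>x. F2 (p x t)) has_derivative (\<lambda>h. (t *\<^sub>R h) \<bullet> G2 (p x t))) (at x)"
      using has_derivative_compose[OF _ d1] has_derivative_compose[OF _ d2] by blast+
    have "((\<lambda>x. (x - c) $ i) has_derivative (\<lambda>h. h $ i)) (at x)" for i
      by (auto intro!: derivative_eq_intros bounded_linear.has_derivative[OF bounded_linear_vec_nth])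
    then have "((\<lambda>x. - (x - c) $ 1 * F2 (p x t) + (x - c) $ 2 * F1 (p x t)) has_derivative
       (\<lambda>h. (- (x - c) $ 1 * ((t *\<^sub>R h) \<bullet> G2 (p x t)) + - h $ 1 * F2 (p x t)) +
         ((x - c) $ 2 * ((t *\<^sub>R h) \<bullet> G1 (p x t)) + h $ 2 * F1 (p x t)))) (at x)"
      by (intro has_derivative_add has_derivative_mult has_derivative_minus e)
    moreover have "blinfun_apply (blinfun_inner_left (D x t)) =
       (\<lambda>h. (- (x - c) $ 1 * ((t *\<^sub>R h) \<bullet> G2 (p x t)) + - h $ 1 * F2 (p x t)) +
         ((x - c) $ 2 * ((t *\<^sub>R h) \<bullet> G1 (p x t)) + h $ 2 * F1 (p x t)))"
      by (rule ext) (simp add: D_def inner_add_right inner_diff_right inner_A algebra_simps)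
    ultimately show ?thesis unfolding f_def inner_A by simp
  qed
  have contf: "continuous_on X (f x)" for x X
  proof -
    have "continuous_on X (\<lambda>t. A (p x t))"
      by (rule continuous_on_compose2[OF contA]) (auto simp: p_def intro!: continuous_intros)
    then show ?thesis unfolding f_def by (intro continuous_intros)
  qed
  have grad: "GDERIV \<psi> x :> g x" for x
  proof -
    have "((\<lambda>x. integral (cbox 0 1) (f x)) has_derivative
        blinfun_apply (integral (cbox 0 1) (\<lambda>t. blinfun_inner_left (D x t)))) (at x within UNIV)"
    proof (rule leibniz_rule)
      show "f x integrable_on cbox 0 1" for x using contf by (intro integrable_continuous) auto
      show "continuous_on (UNIV \<times> cbox 0 1) (\<lambda>(x, t). blinfun_inner_left (D x t))"
        using contD[of "UNIV \<times> cbox 0 1"] unfolding case_prod_beta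
        by (intro bounded_linear.continuous_on[OF bounded_linear_blinfun_inner_left])
    qed (use deriv in auto)
    moreover have "integral (cbox 0 1) (\<lambda>t. blinfun_inner_left (D x t)) = blinfun_inner_left (g x)"
      using integral_linear[OF integrable_continuous_real[OF contD1] bounded_linear_blinfun_inner_left, of x]
      by (simp add: g_def o_def)
    ultimately show ?thesis unfolding gderiv_def \<psi>_def by simp
  qed
  have cg: "continuous_on UNIV g"
    using integral_continuous_on_param[where f=D and U=UNIV and a=0 and b=1] contD
    unfolding g_def by (simp add: case_prod_beta)
  have "rotate (g x) = vector [F1 x, F2 x]" if x: "x \<in> S" for x
  proof -
    have "((\<lambda>t. t *\<^sub>R A (p x t)) has_vector_derivative D x t) (at t within {0..1})" if t: "t \<in> {0..1}" for t
    proof -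
      have pS: "p x t \<in> S" using convexD[OF S(1,2) x, of "1 - t" t] t by (simp add: p_def algebra_simps)
      have dp: "((\<lambda>t. p x t) has_derivative (\<lambda>s. s *\<^sub>R (x - c))) (at t)"
        unfolding p_def by (auto intro!: derivative_eq_intros)
      have "((\<lambda>t. F1 (p x t)) has_derivative (\<lambda>s. (s *\<^sub>R (x - c)) \<bullet> G1 (p x t))) (at t)"
        "((\<lambda>t. F2 (p x t)) has_derivative (\<lambda>s. (s *\<^sub>R (x - c)) \<bullet> G2 (p x t))) (at t)"
        by (rule has_derivative_compose[OF dp d1] has_derivative_compose[OF dp d2])+
      then have e: "((\<lambda>t. F1 (p x t)) has_real_derivative ((x - c) \<bullet> G1 (p x t))) (at t)"
        "((\<lambda>t. F2 (p x t)) has_real_derivative ((x - c) \<bullet> G2 (p x t))) (at t)"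
        by (simp_all add: has_field_derivative_def mult_commute_abs)
      have "((\<lambda>t. t *\<^sub>R A (p x t)) has_vector_derivative
          (A (p x t) + t *\<^sub>R ((- ((x - c) \<bullet> G2 (p x t))) *\<^sub>R axis 1 1 + ((x - c) \<bullet> G1 (p x t)) *\<^sub>R axis 2 1))) (at t)"
        unfolding A_def by (auto intro!: derivative_eq_intros e simp: algebra_simps)
      \<comment> \<open>The vanishing divergence says that the Jacobian of the rotated field is symmetric, so the
        derivative along the ray agrees with the transposed one in the gradient of \<open>\<psi>\<close>.\<close>
      moreover have "(- ((x - c) \<bullet> G2 (p x t))) *\<^sub>R axis 1 1 + ((x - c) \<bullet> G1 (p x t)) *\<^sub>R axis 2 1 =
          (x - c) $ 2 *\<^sub>R G1 (p x t) - (x - c) $ 1 *\<^sub>R G2 (p x t)" (is "?l = ?r")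
      proof -
        have g2: "G2 (p x t) $ 2 = - G1 (p x t) $ 1" using div0[OF pS] by simp
        have "?l $ i = ?r $ i" for i
          using exhaust_2[of i] g2 by (auto simp: inner_vec_def sum_2 axis_def algebra_simps)
        then show ?thesis by (simp add: vec_eq_iff)
      qed
      ultimately show ?thesis unfolding D_def by (auto intro: has_vector_derivative_at_within)
    qed
    then have "(D x has_integral (1 *\<^sub>R A (p x 1) - 0 *\<^sub>R A (p x 0))) {0..1}"
      by (intro fundamental_theorem_of_calculus) auto
    then have "g x = A x" unfolding g_def by (auto dest: integral_unique simp: p_def)
    then show ?thesis by (simp add: rotate_def A_def axis_def)
  qed
  with grad cg show ?thesis by (intro that[of \<psi> g]) (auto simp: C1_with_gradient_def)
qed

section \<open>Green's formula on a triangle\<close>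

text \<open>The signed area of the parallelogram spanned by two vectors.\<close>

definition cross2 :: "plane \<Rightarrow> plane \<Rightarrow> real" where
  "cross2 a b = a $ 1 * b $ 2 - a $ 2 * b $ 1"

lemma cross2_simps:
  "cross2 (a + b) c = cross2 a c + cross2 b c" "cross2 a (b + c) = cross2 a b + cross2 a c"
  "cross2 (a - b) c = cross2 a c - cross2 b c" "cross2 a (b - c) = cross2 a b - cross2 a c"
  "cross2 (t *\<^sub>R a) b = t * cross2 a b" "cross2 a (t *\<^sub>R b) = t * cross2 a b" "cross2 a a = 0"
  by (simp_all add: cross2_def algebra_simps)

lemma cross2_commute: "cross2 a b = - cross2 b a"
  by (simp add: cross2_def)

lemma inner_plane: "a \<bullet> b = a $ 1 * b $ 1 + a $ 2 * b $ 2" for a b :: plane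
  by (simp add: inner_vec_def sum_2)

lemma vec2_eq_iff: "a = b \<longleftrightarrow> a $ 1 = b $ 1 \<and> a $ 2 = b $ 2" for a b :: plane
  by (simp add: vec_eq_iff forall_2)

lemma rotate_component [simp]: "rotate g $ 1 = g $ 2" "rotate g $ 2 = - g $ 1"
  by (simp_all add: rotate_def)

lemma inner_rotate: "v \<bullet> rotate g = cross2 v g"
  by (simp_all add: inner_plane cross2_def)

lemma cross2_eq_0_imp_parallel:
  assumes "cross2 a b = 0" "b \<noteq> 0"
  obtains t where "a = t *\<^sub>R b"
proof (cases "b $ 1 = 0")
  case True
  then have "b $ 2 \<noteq> 0" using assms by (auto simp: vec2_eq_iff)
  with True assms show ?thesis
    by (intro that[of "a $ 2 / b $ 2"]) (auto simp: vec2_eq_iff cross2_def)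
next
  case False
  with assms show ?thesis
    by (intro that[of "a $ 1 / b $ 1"]) (auto simp: vec2_eq_iff cross2_def field_simps)
qed

lemma continuous_on_plane_pair: "continuous_on X (\<lambda>q::real \<times> real. vector [fst q, snd q] :: plane)"
proof -
  have e: "(\<lambda>q::real \<times> real. vector [fst q, snd q] :: plane) = (\<lambda>q. fst q *\<^sub>R axis 1 1 + snd q *\<^sub>R axis 2 1)"
    by (auto simp: vec2_eq_iff axis_def)
  show ?thesis unfolding e by (intro continuous_intros)
qed

text \<open>This identification turns integrals over the plane into iterated ones.\<close>

lemma lborel_plane:
  "(lborel :: plane measure) = distr (lborel \<Otimes>\<^sub>M lborel) borel (\<lambda>q. vector [fst q, snd q])"
proof (rule lborel_eqI)
  let ?v = "\<lambda>q::real \<times> real. vector [fst q, snd q] :: plane"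
  have vm: "?v \<in> borel_measurable borel"
    by (rule borel_measurable_continuous_onI[OF continuous_on_plane_pair])
  then have [measurable]: "?v \<in> (lborel \<Otimes>\<^sub>M lborel) \<rightarrow>\<^sub>M borel" by (simp add: lborel_prod)
  fix l u :: plane assume le: "\<And>b. b \<in> Basis \<Longrightarrow> l \<bullet> b \<le> u \<bullet> b"
  have le': "l $ i \<le> u $ i" for i using le[of "axis i 1"] by (simp add: inner_axis axis_in_Basis_iff)
  have pre: "?v -` box l u \<inter> space (lborel \<Otimes>\<^sub>M lborel) = {l$1<..<u$1} \<times> {l$2<..<u$2}"
    by (auto simp: mem_box_cart forall_2 space_pair_measure)
  have "(\<Prod>b\<in>Basis. (u - l) \<bullet> b) = (\<Prod>i\<in>UNIV. (u - l) $ i)"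
  proof -
    have B: "(Basis :: plane set) = (\<lambda>i. axis i 1) ` UNIV" by (auto simp: Basis_vec_def)
    show ?thesis unfolding B
      by (subst prod.reindex) (auto simp: inj_on_def axis_eq_axis inner_axis)
  qed
  also have "\<dots> = (u$1 - l$1) * (u$2 - l$2)" by (simp add: UNIV_2)
  finally show "emeasure (distr (lborel \<Otimes>\<^sub>M lborel) borel ?v) (box l u) = (\<Prod>b\<in>Basis. (u - l) \<bullet> b)"
    using le' by (simp add: emeasure_distr pre lborel.emeasure_pair_measure_Times ennreal_mult)
qed simp

lemma C1_with_gradientD:
  assumes "C1_with_gradient \<phi> g"
  shows "continuous_on UNIV \<phi>" "continuous_on UNIV g" "(\<phi> has_derivative (\<lambda>h. h \<bullet> g x)) (at x)"
    "\<phi> \<in> borel_measurable borel" "g \<in> borel_measurable borel"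
proof -
  show d: "(\<phi> has_derivative (\<lambda>h. h \<bullet> g x)) (at x)" for x
    using assms by (auto simp: C1_with_gradient_def gderiv_def)
  show "continuous_on UNIV g" using assms by (auto simp: C1_with_gradient_def)
  show "continuous_on UNIV \<phi>"
    using d by (auto simp: continuous_on_eq_continuous_at intro: has_derivative_continuous)
  then show "\<phi> \<in> borel_measurable borel" by (rule borel_measurable_continuous_onI)
  show "g \<in> borel_measurable borel" using \<open>continuous_on UNIV g\<close> by (rule borel_measurable_continuous_onI)
qed

definition seg_mean :: "scalar_field \<Rightarrow> plane \<Rightarrow> plane \<Rightarrow> real" where
  "seg_mean f a b = (LINT s|lebesgue_on {0..1}. f (a + s *\<^sub>R (b - a)))"

lemma seg_point_continuous: "continuous_on X (\<lambda>s. a + s *\<^sub>R (b - a) :: plane)"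
  by (intro continuous_intros)

lemma continuous_on_seg:
  "continuous_on UNIV f \<Longrightarrow> continuous_on X (\<lambda>s. (f :: plane \<Rightarrow> 'a::topological_space) (a + s *\<^sub>R (b - a)))"
  by (rule continuous_on_compose2[OF _ seg_point_continuous]) auto

lemma continuous_borel_integrable_Icc:
  "continuous_on UNIV (f :: real \<Rightarrow> real) \<Longrightarrow> integrable lborel (\<lambda>s. indicator {a..b} s * f s)"
  using borel_integrable_compact[of "{a..b}" f] continuous_on_subset[of UNIV f "{a..b}"] by simp

lemma seg_mean_lborel:
  assumes "continuous_on UNIV f"
  shows "seg_mean f a b = (LINT s|lborel. indicator {0..1} s * f (a + s *\<^sub>R (b - a)))"
proof -
  have [measurable]: "(\<lambda>s. f (a + s *\<^sub>R (b - a))) \<in> borel_measurable borel"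
    using continuous_on_seg[OF assms] by (rule borel_measurable_continuous_onI)
  show ?thesis unfolding seg_mean_def
    by (subst integral_restrict_space) (auto simp: integral_completion)
qed

lemma Icc_integral_rescale:
  assumes f: "continuous_on UNIV (f :: real \<Rightarrow> real)" and c: "c > 0"
  shows "(LINT s|lborel. indicator {t..t + c} s * f s) = c * (LINT s|lborel. indicator {0..1} s * f (t + c * s))"
proof -
  have "indicator {t..t + c} (t + c * s) = (indicator {0..1} s :: real)" for s
    using c by (auto simp: indicator_def zero_le_mult_iff)
  then show ?thesis using lborel_integral_real_affine[of c "\<lambda>s. indicator {t..t + c} s * f s" t] c by simp
qed

lemma seg_mean_split:
  fixes a b :: plane
  assumes f: "continuous_on UNIV f" and t: "0 < t" "t < 1"
  defines "p \<equiv> a + t *\<^sub>R (b - a)"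
  shows "seg_mean f a b = t * seg_mean f a p + (1 - t) * seg_mean f p b"
proof -
  let ?h = "\<lambda>s. f (a + s *\<^sub>R (b - a))"
  have h: "continuous_on UNIV ?h" using continuous_on_seg[OF f] .
  have 1: "seg_mean f a p = (LINT s|lborel. indicator {0..1} s * ?h (0 + t * s))"
    unfolding seg_mean_lborel[OF f] by (simp add: p_def mult.commute)
  have "p + s *\<^sub>R (b - p) = a + (t + (1 - t) * s) *\<^sub>R (b - a)" for s
    by (simp add: p_def algebra_simps)
  then have 2: "seg_mean f p b = (LINT s|lborel. indicator {0..1} s * ?h (t + (1 - t) * s))"
    unfolding seg_mean_lborel[OF f] by simp
  have "seg_mean f a b = (LINT s|lborel. indicator {0..0 + t} s * ?h s + indicator {t..t + (1 - t)} s * ?h s)"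
    unfolding seg_mean_lborel[OF f]
  proof (rule integral_cong_AE)
    have [measurable]: "?h \<in> borel_measurable borel" using h by (rule borel_measurable_continuous_onI)
    show "(\<lambda>s. indicator {0..1} s * ?h s) \<in> borel_measurable lborel"
      "(\<lambda>s. indicator {0..0 + t} s * ?h s + indicator {t..t + (1 - t)} s * ?h s) \<in> borel_measurable lborel"
      by simp_all
    have "AE s in lborel. s \<noteq> t" by (rule AE_lborel_singleton)
    then show "AE s in lborel. indicator {0..1} s * ?h s =
        indicator {0..0 + t} s * ?h s + indicator {t..t + (1 - t)} s * ?h s"
      by eventually_elim (use t in \<open>auto simp: indicator_def\<close>)
  qed
  also have "\<dots> = (LINT s|lborel. indicator {0..0 + t} s * ?h s) + (LINT s|lborel. indicator {t..t + (1 - t)} s * ?h s)"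
    by (intro Bochner_Integration.integral_add continuous_borel_integrable_Icc h)
  also have "\<dots> = t * seg_mean f a p + (1 - t) * seg_mean f p b"
    unfolding 1 2 using t by (subst Icc_integral_rescale[OF h], simp)+ simp
  finally show ?thesis .
qed

lemma seg_mean_reverse:
  assumes f: "continuous_on UNIV f"
  shows "seg_mean f a b = seg_mean f b a"
proof -
  have "seg_mean f a b = (LINT s|lborel. indicator {0..1} (1 + -1 * s) * f (a + (1 + - 1 * s) *\<^sub>R (b - a)))"
    unfolding seg_mean_lborel[OF f]
    by (subst lborel_integral_real_affine[where c="-1" and t=1]) auto
  also have "\<dots> = seg_mean f b a"
    unfolding seg_mean_lborel[OF f]
    by (intro Bochner_Integration.integral_cong) (auto simp: indicator_def algebra_simps)
  finally show ?thesis .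
qed

lemma absolutely_integrable_on_compact:
  fixes f :: "'a::euclidean_space \<Rightarrow> 'b::euclidean_space"
  assumes S: "compact S" and f: "continuous_on S f"
  shows "f absolutely_integrable_on S"
proof -
  have "integrable lborel (\<lambda>x. indicator S x *\<^sub>R f x)" using S f by (rule borel_integrable_compact)
  then show ?thesis unfolding set_integrable_def by (subst integrable_completion) auto
qed

text \<open>In the coordinates spanned by two edges, the derivative in the direction of one edge is
  integrated out by the fundamental theorem of calculus along that direction.\<close>

lemma triangle_directional_integral:
  fixes A B C :: plane
  assumes C1: "C1_with_gradient \<phi> g" and nd: "cross2 (B - A) (C - A) \<noteq> 0"
  shows "integral (convex hull {A, B, C}) g \<bullet> (B - A) =
    \<bar>cross2 (B - A) (C - A)\<bar> * (seg_mean \<phi> B C - seg_mean \<phi> A C)"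
proof -
  note d = C1_with_gradientD[OF C1]
  define u v where "u = B - A" and "v = C - A"
  define T :: "plane \<Rightarrow> plane" where "T p = A + p $ 1 *\<^sub>R u + p $ 2 *\<^sub>R v" for p
  define T' :: "plane \<Rightarrow> plane" where "T' p = p $ 1 *\<^sub>R u + p $ 2 *\<^sub>R v" for p
  define R :: "plane set" where "R = {p. 0 \<le> p $ 1 \<and> 0 \<le> p $ 2 \<and> p $ 1 + p $ 2 \<le> 1}"
  have "T ` R = convex hull {A, B, C}"
  proof -
    have "convex hull {A, B, C} = {A + s *\<^sub>R u + t *\<^sub>R v | s t. 0 \<le> s \<and> 0 \<le> t \<and> s + t \<le> 1}"
      unfolding convex_hull_3_alt u_def v_def by auto
    also have "\<dots> = T ` R"
    proof (intro equalityI subsetI)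
      fix x assume "x \<in> {A + s *\<^sub>R u + t *\<^sub>R v | s t. 0 \<le> s \<and> 0 \<le> t \<and> s + t \<le> 1}"
      then obtain s t where "x = A + s *\<^sub>R u + t *\<^sub>R v" "0 \<le> s" "0 \<le> t" "s + t \<le> 1" by auto
      then show "x \<in> T ` R" by (intro image_eqI[of _ _ "vector [s, t]"]) (auto simp: T_def R_def)
    qed (auto simp: T_def R_def)
    finally show ?thesis by simp
  qed
  note hull = this[symmetric]
  have linT': "linear T'" unfolding T'_def by (rule linearI) (auto simp: algebra_simps)
  have dT: "(T has_derivative T') (at p within R)" for p
    unfolding T_def T'_def
    by (auto intro!: derivative_eq_intros bounded_linear.has_derivative[OF bounded_linear_vec_nth])
  have det: "det (matrix T') = cross2 u v"
    by (simp add: matrix_def T'_def det_2 cross2_def axis_def)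
  have inj: "inj_on T R"
  proof (rule inj_onI)
    fix p q assume "T p = T q"
    then have "T' p - T' q = 0" by (simp add: T_def T'_def algebra_simps)
    then have e: "T' (p - q) = 0" using linT' by (simp add: linear_diff)
    have "(p - q) $ 1 * cross2 u v = cross2 (T' (p - q)) v" "(p - q) $ 2 * cross2 u v = cross2 u (T' (p - q))"
      by (simp_all add: T'_def cross2_simps)
    then have "(p - q) $ 1 = 0" "(p - q) $ 2 = 0" using nd e by (auto simp: u_def v_def cross2_def)
    then show "p = q" by (simp add: vec2_eq_iff)
  qed
  have compK: "compact (T ` R)" unfolding hull[symmetric] by (simp add: compact_convex_hull)
  have clR: "closed R"
    unfolding R_def by (intro closed_Collect_conj closed_Collect_le continuous_intros)
  have bR: "bounded R"
  proof (rule bounded_subset[OF bounded_cbox[of 0 "vector [1, 1]"]])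
    show "R \<subseteq> cbox 0 (vector [1, 1])" by (auto simp: R_def mem_box_cart forall_2)
  qed
  have compR: "compact R" using clR bR by (simp add: compact_eq_bounded_closed)
  have contT: "continuous_on X T" for X unfolding T_def by (intro continuous_intros)
  have cgT: "continuous_on UNIV (\<lambda>p. g (T p))"
    using continuous_on_compose2[OF d(2) contT] by auto
  have ai: "g absolutely_integrable_on (T ` R)"
    using compK d(2) by (intro absolutely_integrable_on_compact) (auto intro: continuous_on_subset)
  have "R \<in> sets lebesgue" using clR by auto
  then have "integral R (\<lambda>p. \<bar>det (matrix T')\<bar> *\<^sub>R g (T p)) = integral (T ` R) g"
    using has_absolute_integral_change_of_variables[of R T "\<lambda>_. T'" g "integral (T ` R) g"] dT inj ai by auto
  then have "integral (convex hull {A, B, C}) g = \<bar>cross2 u v\<bar> *\<^sub>R integral R (\<lambda>p. g (T p))"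
    unfolding hull det by simp
  then have "integral (convex hull {A, B, C}) g \<bullet> u = \<bar>cross2 u v\<bar> * (integral R (\<lambda>p. g (T p)) \<bullet> u)"
    by simp
  also have "integral R (\<lambda>p. g (T p)) \<bullet> u = integral R (\<lambda>p. g (T p) \<bullet> u)"
  proof -
    have "(\<lambda>p. g (T p)) integrable_on R"
      using compR cgT by (intro set_lebesgue_integral_eq_integral(1) absolutely_integrable_on_compact)
        (auto intro: continuous_on_subset)
    from integral_linear[OF this bounded_linear_inner_left[of u]] show ?thesis by (simp add: o_def)
  qed
  also have "\<dots> = (LINT p|lborel. indicator R p * (g (T p) \<bullet> u))"
  proof -
    have "set_integrable lborel R (\<lambda>p. g (T p) \<bullet> u)"
      unfolding set_integrable_def using compR cgT
      by (intro borel_integrable_compact continuous_intros) (auto intro: continuous_on_subset)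
    from set_borel_integral_eq_integral(2)[OF this] show ?thesis by (simp add: set_lebesgue_integral_def)
  qed
  also have "\<dots> = seg_mean \<phi> B C - seg_mean \<phi> A C"
  proof -
    define f where "f s t = indicator R (vector [s, t] :: plane) * (g (T (vector [s, t])) \<bullet> u)" for s t
    have Tv: "T (vector [s, t]) = A + s *\<^sub>R u + t *\<^sub>R v" for s t by (simp add: T_def)
    have [measurable]: "(\<lambda>p. indicator R p * (g (T p) \<bullet> u)) \<in> borel_measurable borel"
      using clR borel_measurable_continuous_onI[OF cgT] by (intro borel_measurable_times borel_measurable_indicator borel_measurable_inner) auto
    note vc = continuous_on_plane_pair
    have vm: "(\<lambda>q::real \<times> real. vector [fst q, snd q] :: plane) \<in> borel_measurable (lborel \<Otimes>\<^sub>M lborel)"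
      by (simp add: lborel_prod borel_measurable_continuous_onI[OF vc])
    have "(LINT p|lborel. indicator R p * (g (T p) \<bullet> u)) = (LINT q|(lborel \<Otimes>\<^sub>M lborel). f (fst q) (snd q))"
      unfolding f_def by (subst lborel_plane, subst integral_distr[OF vm]) simp_all
    also have "\<dots> = (LINT t|lborel. LINT s|lborel. f s t)"
    proof -
      let ?R = "{q::real \<times> real. 0 \<le> fst q \<and> 0 \<le> snd q \<and> fst q + snd q \<le> 1}"
      have "compact ?R" unfolding compact_eq_bounded_closed
      proof
        show "bounded ?R" by (rule bounded_subset[OF bounded_cbox[of "(0,0)" "(1,1)"]]) auto
        show "closed ?R" by (intro closed_Collect_conj closed_Collect_le continuous_intros)
      qed
      then have "integrable lborel (\<lambda>q. indicator ?R q *\<^sub>R (g (T (vector [fst q, snd q])) \<bullet> u))"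
        using continuous_on_compose2[OF cgT vc] by (intro borel_integrable_compact continuous_intros) auto
      moreover have "(\<lambda>q. indicator ?R q *\<^sub>R (g (T (vector [fst q, snd q])) \<bullet> u)) = (\<lambda>q. f (fst q) (snd q))"
        by (auto simp: f_def R_def indicator_def)
      ultimately have "integrable (lborel \<Otimes>\<^sub>M lborel) (case_prod f)" by (simp add: lborel_prod case_prod_unfold)
      from lborel_pair.integral_snd[OF this] show ?thesis by (simp add: case_prod_unfold)
    qed
    also have "(\<lambda>t. LINT s|lborel. f s t) = (\<lambda>t. indicator {0..1} t * \<phi> (B + t *\<^sub>R (C - B)) - indicator {0..1} t * \<phi> (A + t *\<^sub>R (C - A)))"
    proof
      fix t
      show "(LINT s|lborel. f s t) = indicator {0..1} t * \<phi> (B + t *\<^sub>R (C - B)) - indicator {0..1} t * \<phi> (A + t *\<^sub>R (C - A))"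
      proof (cases "0 \<le> t \<and> t \<le> 1")
        case True
        let ?F = "\<lambda>s. \<phi> (A + s *\<^sub>R u + t *\<^sub>R v)"
        have "((\<lambda>s. A + s *\<^sub>R u + t *\<^sub>R v) has_derivative (\<lambda>h. h *\<^sub>R u)) (at s)" for s
          by (auto intro!: derivative_eq_intros)
        from has_derivative_compose[OF this d(3)]
        have "DERIV ?F s :> g (T (vector [s, t])) \<bullet> u" for s
          by (simp add: has_field_derivative_def Tv inner_commute mult_commute_abs)
        moreover have "isCont (\<lambda>s. g (T (vector [s, t])) \<bullet> u) s" for s
        proof -
          have "continuous_on UNIV (\<lambda>s. g (A + s *\<^sub>R u + t *\<^sub>R v) \<bullet> u)"
            by (intro continuous_intros continuous_on_compose2[OF d(2)]) auto
          then show ?thesis by (simp add: Tv continuous_on_eq_continuous_at)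
        qed
        ultimately have "(LINT s|lborel. (g (T (vector [s, t])) \<bullet> u) * indicator {0..1 - t} s) = ?F (1 - t) - ?F 0"
          using True by (intro integral_FTC_Icc_real) (auto intro: has_field_derivative_at_within)
        moreover have "(\<lambda>s. (g (T (vector [s, t])) \<bullet> u) * indicator {0..1 - t} s) = (\<lambda>s. f s t)"
          using True by (auto simp: f_def R_def indicator_def fun_eq_iff)
        moreover have "A + (1 - t) *\<^sub>R u + t *\<^sub>R v = B + t *\<^sub>R (C - B)"
          by (simp add: u_def v_def algebra_simps)
        ultimately show ?thesis using True by (simp add: v_def)
      next
        case False
        then have "f s t = 0" for s by (auto simp: f_def R_def indicator_def)
        then show ?thesis using False by (auto simp: indicator_def)
      qed
    qed
    also have "(LINT t|lborel. indicator {0..1} t * \<phi> (B + t *\<^sub>R (C - B)) - indicator {0..1} t * \<phi> (A + t *\<^sub>R (C - A))) =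
        seg_mean \<phi> B C - seg_mean \<phi> A C"
      unfolding seg_mean_lborel[OF d(1)]
      by (intro Bochner_Integration.integral_diff continuous_borel_integrable_Icc continuous_on_seg d(1))
    finally show ?thesis .
  qed
  finally show ?thesis by (simp add: u_def v_def)
qed

locale triangle =
  fixes A B C :: plane
  assumes ccw: "cross2 (B - A) (C - A) > 0"
begin

definition K :: "plane set" where "K = convex hull {A, B, C}"

lemma K_convex: "convex K" and K_compact: "compact K" and vertices_in_K: "A \<in> K" "B \<in> K" "C \<in> K"
  by (auto simp: K_def compact_convex_hull hull_inc)

lemma frontier_K: "frontier K = closed_segment A B \<union> closed_segment B C \<union> closed_segment C A"
  unfolding K_def by (rule frontier_of_triangle) simp

lemma frontier_subset_K: "frontier K \<subseteq> K"
  using K_compact by (simp add: compact_imp_closed frontier_subset_closed)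

lemma vertices_distinct: "A \<noteq> B" "B \<noteq> C" "C \<noteq> A"
  using ccw by (auto simp: cross2_def)

definition left_of :: "plane \<Rightarrow> plane \<Rightarrow> plane \<Rightarrow> bool" where
  "left_of a b x \<longleftrightarrow> 0 \<le> cross2 (b - a) (x - a)"

lemma boundary_segments_iff:
  "(a, b) \<in> boundary_segments K N \<longleftrightarrow> a \<in> N \<and> b \<in> N \<and> a \<noteq> b \<and>
     closed_segment a b \<subseteq> frontier K \<and> open_segment a b \<inter> N = {} \<and> (\<forall>x\<in>K. left_of a b x)"
  by (simp add: boundary_segments_def left_of_def cross2_def)

lemma open_segment_point:
  assumes "x \<in> open_segment a b"
  obtains t where "0 < t" "t < 1" "x = a + t *\<^sub>R (b - a)"
  using assms by (auto simp: in_segment algebra_simps)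

lemma open_segment_pointI:
  assumes "0 < t" "t < 1" "a \<noteq> b"
  shows "a + t *\<^sub>R (b - a) \<in> open_segment a b"
  using assms by (auto simp: in_segment algebra_simps intro!: exI[of _ t])

text \<open>A triangle is not contained in a line; this is what distinguishes the two orientations of a
  boundary segment.\<close>

lemma exists_strictly_left:
  assumes ab: "a \<noteq> b" and left: "\<forall>x\<in>K. left_of a b x"
  obtains z where "z \<in> K" "cross2 (b - a) (z - a) > 0"
proof -
  have "cross2 (b - a) (A - a) \<noteq> 0 \<or> cross2 (b - a) (B - a) \<noteq> 0 \<or> cross2 (b - a) (C - a) \<noteq> 0"
  proof (rule ccontr)
    assume "\<not> ?thesis"
    then have z: "cross2 (b - a) (B - A) = 0" "cross2 (b - a) (C - A) = 0"
      by (simp_all add: cross2_simps)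
    have "B - A \<noteq> 0" using vertices_distinct by simp
    with z(1) obtain t where t: "b - a = t *\<^sub>R (B - A)" by (rule cross2_eq_0_imp_parallel)
    then have "t * cross2 (B - A) (C - A) = 0" using z(2) by (simp add: cross2_simps)
    then have "t = 0" using ccw by simp
    then show False using t ab by simp
  qed
  then show ?thesis using left vertices_in_K that unfolding left_of_def by (metis less_eq_real_def)
qed

text \<open>A supporting line of a planar convex set at a relatively interior point of a boundary segment
  contains that segment. So two counterclockwise boundary segments that meet in this way have the
  same direction.\<close>

lemma supporting_directions_agree:
  assumes x: "x \<in> open_segment a b" and ab: "a \<in> K" "b \<in> K" "\<forall>z\<in>K. left_of a b z"
    and y: "x \<in> closed_segment a' b'" "a' \<noteq> b'" "\<forall>z\<in>K. left_of a' b' z"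
  obtains s where "s > 0" "b' - a' = s *\<^sub>R (b - a)"
proof -
  from x obtain t where t: "0 < t" "t < 1" "x = a + t *\<^sub>R (b - a)" by (rule open_segment_point)
  have ne: "a \<noteq> b" using x by auto
  from y(1) obtain s where s: "x = a' + s *\<^sub>R (b' - a')" by (auto simp: in_segment algebra_simps)
  have x0: "cross2 (b' - a') (x - a') = 0" by (simp add: s cross2_simps)
  have "(1 - t) * cross2 (b' - a') (a - a') + t * cross2 (b' - a') (b - a') = cross2 (b' - a') (x - a')"
    by (simp add: t(3) cross2_simps algebra_simps)
  moreover have "cross2 (b' - a') (a - a') \<ge> 0" "cross2 (b' - a') (b - a') \<ge> 0"
    using y(3) ab by (auto simp: left_of_def)
  ultimately have z: "cross2 (b' - a') (a - a') = 0" "cross2 (b' - a') (b - a') = 0"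
    using x0 t by (simp_all add: add_nonneg_eq_0_iff)
  then have "cross2 (b' - a') (b - a) = 0" by (simp add: cross2_simps)
  then obtain r where r: "b' - a' = r *\<^sub>R (b - a)"
    using ne cross2_eq_0_imp_parallel[of "b' - a'" "b - a"] by auto
  obtain w where w: "w \<in> K" "cross2 (b - a) (w - a) > 0" using exists_strictly_left[OF ne ab(3)] .
  have "cross2 (b' - a') (w - a') = cross2 (b' - a') (w - a) + cross2 (b' - a') (a - a')"
    by (simp add: cross2_simps)
  also have "\<dots> = r * cross2 (b - a) (w - a)" unfolding z(1) unfolding r by (simp only: cross2_simps(5) add_0_right)
  finally have "cross2 (b' - a') (w - a') = r * cross2 (b - a) (w - a)" .
  moreover have "cross2 (b' - a') (w - a') \<ge> 0" using y(3) w(1) unfolding left_of_def by blast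
  ultimately have "r * cross2 (b - a) (w - a) \<ge> 0" by simp
  then have "r \<ge> 0" using w(2) by (simp add: zero_le_mult_iff)
  moreover have "r \<noteq> 0" using r y(2) by auto
  ultimately show ?thesis using r by (intro that[of r]) auto
qed

lemma boundary_segment_in_K:
  assumes "(a, b) \<in> boundary_segments K N"
  shows "a \<in> K" "b \<in> K"
  using assms frontier_subset_K by (auto simp: boundary_segments_iff)

text \<open>Two segments of the subdivision with a common relatively interior point have the same direction.
  If their end points differed, one of them would be a node in the interior of the other segment.\<close>

lemma boundary_segment_unique:
  assumes e: "(a, b) \<in> boundary_segments K N" "(a', b') \<in> boundary_segments K N"
    and x: "x \<in> open_segment a b" "x \<in> open_segment a' b'"
  shows "a' = a \<and> b' = b"
proof -
  have no: "open_segment a b \<inter> N = {}" "open_segment a' b' \<inter> N = {}" "a \<in> N" "b \<in> N" "a' \<in> N" "b' \<in> N"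
    "a \<noteq> b" "a' \<noteq> b'"
    using e by (auto simp: boundary_segments_iff)
  obtain s where s: "s > 0" "b' - a' = s *\<^sub>R (b - a)"
    using supporting_directions_agree[OF x(1), of a' b'] e boundary_segment_in_K[OF e(1)] x(2) open_closed_segment
    by (metis boundary_segments_iff)
  obtain t where t: "0 < t" "t < 1" "x = a + t *\<^sub>R (b - a)" using x(1) by (rule open_segment_point)
  obtain t' where t': "0 < t'" "t' < 1" "x = a' + t' *\<^sub>R (b' - a')" using x(2) by (rule open_segment_point)
  define p where "p = t - t' * s"
  define q where "q = p + s"
  have a': "a' = a + p *\<^sub>R (b - a)" using t(3) t'(3) unfolding s(2) p_def by (simp add: algebra_simps)
  have "b' = a' + (b' - a')" by simp
  also have "\<dots> = a + q *\<^sub>R (b - a)" unfolding s(2) by (subst a') (simp add: q_def scaleR_add_left)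
  finally have b': "b' = a + q *\<^sub>R (b - a)" .
  have p1: "p < 1" using t t' s by (simp add: p_def) (smt (verit) mult_pos_pos)
  have "q = t + (1 - t') * s" by (simp add: p_def q_def algebra_simps)
  moreover have "(1 - t') * s > 0" using t' s by simp
  ultimately have q0: "q > 0" using t by linarith
  have "\<not> 0 < p" using open_segment_pointI[of p a b] p1 no a' by auto
  moreover have "\<not> q < 1" using open_segment_pointI[of q a b] q0 no b' by auto
  moreover have "\<not> p < 0"
  proof
    assume pn: "p < 0"
    then have "0 < - p / s \<and> - p / s < 1" using s q0 by (auto simp: q_def field_simps)
    then have "a' + (- p / s) *\<^sub>R (b' - a') \<in> open_segment a' b'" using no by (intro open_segment_pointI) auto
    moreover have "a' + (- p / s) *\<^sub>R (b' - a') = a" using s unfolding s(2) a' by simp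
    ultimately show False using no by auto
  qed
  moreover have "\<not> q > 1"
  proof
    assume qn: "q > 1"
    then have "0 < (1 - p) / s \<and> (1 - p) / s < 1" using s p1 by (auto simp: q_def field_simps)
    then have "a' + ((1 - p) / s) *\<^sub>R (b' - a') \<in> open_segment a' b'" using no by (intro open_segment_pointI) auto
    moreover have "a' + ((1 - p) / s) *\<^sub>R (b' - a') = a' + (1 - p) *\<^sub>R (b - a)" using s by (simp add: s(2))
    moreover have "a' + (1 - p) *\<^sub>R (b - a) = b" by (simp add: a' algebra_simps)
    ultimately show False using no by auto
  qed
  ultimately have "p = 0" "q = 1" by auto
  then show ?thesis using a' b' by simp
qed

lemma boundary_segments_insert:
  assumes e: "(a, b) \<in> boundary_segments K N" and p: "p \<in> open_segment a b"
  shows "boundary_segments K (insert p N) = boundary_segments K N - {(a, b)} \<union> {(a, p), (p, b)}"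
proof (intro equalityI subsetI)
  have ab: "a \<in> N" "b \<in> N" "a \<noteq> b" "closed_segment a b \<subseteq> frontier K" "open_segment a b \<inter> N = {}" "\<forall>x\<in>K. left_of a b x"
    using e by (auto simp: boundary_segments_iff)
  obtain t where t: "0 < t" "t < 1" "p = a + t *\<^sub>R (b - a)" using p by (rule open_segment_point)
  have pne: "p \<noteq> a" "p \<noteq> b" using p by (auto simp: open_segment_def)
  have pN: "p \<notin> N" using p ab by auto
  note inK = boundary_segment_in_K[OF e]
  {
    fix e' assume "e' \<in> boundary_segments K (insert p N)"
    then obtain x y where e': "e' = (x, y)" and xy: "x \<in> insert p N" "y \<in> insert p N" "x \<noteq> y"
      "closed_segment x y \<subseteq> frontier K" "open_segment x y \<inter> insert p N = {}" "\<forall>z\<in>K. left_of x y z"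
      by (cases e') (auto simp: boundary_segments_iff)
    consider "x \<noteq> p" "y \<noteq> p" | "x = p" "y \<in> N" | "y = p" "x \<in> N" using xy by auto
    then show "e' \<in> boundary_segments K N - {(a, b)} \<union> {(a, p), (p, b)}"
    proof cases
      case 1
      then have "e' \<in> boundary_segments K N" using xy by (auto simp: e' boundary_segments_iff)
      moreover have "e' \<noteq> (a, b)" using xy p by (auto simp: e')
      ultimately show ?thesis by auto
    next
      case 2
      obtain s where s: "s > 0" "y - p = s *\<^sub>R (b - a)"
        using supporting_directions_agree[OF p inK ab(6), of p y] 2 xy by auto
      have y: "y = a + (t + s) *\<^sub>R (b - a)" using s(2) t(3) by (simp add: algebra_simps)
      have "\<not> t + s < 1" using open_segment_pointI[of "t + s" a b] s t ab 2 y by auto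
      moreover have "\<not> t + s > 1"
      proof
        assume g: "t + s > 1"
        then have "p + ((1 - t) / s) *\<^sub>R (y - p) \<in> open_segment p y" using t s 2 xy by (intro open_segment_pointI) auto
        moreover have "p + ((1 - t) / s) *\<^sub>R (y - p) = p + (1 - t) *\<^sub>R (b - a)" using s by (simp add: s(2))
        moreover have "p + (1 - t) *\<^sub>R (b - a) = b" by (simp add: t(3) algebra_simps)
        ultimately show False using xy(5) ab 2 by auto
      qed
      ultimately have "t + s = 1" by linarith
      then show ?thesis using y 2 by (simp add: e')
    next
      case 3
      obtain s where s: "s > 0" "p - x = s *\<^sub>R (b - a)"
        using supporting_directions_agree[OF p inK ab(6), of x p] 3 xy by auto
      have x: "x = a + (t - s) *\<^sub>R (b - a)" using s(2) t(3) by (simp add: algebra_simps)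
      have "\<not> t - s > 0" using open_segment_pointI[of "t - s" a b] s t ab 3 x by auto
      moreover have "\<not> t - s < 0"
      proof
        assume g: "t - s < 0"
        then have "x + ((s - t) / s) *\<^sub>R (p - x) \<in> open_segment x p" using t s 3 xy by (intro open_segment_pointI) auto
        moreover have "x + ((s - t) / s) *\<^sub>R (p - x) = x + (s - t) *\<^sub>R (b - a)" using s by (simp add: s(2))
        moreover have "x + (s - t) *\<^sub>R (b - a) = a" by (simp add: x algebra_simps)
        ultimately show False using xy(5) ab 3 by auto
      qed
      ultimately have "t - s = 0" by linarith
      then show ?thesis using x 3 by (simp add: e')
    qed
  }
  {
    fix e' assume e': "e' \<in> boundary_segments K N - {(a, b)} \<union> {(a, p), (p, b)}"
    have p_cl: "p \<in> closed_segment a b" using p by (auto simp: open_segment_def)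
    have cl: "closed_segment a p \<subseteq> closed_segment a b" "closed_segment p b \<subseteq> closed_segment a b"
      using p_cl by (auto simp: subset_closed_segment)
    have op: "open_segment a p \<subseteq> open_segment a b" "open_segment p b \<subseteq> open_segment a b"
      using p_cl by (auto simp: subset_open_segment)
    have po: "p \<notin> open_segment a p" "p \<notin> open_segment p b" by (auto simp: open_segment_def)
    consider "e' \<in> boundary_segments K N" "e' \<noteq> (a, b)" | "e' = (a, p)" | "e' = (p, b)" using e' by auto
    then show "e' \<in> boundary_segments K (insert p N)"
    proof cases
      case 1
      then obtain x y where xy: "e' = (x, y)" "(x, y) \<in> boundary_segments K N" by (cases e') auto
      have "p \<notin> open_segment x y"
        using boundary_segment_unique[OF e xy(2) p] xy 1 by auto
      then show ?thesis using xy by (auto simp: boundary_segments_iff)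
    next
      case 2
      have "left_of a p x" if "x \<in> K" for x
      proof -
        have "p - a = t *\<^sub>R (b - a)" by (simp add: t(3))
        then have "cross2 (p - a) (x - a) = t * cross2 (b - a) (x - a)" by (simp only: cross2_simps(5))
        then show ?thesis using ab(6) that t by (auto simp: left_of_def)
      qed
      then show ?thesis unfolding 2 boundary_segments_iff using ab cl op po pne by auto
    next
      case 3
      have "left_of p b x" if "x \<in> K" for x
      proof -
        have "cross2 ((1 - t) *\<^sub>R w) (y - t *\<^sub>R w) = (1 - t) * cross2 w y" for w y :: plane
          by (simp add: cross2_simps)
        moreover have "b - p = (1 - t) *\<^sub>R (b - a)" "x - p = (x - a) - t *\<^sub>R (b - a)"
          by (simp_all add: t(3) algebra_simps)
        ultimately have "cross2 (b - p) (x - p) = (1 - t) * cross2 (b - a) (x - a)" by metis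
        then show ?thesis using ab(6) that t by (auto simp: left_of_def)
      qed
      then show ?thesis unfolding 3 boundary_segments_iff using ab cl op po pne by auto
    qed
  }
qed

lemma left_of_vertices:
  assumes "left_of a b A" "left_of a b B" "left_of a b C" "x \<in> K"
  shows "left_of a b x"
proof -
  obtain u v w where uvw: "0 \<le> u" "0 \<le> v" "0 \<le> w" "u + v + w = 1" "x = u *\<^sub>R A + v *\<^sub>R B + w *\<^sub>R C"
    using assms(4) unfolding K_def convex_hull_3 by auto
  have "x - a = u *\<^sub>R (A - a) + v *\<^sub>R (B - a) + w *\<^sub>R (C - a)"
    unfolding uvw(5) using uvw(4) by (simp add: algebra_simps flip: scaleR_add_left)
  then have "cross2 (b - a) (x - a) = u * cross2 (b - a) (A - a) + v * cross2 (b - a) (B - a) + w * cross2 (b - a) (C - a)"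
    by (simp add: cross2_simps)
  then show ?thesis using assms uvw by (simp add: left_of_def)
qed

lemma boundary_segments_vertices: "boundary_segments K {A, B, C} = {(A, B), (B, C), (C, A)}"
proof (intro equalityI subsetI)
  have c: "cross2 (C - B) (A - B) > 0" "cross2 (A - C) (B - C) > 0"
    using ccw by (simp_all add: cross2_def algebra_simps)
  have no: "z \<notin> open_segment x y" if "cross2 (y - x) (z - x) > 0" for x y z
  proof
    assume "z \<in> open_segment x y"
    then obtain t where "z = x + t *\<^sub>R (y - x)" by (rule open_segment_point)
    then show False using that by (simp add: cross2_simps)
  qed
  have nl: "\<not> left_of y x z" if "cross2 (y - x) (z - x) > 0" for x y z
    using that by (simp add: left_of_def cross2_def algebra_simps)
  {
    fix e assume "e \<in> boundary_segments K {A, B, C}"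
    then show "e \<in> {(A, B), (B, C), (C, A)}"
      using nl[OF ccw] nl[OF c(1)] nl[OF c(2)] vertices_in_K
      by (cases e) (auto simp: boundary_segments_iff)
  }
  {
    fix e assume "e \<in> {(A, B), (B, C), (C, A)}"
    then obtain x y z where e: "e = (x, y)" "{x, y, z} = {A, B, C}" and pos: "cross2 (y - x) (z - x) > 0"
      and cl: "closed_segment x y \<subseteq> frontier K"
      using ccw c frontier_K by auto
    have "left_of x y w" if "w \<in> K" for w
    proof -
      have "left_of x y v" if "v \<in> {x, y, z}" for v
        using that pos by (auto simp: left_of_def cross2_def algebra_simps)
      then show ?thesis using left_of_vertices[OF _ _ _ \<open>w \<in> K\<close>] e(2) by blast
    qed
    moreover have "x \<noteq> y" using pos by (auto simp: cross2_def)
    moreover have "open_segment x y \<inter> {x, y, z} = {}" using no[OF pos] by (auto simp: open_segment_def)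
    ultimately show "e \<in> boundary_segments K {A, B, C}"
      using cl unfolding e(1) boundary_segments_iff e(2)[symmetric] by auto
  }
qed

text \<open>The nodes are inserted one at a time. Each insertion splits one segment, which changes no boundary
  integral.\<close>

lemma boundary_subdivision:
  assumes "finite M" "M \<subseteq> frontier K"
  shows "finite (boundary_segments K ({A, B, C} \<union> M)) \<and>
    frontier K - ({A, B, C} \<union> M) \<subseteq> (\<Union>e\<in>boundary_segments K ({A, B, C} \<union> M). open_segment (fst e) (snd e)) \<and>
    (\<forall>\<phi> d. continuous_on UNIV \<phi> \<longrightarrow>
      (\<Sum>e\<in>boundary_segments K ({A, B, C} \<union> M). (d \<bullet> (snd e - fst e)) * seg_mean \<phi> (fst e) (snd e)) =
      (d \<bullet> (B - A)) * seg_mean \<phi> A B + (d \<bullet> (C - B)) * seg_mean \<phi> B C + (d \<bullet> (A - C)) * seg_mean \<phi> C A)"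
  using assms
proof (induction M rule: finite_induct)
  case empty
  have "frontier K - {A, B, C} \<subseteq> open_segment A B \<union> open_segment B C \<union> open_segment C A"
    unfolding frontier_K by (auto simp: open_segment_def)
  then show ?case using vertices_distinct
    by (auto simp: boundary_segments_vertices)
next
  case (insert p M)
  let ?N = "{A, B, C} \<union> M"
  let ?E = "boundary_segments K ?N"
  have ins: "{A, B, C} \<union> insert p M = insert p ?N" by auto
  have IH: "finite ?E" "frontier K - ?N \<subseteq> (\<Union>e\<in>?E. open_segment (fst e) (snd e))"
    "\<And>\<phi> d. continuous_on UNIV \<phi> \<Longrightarrow> (\<Sum>e\<in>?E. (d \<bullet> (snd e - fst e)) * seg_mean \<phi> (fst e) (snd e)) =
      (d \<bullet> (B - A)) * seg_mean \<phi> A B + (d \<bullet> (C - B)) * seg_mean \<phi> B C + (d \<bullet> (A - C)) * seg_mean \<phi> C A"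
    using insert by auto
  show ?case
  proof (cases "p \<in> ?N")
    case True
    then have "insert p ?N = ?N" by auto
    then show ?thesis using IH unfolding ins by simp
  next
    case False
    then obtain a b where ab: "(a, b) \<in> ?E" "p \<in> open_segment a b" using IH(2) insert.prems by fastforce
    obtain t where t: "0 < t" "t < 1" "p = a + t *\<^sub>R (b - a)" using ab(2) by (rule open_segment_point)
    have E': "boundary_segments K (insert p ?N) = ?E - {(a, b)} \<union> {(a, p), (p, b)}" (is "?E' = _")
      by (rule boundary_segments_insert[OF ab])
    have new: "(a, p) \<notin> ?E" "(p, b) \<notin> ?E" using False by (auto simp: boundary_segments_iff)
    have ne: "(a, p) \<noteq> (p, b)" using ab(2) by (auto simp: open_segment_def)
    have "frontier K - insert p ?N \<subseteq> (\<Union>e\<in>?E'. open_segment (fst e) (snd e))"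
    proof
      fix x assume x: "x \<in> frontier K - insert p ?N"
      then obtain e where e: "e \<in> ?E" "x \<in> open_segment (fst e) (snd e)" using IH(2) by auto
      show "x \<in> (\<Union>e\<in>?E'. open_segment (fst e) (snd e))"
      proof (cases "e = (a, b)")
        case True
        then have "x \<in> open_segment a p \<union> open_segment p b"
          using e(2) x ab(2) Un_open_segment[of p a b] by auto
        then show ?thesis unfolding E' by auto
      next
        case False
        then have "e \<in> ?E'" unfolding E' using e by blast
        then show ?thesis using e by blast
      qed
    qed
    moreover have "(\<Sum>e\<in>?E'. (d \<bullet> (snd e - fst e)) * seg_mean \<phi> (fst e) (snd e)) =
        (\<Sum>e\<in>?E. (d \<bullet> (snd e - fst e)) * seg_mean \<phi> (fst e) (snd e))" if \<phi>: "continuous_on UNIV \<phi>" for \<phi> d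
    proof -
      let ?f = "\<lambda>e. (d \<bullet> (snd e - fst e)) * seg_mean \<phi> (fst e) (snd e)"
      have "(\<Sum>e\<in>?E'. ?f e) = (\<Sum>e\<in>?E - {(a, b)}. ?f e) + (\<Sum>e\<in>{(a, p), (p, b)}. ?f e)"
        unfolding E' using IH(1) new by (intro sum.union_disjoint) auto
      also have "(\<Sum>e\<in>{(a, p), (p, b)}. ?f e) = ?f (a, p) + ?f (p, b)" using ne by simp
      also have "?f (a, p) + ?f (p, b) = ?f (a, b)"
      proof -
        have "p - a = t *\<^sub>R (b - a)" "b - p = (1 - t) *\<^sub>R (b - a)" by (simp_all add: t(3) algebra_simps)
        then have dp: "d \<bullet> (p - a) = t * (d \<bullet> (b - a))" "d \<bullet> (b - p) = (1 - t) * (d \<bullet> (b - a))"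
          by (simp_all only: inner_scaleR_right)
        show ?thesis
          unfolding fst_conv snd_conv dp seg_mean_split[OF \<phi> t(1,2), of a b, folded t(3)]
          by (simp add: distrib_left)
      qed
      also have "(\<Sum>e\<in>?E - {(a, b)}. ?f e) + ?f (a, b) = (\<Sum>e\<in>?E. ?f e)"
        using sum.remove[OF IH(1) ab(1), of ?f] by simp
      finally show ?thesis .
    qed
    moreover have "finite ?E'" unfolding E' using IH(1) by simp
    ultimately show ?thesis using IH(3) unfolding ins by auto
  qed
qed

lemma negligible_frontier_K: "negligible (frontier K)"
  using K_convex by (rule negligible_convex_frontier)

lemma integral_interior_K:
  fixes f :: "plane \<Rightarrow> 'a::euclidean_space"
  assumes f: "continuous_on UNIV f"
  shows "integrable (lebesgue_on (interior K)) f" "(LINT x|lebesgue_on (interior K). f x) = integral K f"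
proof -
  have aiK: "f absolutely_integrable_on K"
    using K_compact f by (intro absolutely_integrable_on_compact) (auto intro: continuous_on_subset)
  have sub: "K - interior K = frontier K" "interior K - K = {}"
    using K_compact interior_subset by (auto simp: frontier_def compact_imp_closed)
  have ai: "f absolutely_integrable_on interior K"
    by (rule absolutely_integrable_spike_set[OF aiK])
      (use sub in \<open>auto intro: negligible_subset[OF negligible_frontier_K]\<close>)
  then show "integrable (lebesgue_on (interior K)) f"
    by (subst integrable_restrict_space) (auto simp: set_integrable_def)
  have "(LINT x|lebesgue_on (interior K). f x) = integral (interior K) f"
    using ai by (intro lebesgue_integral_eq_integral) (auto simp: integrable_restrict_space set_integrable_def)
  also have "\<dots> = integral K f"
    using sub negligible_frontier_K by (intro integral_spike_set) (auto intro: negligible_subset)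
  finally show "(LINT x|lebesgue_on (interior K). f x) = integral K f" .
qed

text \<open>Integrals of derivatives in the directions of two edges are known, and these directions span the
  plane.\<close>

lemma green_formula_vertices:
  assumes C1: "C1_with_gradient \<phi> g"
  shows "(d \<bullet> (B - A)) * seg_mean \<phi> A B + (d \<bullet> (C - B)) * seg_mean \<phi> B C + (d \<bullet> (A - C)) * seg_mean \<phi> C A =
    - (LINT x|lebesgue_on (interior K). d \<bullet> rotate (g x))"
proof -
  note c = C1_with_gradientD[OF C1]
  let ?D = "cross2 (B - A) (C - A)"
  let ?G = "integral K g"
  have 1: "?G \<bullet> (B - A) = ?D * (seg_mean \<phi> B C - seg_mean \<phi> C A)"
    using triangle_directional_integral[OF C1, of B A C] ccw seg_mean_reverse[OF c(1), of A C] by (simp add: K_def)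
  have ccw': "cross2 (C - A) (B - A) = - ?D" by (simp add: cross2_def)
  have "?G \<bullet> (C - A) = \<bar>cross2 (C - A) (B - A)\<bar> * (seg_mean \<phi> C B - seg_mean \<phi> A B)"
    using triangle_directional_integral[OF C1, of C A B] ccw unfolding ccw' by (simp add: K_def insert_commute)
  then have 2: "?G \<bullet> (C - A) = ?D * (seg_mean \<phi> B C - seg_mean \<phi> A B)"
    using ccw seg_mean_reverse[OF c(1), of C B] by (simp add: ccw')
  have "(LINT x|lebesgue_on (interior K). d \<bullet> rotate (g x)) = (LINT x|lebesgue_on (interior K). g x \<bullet> (- rotate d))"
    by (intro Bochner_Integration.integral_cong) (auto simp: inner_plane)
  also have "\<dots> = ?G \<bullet> (- rotate d)"
    using integral_interior_K[OF c(2)] by simp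
  also have "?D * (?G \<bullet> (- rotate d)) = (- (d \<bullet> (C - A))) * (?G \<bullet> (B - A)) + (d \<bullet> (B - A)) * (?G \<bullet> (C - A))"
    by (simp add: inner_plane cross2_def algebra_simps)
  finally have "?D * (LINT x|lebesgue_on (interior K). d \<bullet> rotate (g x)) =
     ?D * (- (d \<bullet> (C - A)) * (seg_mean \<phi> B C - seg_mean \<phi> C A) + (d \<bullet> (B - A)) * (seg_mean \<phi> B C - seg_mean \<phi> A B))"
    unfolding 1 2 by (simp add: algebra_simps)
  then have "(LINT x|lebesgue_on (interior K). d \<bullet> rotate (g x)) =
     - (d \<bullet> (C - A)) * (seg_mean \<phi> B C - seg_mean \<phi> C A) + (d \<bullet> (B - A)) * (seg_mean \<phi> B C - seg_mean \<phi> A B)"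
    using ccw by simp
  then show ?thesis by (simp add: algebra_simps)
qed

text \<open>Subdivision does not change boundary integrals, so the formula for the three edges carries over.\<close>

lemma green_formula:
  assumes C1: "C1_with_gradient \<phi> g" and M: "finite M" "M \<subseteq> frontier K"
  shows "(\<Sum>e\<in>boundary_segments K ({A, B, C} \<union> M). (d \<bullet> (snd e - fst e)) * seg_mean \<phi> (fst e) (snd e)) =
    - (LINT x|lebesgue_on (interior K). d \<bullet> rotate (g x))"
  using boundary_subdivision[OF M] C1_with_gradientD(1)[OF C1] green_formula_vertices[OF C1] by simp

end

section \<open>Trace and Poincare inequalities\<close>

lemma norm_rotate: "norm (rotate w) = norm w"
  by (simp add: norm_eq_sqrt_inner inner_plane add.commute)

lemma seg_integrable:
  assumes "continuous_on UNIV (f :: scalar_field)"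
  shows "integrable (lebesgue_on {0..1}) (\<lambda>s. f (a + s *\<^sub>R (b - a)))"
proof -
  have "(\<lambda>s. f (a + s *\<^sub>R (b - a))) absolutely_integrable_on {0..1}"
    by (intro absolutely_integrable_on_compact continuous_on_seg assms) auto
  then show ?thesis by (subst integrable_restrict_space) (auto simp: set_integrable_def)
qed

lemma seg_mean_nonneg: "(\<And>x. f x \<ge> 0) \<Longrightarrow> seg_mean f a b \<ge> 0"
  unfolding seg_mean_def by simp

lemma C1_square_times_coordinate:
  assumes C1: "C1_with_gradient \<phi> g"
  shows "C1_with_gradient (\<lambda>x. (\<phi> x)\<^sup>2 * (x - c) $ i) (\<lambda>x. (2 * \<phi> x * (x - c) $ i) *\<^sub>R g x + (\<phi> x)\<^sup>2 *\<^sub>R axis i 1)"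
  unfolding C1_with_gradient_def
proof (intro conjI allI)
  note d = C1_with_gradientD[OF C1]
  show "continuous_on UNIV (\<lambda>x. (2 * \<phi> x * (x - c) $ i) *\<^sub>R g x + (\<phi> x)\<^sup>2 *\<^sub>R axis i 1)"
    by (intro continuous_intros d)
  fix x
  have "((\<lambda>x. (x - c) $ i) has_derivative (\<lambda>h. h $ i)) (at x)"
    by (auto intro!: derivative_eq_intros bounded_linear.has_derivative[OF bounded_linear_vec_nth])
  then have "((\<lambda>x. (\<phi> x)\<^sup>2 * (x - c) $ i) has_derivative
      (\<lambda>h. (\<phi> x)\<^sup>2 * h $ i + (of_nat 2 * (h \<bullet> g x) * (\<phi> x) ^ (2 - 1)) * (x - c) $ i)) (at x)"
    by (intro has_derivative_mult has_derivative_power d)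
  moreover have "(\<lambda>h. (\<phi> x)\<^sup>2 * h $ i + (of_nat 2 * (h \<bullet> g x) * (\<phi> x) ^ (2 - 1)) * (x - c) $ i) =
      (\<lambda>h. h \<bullet> ((2 * \<phi> x * (x - c) $ i) *\<^sub>R g x + (\<phi> x)\<^sup>2 *\<^sub>R axis i 1))"
    by (rule ext) (simp add: inner_add_right inner_axis algebra_simps)
  ultimately show "GDERIV (\<lambda>x. (\<phi> x)\<^sup>2 * (x - c) $ i) x :> (2 * \<phi> x * (x - c) $ i) *\<^sub>R g x + (\<phi> x)\<^sup>2 *\<^sub>R axis i 1"
    by (simp add: gderiv_def)
qed

context triangle
begin

lemma edge_distance:
  assumes left: "\<forall>x\<in>K. left_of a b x" and ball: "cball x0 r \<subseteq> K" "r > 0"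
  shows "r * dist a b \<le> cross2 (b - a) (x0 - a)"
proof (cases "a = b")
  case False
  define w where "w = b - a"
  have w: "norm w > 0" using False by (simp add: w_def)
  let ?\<delta> = "(r / norm w) *\<^sub>R rotate w"
  have "x0 + ?\<delta> \<in> cball x0 r" using w ball by (simp add: dist_norm norm_rotate)
  then have "left_of a b (x0 + ?\<delta>)" using left ball by blast
  then have "0 \<le> cross2 w (x0 - a) + cross2 w ?\<delta>"
    by (simp add: left_of_def w_def cross2_simps)
  moreover have "cross2 w ?\<delta> = - (r / norm w) * (w \<bullet> w)"
    by (simp add: cross2_simps(6) cross2_def inner_plane algebra_simps)
  moreover have "(r / norm w) * (w \<bullet> w) = r * norm w" using w by (simp add: dot_square_norm power2_eq_square)
  ultimately show ?thesis by (simp add: w_def dist_norm norm_minus_commute)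
qed (simp add: cross2_def)

text \<open>Green's formula for the field \<open>\<phi>\<^sup>2 (x - x0)\<close>: its normal component on an edge is \<open>\<phi>\<^sup>2\<close>
  times the distance of \<open>x0\<close> to the line through the edge, which is at least the radius of an inscribed disc.\<close>

lemma trace_inequality:
  assumes C1: "C1_with_gradient \<phi> g" and M: "finite M" "M \<subseteq> frontier K"
    and ball: "cball x0 r \<subseteq> K" "r > 0" and diam: "diameter K \<le> d"
  shows "r * (\<Sum>e\<in>boundary_segments K ({A, B, C} \<union> M). dist (fst e) (snd e) * seg_mean (\<lambda>x. (\<phi> x)\<^sup>2) (fst e) (snd e))
    \<le> 3 * (LINT x|lebesgue_on (interior K). (\<phi> x)\<^sup>2) + d\<^sup>2 * (LINT x|lebesgue_on (interior K). (norm (g x))\<^sup>2)"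
proof -
  note c = C1_with_gradientD[OF C1]
  let ?E = "boundary_segments K ({A, B, C} \<union> M)"
  let ?P = "\<lambda>i x. (\<phi> x)\<^sup>2 * (x - x0) $ i"
  let ?G = "\<lambda>i x. (2 * \<phi> x * (x - x0) $ i) *\<^sub>R g x + (\<phi> x)\<^sup>2 *\<^sub>R axis i 1 :: plane"
  note P = C1_square_times_coordinate[OF C1, of x0]
  have d0: "d \<ge> 0" using diam K_compact diameter_ge_0[of K] compact_imp_bounded by fastforce
  have x0K: "x0 \<in> K" using ball by auto
  have edge: "r * (dist (fst e) (snd e) * seg_mean (\<lambda>x. (\<phi> x)\<^sup>2) (fst e) (snd e)) \<le>
      (axis 2 1 \<bullet> (snd e - fst e)) * seg_mean (?P 1) (fst e) (snd e) + (- axis 1 1 \<bullet> (snd e - fst e)) * seg_mean (?P 2) (fst e) (snd e)"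
    if e: "e \<in> ?E" for e
  proof -
    obtain a b where ab: "e = (a, b)" by (cases e)
    have left: "\<forall>x\<in>K. left_of a b x" using e by (simp add: ab boundary_segments_iff)
    have "(axis 2 1 \<bullet> (b - a)) * seg_mean (?P 1) a b + (- axis 1 1 \<bullet> (b - a)) * seg_mean (?P 2) a b =
        (LINT s|lebesgue_on {0..1}. (b - a) $ 2 * ?P 1 (a + s *\<^sub>R (b - a)) + - (b - a) $ 1 * ?P 2 (a + s *\<^sub>R (b - a)))"
      unfolding seg_mean_def
      by (subst Bochner_Integration.integral_add)
        (use seg_integrable[OF C1_with_gradientD(1)[OF P]] in \<open>auto simp: inner_axis'\<close>)
    also have "\<dots> = (LINT s|lebesgue_on {0..1}. cross2 (b - a) (x0 - a) * (\<phi> (a + s *\<^sub>R (b - a)))\<^sup>2)"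
      by (intro Bochner_Integration.integral_cong) (auto simp: cross2_def algebra_simps)
    also have "\<dots> = cross2 (b - a) (x0 - a) * seg_mean (\<lambda>x. (\<phi> x)\<^sup>2) a b"
      by (simp add: seg_mean_def)
    also have "\<dots> \<ge> (r * dist a b) * seg_mean (\<lambda>x. (\<phi> x)\<^sup>2) a b"
      by (intro mult_right_mono edge_distance left ball seg_mean_nonneg) simp
    finally show ?thesis by (simp add: ab mult.assoc)
  qed
  have "r * (\<Sum>e\<in>?E. dist (fst e) (snd e) * seg_mean (\<lambda>x. (\<phi> x)\<^sup>2) (fst e) (snd e)) \<le>
      (\<Sum>e\<in>?E. (axis 2 1 \<bullet> (snd e - fst e)) * seg_mean (?P 1) (fst e) (snd e)) +
      (\<Sum>e\<in>?E. (- axis 1 1 \<bullet> (snd e - fst e)) * seg_mean (?P 2) (fst e) (snd e))"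
    unfolding sum_distrib_left sum.distrib[symmetric] using edge by (intro sum_mono)
  also have "\<dots> = - (LINT x|lebesgue_on (interior K). axis 2 1 \<bullet> rotate (?G 1 x)) - (LINT x|lebesgue_on (interior K). - axis 1 1 \<bullet> rotate (?G 2 x))"
    unfolding green_formula[OF P M] by simp
  also have "\<dots> = (LINT x|lebesgue_on (interior K). ?G 1 x $ 1 + ?G 2 x $ 2)"
  proof -
    have i: "integrable (lebesgue_on (interior K)) (\<lambda>x. ?G i x $ j)" for i j
      by (intro integral_interior_K(1) continuous_intros c)
    have e: "axis 2 1 \<bullet> rotate v = - v $ 1" "- axis 1 1 \<bullet> rotate v = - v $ 2" for v :: plane
      by (simp_all add: inner_axis')
    show ?thesis
      by (subst Bochner_Integration.integral_add[OF i i])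
        (simp only: e Bochner_Integration.integral_minus minus_minus diff_minus_eq_add)
  qed
  also have "\<dots> \<le> (LINT x|lebesgue_on (interior K). 3 * (\<phi> x)\<^sup>2 + d\<^sup>2 * (norm (g x))\<^sup>2)"
  proof (rule integral_mono)
    show "integrable (lebesgue_on (interior K)) (\<lambda>x. ?G 1 x $ 1 + ?G 2 x $ 2)"
      "integrable (lebesgue_on (interior K)) (\<lambda>x. 3 * (\<phi> x)\<^sup>2 + d\<^sup>2 * (norm (g x))\<^sup>2)"
      by (intro integral_interior_K(1) continuous_intros c)+
    fix x assume "x \<in> space (lebesgue_on (interior K))"
    then have "x \<in> K" using interior_subset by auto
    then have xd: "norm (x - x0) \<le> d"
      using diameter_bounded_bound[OF compact_imp_bounded[OF K_compact], of x x0] x0K diam by (simp add: dist_norm)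
    have "?G 1 x $ 1 + ?G 2 x $ 2 = 2 * (\<phi> x)\<^sup>2 + 2 * (\<phi> x * (g x \<bullet> (x - x0)))"
      by (simp add: inner_plane axis_def algebra_simps)
    also have "2 * (\<phi> x * (g x \<bullet> (x - x0))) \<le> (\<phi> x)\<^sup>2 + (g x \<bullet> (x - x0))\<^sup>2"
      using sum_squares_bound[of "\<phi> x" "g x \<bullet> (x - x0)"] by simp
    also have "(g x \<bullet> (x - x0))\<^sup>2 \<le> (d * norm (g x))\<^sup>2"
    proof (rule abs_le_square_iff[THEN iffD1])
      have "\<bar>g x \<bullet> (x - x0)\<bar> \<le> norm (g x) * norm (x - x0)" by (rule Cauchy_Schwarz_ineq2)
      also have "\<dots> \<le> norm (g x) * d" using xd by (intro mult_left_mono) auto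
      finally show "\<bar>g x \<bullet> (x - x0)\<bar> \<le> \<bar>d * norm (g x)\<bar>" using d0 by (simp add: mult.commute abs_mult)
    qed
    finally show "?G 1 x $ 1 + ?G 2 x $ 2 \<le> 3 * (\<phi> x)\<^sup>2 + d\<^sup>2 * (norm (g x))\<^sup>2"
      by (simp add: power_mult_distrib)
  qed
  also have "\<dots> = 3 * (LINT x|lebesgue_on (interior K). (\<phi> x)\<^sup>2) + d\<^sup>2 * (LINT x|lebesgue_on (interior K). (norm (g x))\<^sup>2)"
  proof -
    have "integrable (lebesgue_on (interior K)) (\<lambda>x. (\<phi> x)\<^sup>2)" "integrable (lebesgue_on (interior K)) (\<lambda>x. (norm (g x))\<^sup>2)"
      by (intro integral_interior_K(1) continuous_intros c)+
    then show ?thesis by simp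
  qed
  finally show ?thesis .
qed

end

text \<open>The fundamental theorem of calculus along the segment, followed by Jensen's inequality.\<close>

lemma increment_square_le:
  fixes x y :: plane
  assumes C1: "C1_with_gradient \<phi> g"
  shows "ennreal ((\<phi> x - \<phi> y)\<^sup>2) \<le> ennreal ((norm (x - y))\<^sup>2) * (\<integral>\<^sup>+t. indicator {0..1} t * ennreal ((norm (g (y + t *\<^sub>R (x - y))))\<^sup>2) \<partial>lborel)"
proof -
  note c = C1_with_gradientD[OF C1]
  define q where "q t = g (y + t *\<^sub>R (x - y)) \<bullet> (x - y)" for t
  define n where "n t = (norm (g (y + t *\<^sub>R (x - y))))\<^sup>2" for t
  have cq: "continuous_on UNIV q" unfolding q_def by (intro continuous_intros continuous_on_seg c)
  have cn: "continuous_on UNIV n" unfolding n_def by (intro continuous_intros continuous_on_seg c)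
  define m where "m = \<phi> x - \<phi> y"
  have "((\<lambda>t. y + t *\<^sub>R (x - y)) has_derivative (\<lambda>h. h *\<^sub>R (x - y))) (at t)" for t
    by (auto intro!: derivative_eq_intros)
  from has_derivative_compose[OF this c(3)]
  have "DERIV (\<lambda>t. \<phi> (y + t *\<^sub>R (x - y))) t :> q t" for t
    by (simp add: has_field_derivative_def q_def inner_commute mult_commute_abs)
  moreover have "isCont q t" for t using cq by (simp add: continuous_on_eq_continuous_at)
  ultimately have "(LINT t|lborel. q t * indicator {0..1} t) = \<phi> (y + 1 *\<^sub>R (x - y)) - \<phi> (y + 0 *\<^sub>R (x - y))"
    by (intro integral_FTC_Icc_real) (auto intro: has_field_derivative_at_within)
  then have m: "(LINT t|lborel. indicator {0..1} t * q t) = m" by (simp add: m_def mult.commute)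
  have i1: "integrable lborel (\<lambda>t. indicator {0..1} t * q t)" by (rule continuous_borel_integrable_Icc[OF cq])
  have i2: "integrable lborel (\<lambda>t. indicator {0..1} t * (q t)\<^sup>2)"
    by (intro continuous_borel_integrable_Icc continuous_intros cq)
  have i0: "integrable lborel (indicator {0..1::real} :: real \<Rightarrow> real)" by simp
  have i3: "integrable lborel (\<lambda>t. indicator {0..1} t * n t)" by (rule continuous_borel_integrable_Icc[OF cn])
  have "0 \<le> (LINT t|lborel. indicator {0..1} t * (q t - m)\<^sup>2)" by simp
  also have "(\<lambda>t. indicator {0..1} t * (q t - m)\<^sup>2) =
      (\<lambda>t. indicator {0..1} t * (q t)\<^sup>2 - 2 * m * (indicator {0..1} t * q t) + m\<^sup>2 * indicator {0..1} t)"
    by (auto simp: power2_eq_square algebra_simps)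
  also have "(LINT t|lborel. indicator {0..1} t * (q t)\<^sup>2 - 2 * m * (indicator {0..1} t * q t) + m\<^sup>2 * indicator {0..1} t) =
      (LINT t|lborel. indicator {0..1} t * (q t)\<^sup>2) - 2 * m * m + m\<^sup>2 * 1"
    using i0 i1 i2 m by simp
  finally have "m\<^sup>2 \<le> (LINT t|lborel. indicator {0..1} t * (q t)\<^sup>2)" by (simp add: power2_eq_square)
  also have "\<dots> \<le> (LINT t|lborel. (norm (x - y))\<^sup>2 * (indicator {0..1} t * n t))"
  proof (rule integral_mono)
    fix t
    have "(q t)\<^sup>2 \<le> (norm (g (y + t *\<^sub>R (x - y))) * norm (x - y))\<^sup>2"
      unfolding q_def using Cauchy_Schwarz_ineq2 by (intro abs_le_square_iff[THEN iffD1]) (auto simp: abs_mult)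
    then show "indicator {0..1} t * (q t)\<^sup>2 \<le> (norm (x - y))\<^sup>2 * (indicator {0..1} t * n t)"
      by (auto simp: indicator_def n_def power_mult_distrib mult.commute)
  qed (use i2 i3 in auto)
  also have "\<dots> = (norm (x - y))\<^sup>2 * (LINT t|lborel. indicator {0..1} t * n t)" by simp
  finally have "ennreal (m\<^sup>2) \<le> ennreal ((norm (x - y))\<^sup>2) * ennreal (LINT t|lborel. indicator {0..1} t * n t)"
    by (subst ennreal_mult'[symmetric]) (auto intro: ennreal_leI)
  also have "ennreal (LINT t|lborel. indicator {0..1} t * n t) = (\<integral>\<^sup>+t. ennreal (indicator {0..1} t * n t) \<partial>lborel)"
    using i3 by (intro nn_integral_eq_integral[symmetric]) (auto simp: n_def)
  also have "\<dots> = (\<integral>\<^sup>+t. indicator {0..1} t * ennreal (n t) \<partial>lborel)"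
    by (intro nn_integral_cong) (auto simp: indicator_def)
  finally show ?thesis by (simp add: m_def n_def)
qed

text \<open>Averaging over both end points. For a fixed parameter the points that divide the segments in
  that ratio are obtained from one of the end points by a dilation by a factor of at least one half,
  so the double integral costs at most a factor of four.\<close>

lemma nn_integral_dividing_points_le:
  fixes h :: "plane \<Rightarrow> ennreal" and K :: "plane set"
  assumes [measurable]: "h \<in> borel_measurable borel" "K \<in> sets borel" and t: "0 \<le> t" "t \<le> 1"
  shows "(\<integral>\<^sup>+x. indicator K x * (\<integral>\<^sup>+y. indicator K y * h (y + t *\<^sub>R (x - y)) \<partial>lborel) \<partial>lborel)
    \<le> 4 * emeasure lborel K * (\<integral>\<^sup>+x. h x \<partial>lborel)"
proof -
  have dil: "(\<integral>\<^sup>+y. h (z + s *\<^sub>R y) \<partial>lborel) \<le> 4 * (\<integral>\<^sup>+x. h x \<partial>lborel)" if "1 / 2 \<le> s" for z s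
  proof -
    have "1 \<le> 4 * s\<^sup>2" using that power_mono[of "1/2" s 2] by (simp add: power2_eq_square)
    then have "1 * (\<integral>\<^sup>+y. h (z + s *\<^sub>R y) \<partial>lborel) \<le> ennreal (4 * s\<^sup>2) * (\<integral>\<^sup>+y. h (z + s *\<^sub>R y) \<partial>lborel)"
      by (intro mult_right_mono) (auto simp flip: ennreal_1 intro: ennreal_leI)
    also have "\<dots> = 4 * (\<integral>\<^sup>+x. h x \<partial>lborel)"
      using that nn_integral_affine[of h s z] by (simp add: ennreal_mult' mult.assoc)
    finally show ?thesis by simp
  qed
  show ?thesis
  proof (cases "t \<le> 1 / 2")
    case True
    have "(\<integral>\<^sup>+x. indicator K x * (\<integral>\<^sup>+y. indicator K y * h (y + t *\<^sub>R (x - y)) \<partial>lborel) \<partial>lborel) \<le>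
        (\<integral>\<^sup>+x. indicator K x * (4 * (\<integral>\<^sup>+x. h x \<partial>lborel)) \<partial>lborel)"
    proof (intro nn_integral_mono mult_left_mono)
      fix x
      have "(\<integral>\<^sup>+y. indicator K y * h (y + t *\<^sub>R (x - y)) \<partial>lborel) \<le> (\<integral>\<^sup>+y. h (t *\<^sub>R x + (1 - t) *\<^sub>R y) \<partial>lborel)"
        by (intro nn_integral_mono) (auto simp: indicator_def algebra_simps)
      then show "(\<integral>\<^sup>+y. indicator K y * h (y + t *\<^sub>R (x - y)) \<partial>lborel) \<le> 4 * (\<integral>\<^sup>+x. h x \<partial>lborel)"
        using dil[of "1 - t" "t *\<^sub>R x"] True by simp
    qed auto
    also have "\<dots> = 4 * emeasure lborel K * (\<integral>\<^sup>+x. h x \<partial>lborel)"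
      by (subst nn_integral_multc) (auto simp: ac_simps)
    finally show ?thesis .
  next
    case False
    have "(\<integral>\<^sup>+x. indicator K x * (\<integral>\<^sup>+y. indicator K y * h (y + t *\<^sub>R (x - y)) \<partial>lborel) \<partial>lborel) =
        (\<integral>\<^sup>+x. (\<integral>\<^sup>+y. indicator K x * (indicator K y * h (y + t *\<^sub>R (x - y))) \<partial>lborel) \<partial>lborel)"
      by (intro nn_integral_cong nn_integral_cmult[symmetric]) measurable
    also have "\<dots> = (\<integral>\<^sup>+y. (\<integral>\<^sup>+x. indicator K x * (indicator K y * h (y + t *\<^sub>R (x - y))) \<partial>lborel) \<partial>lborel)"
      by (rule lborel_pair.Fubini') measurable
    also have "\<dots> \<le> (\<integral>\<^sup>+y. indicator K y * (4 * (\<integral>\<^sup>+x. h x \<partial>lborel)) \<partial>lborel)"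
    proof (rule nn_integral_mono)
      fix y
      have "(\<integral>\<^sup>+x. indicator K x * (indicator K y * h (y + t *\<^sub>R (x - y))) \<partial>lborel) \<le>
          (\<integral>\<^sup>+x. indicator K y * h ((1 - t) *\<^sub>R y + t *\<^sub>R x) \<partial>lborel)"
        by (intro nn_integral_mono) (auto simp: indicator_def algebra_simps)
      also have "\<dots> = indicator K y * (\<integral>\<^sup>+x. h ((1 - t) *\<^sub>R y + t *\<^sub>R x) \<partial>lborel)"
        by (rule nn_integral_cmult) measurable
      also have "\<dots> \<le> indicator K y * (4 * (\<integral>\<^sup>+x. h x \<partial>lborel))"
        using dil[of t "(1 - t) *\<^sub>R y"] False by (intro mult_left_mono) auto
      finally show "(\<integral>\<^sup>+x. indicator K x * (indicator K y * h (y + t *\<^sub>R (x - y))) \<partial>lborel) \<le>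
          indicator K y * (4 * (\<integral>\<^sup>+x. h x \<partial>lborel))" .
    qed
    also have "\<dots> = 4 * emeasure lborel K * (\<integral>\<^sup>+x. h x \<partial>lborel)"
      by (subst nn_integral_multc) (auto simp: ac_simps)
    finally show ?thesis .
  qed
qed

text \<open>The squared increments, averaged over both end points, are bounded by the gradient. So some
  point \<open>y\<close> is not worse than the average, and its value serves as the constant to be subtracted.\<close>

lemma poincare_inequality:
  fixes K :: "plane set"
  assumes C1: "C1_with_gradient \<phi> g" and K: "compact K" "convex K" and int: "interior K \<noteq> {}"
    and diam: "diameter K \<le> d"
  obtains y where "y \<in> K"
    "(LINT x|lborel. indicator K x * (\<phi> x - \<phi> y)\<^sup>2) \<le> 4 * d\<^sup>2 * (LINT x|lborel. indicator K x * (norm (g x))\<^sup>2)"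
proof -
  note c = C1_with_gradientD[OF C1]
  note [measurable] = c(4,5)
  have [measurable]: "K \<in> sets borel" using K by (simp add: compact_imp_closed)
  have d0: "d \<ge> 0" using diam K diameter_ge_0[of K] compact_imp_bounded by fastforce
  define h where "h x = indicator K x * ennreal ((norm (g x))\<^sup>2)" for x
  have hm[measurable]: "h \<in> borel_measurable borel" unfolding h_def[abs_def] by measurable
  define I where "I y = (\<integral>\<^sup>+x. indicator K x * ennreal ((\<phi> x - \<phi> y)\<^sup>2) \<partial>lborel)" for y
  have Im[measurable]: "I \<in> borel_measurable borel" unfolding I_def[abs_def] by measurable
  let ?H = "\<integral>\<^sup>+x. h x \<partial>lborel"
  have iint: "integrable lborel (\<lambda>x. indicator K x * f x)" if "continuous_on UNIV f" for f :: scalar_field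
    using borel_integrable_compact[of K f] K that by (auto intro: continuous_on_subset)
  have nneq: "(\<integral>\<^sup>+x. indicator K x * ennreal (f x) \<partial>lborel) = ennreal (LINT x|lborel. indicator K x * f x)"
    if "continuous_on UNIV f" "\<And>x. f x \<ge> 0" for f :: scalar_field
  proof -
    have "(\<integral>\<^sup>+x. ennreal (indicator K x * f x) \<partial>lborel) = ennreal (LINT x|lborel. indicator K x * f x)"
      using iint[OF that(1)] that(2) by (intro nn_integral_eq_integral) auto
    moreover have "ennreal (indicator K x * f x) = indicator K x * ennreal (f x)" for x
      by (auto simp: indicator_def)
    ultimately show ?thesis by simp
  qed
  have Kfin: "emeasure lborel K < \<infinity>" using K by (intro emeasure_bounded_finite compact_imp_bounded)
  have Kpos: "emeasure lborel K \<noteq> 0"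
  proof
    assume "emeasure lborel K = 0"
    then have "emeasure lborel (interior K) = 0"
      using emeasure_mono[OF interior_subset, of K lborel] by simp
    then have "interior K \<in> null_sets lebesgue" by (auto intro: null_sets_completionI)
    then show False using int open_not_negligible[of "interior K"] by (simp add: negligible_iff_null_sets)
  qed
  have seg: "y + t *\<^sub>R (x - y) \<in> K" if "x \<in> K" "y \<in> K" "0 \<le> t" "t \<le> 1" for x y t
    using convexD[OF K(2) that(2,1), of "1 - t" t] that by (simp add: algebra_simps)
  have pt: "indicator K y * (indicator K x * ennreal ((\<phi> x - \<phi> y)\<^sup>2)) \<le>
      ennreal (d\<^sup>2) * (\<integral>\<^sup>+t. indicator {0..1} t * (indicator K x * (indicator K y * h (y + t *\<^sub>R (x - y)))) \<partial>lborel)" for x y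
  proof (cases "x \<in> K \<and> y \<in> K")
    case True
    have "(norm (x - y))\<^sup>2 \<le> d\<^sup>2"
      using diameter_bounded_bound[OF compact_imp_bounded[OF K(1)], of x y] True diam
      by (intro power_mono) (auto simp: dist_norm)
    then have "ennreal ((\<phi> x - \<phi> y)\<^sup>2) \<le> ennreal (d\<^sup>2) * (\<integral>\<^sup>+t. indicator {0..1} t * ennreal ((norm (g (y + t *\<^sub>R (x - y))))\<^sup>2) \<partial>lborel)"
      by (intro order_trans[OF increment_square_le[OF C1]] mult_right_mono ennreal_leI) auto
    also have "(\<integral>\<^sup>+t. indicator {0..1} t * ennreal ((norm (g (y + t *\<^sub>R (x - y))))\<^sup>2) \<partial>lborel) =
        (\<integral>\<^sup>+t. indicator {0..1} t * (indicator K x * (indicator K y * h (y + t *\<^sub>R (x - y)))) \<partial>lborel)"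
      using True seg by (intro nn_integral_cong) (auto simp: h_def indicator_def)
    finally show ?thesis using True by simp
  qed auto
  have "(\<integral>\<^sup>+y. indicator K y * I y \<partial>lborel) = (\<integral>\<^sup>+y. (\<integral>\<^sup>+x. indicator K y * (indicator K x * ennreal ((\<phi> x - \<phi> y)\<^sup>2)) \<partial>lborel) \<partial>lborel)"
    unfolding I_def by (intro nn_integral_cong nn_integral_cmult[symmetric]) measurable
  also have "\<dots> \<le> (\<integral>\<^sup>+y. (\<integral>\<^sup>+x. ennreal (d\<^sup>2) * (\<integral>\<^sup>+t. indicator {0..1} t * (indicator K x * (indicator K y * h (y + t *\<^sub>R (x - y)))) \<partial>lborel) \<partial>lborel) \<partial>lborel)"
    by (intro nn_integral_mono pt)
  also have "\<dots> = (\<integral>\<^sup>+y. ennreal (d\<^sup>2) * (\<integral>\<^sup>+x. (\<integral>\<^sup>+t. indicator {0..1} t * (indicator K x * (indicator K y * h (y + t *\<^sub>R (x - y)))) \<partial>lborel) \<partial>lborel) \<partial>lborel)"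
    by (intro nn_integral_cong nn_integral_cmult) measurable
  also have "\<dots> = ennreal (d\<^sup>2) * (\<integral>\<^sup>+y. (\<integral>\<^sup>+x. (\<integral>\<^sup>+t. indicator {0..1} t * (indicator K x * (indicator K y * h (y + t *\<^sub>R (x - y)))) \<partial>lborel) \<partial>lborel) \<partial>lborel)"
    by (intro nn_integral_cmult) measurable
  \<comment> \<open>The integration over the parameter of the segment is moved to the outside.\<close>
  also have "(\<integral>\<^sup>+y. (\<integral>\<^sup>+x. (\<integral>\<^sup>+t. indicator {0..1} t * (indicator K x * (indicator K y * h (y + t *\<^sub>R (x - y)))) \<partial>lborel) \<partial>lborel) \<partial>lborel) =
      (\<integral>\<^sup>+x. (\<integral>\<^sup>+y. (\<integral>\<^sup>+t. indicator {0..1} t * (indicator K x * (indicator K y * h (y + t *\<^sub>R (x - y)))) \<partial>lborel) \<partial>lborel) \<partial>lborel)"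
    by (rule lborel_pair.Fubini') measurable
  also have "\<dots> = (\<integral>\<^sup>+x. (\<integral>\<^sup>+t. (\<integral>\<^sup>+y. indicator {0..1} t * (indicator K x * (indicator K y * h (y + t *\<^sub>R (x - y)))) \<partial>lborel) \<partial>lborel) \<partial>lborel)"
    by (intro nn_integral_cong lborel_pair.Fubini') measurable
  also have "\<dots> = (\<integral>\<^sup>+t. (\<integral>\<^sup>+x. (\<integral>\<^sup>+y. indicator {0..1} t * (indicator K x * (indicator K y * h (y + t *\<^sub>R (x - y)))) \<partial>lborel) \<partial>lborel) \<partial>lborel)"
    by (rule lborel_pair.Fubini') measurable
  also have "\<dots> \<le> (\<integral>\<^sup>+t. (4 * emeasure lborel K * ?H) * indicator {0..1::real} t \<partial>lborel)"
  proof (rule nn_integral_mono)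
    fix t :: real
    show "(\<integral>\<^sup>+x. (\<integral>\<^sup>+y. indicator {0..1} t * (indicator K x * (indicator K y * h (y + t *\<^sub>R (x - y)))) \<partial>lborel) \<partial>lborel)
        \<le> (4 * emeasure lborel K * ?H) * indicator {0..1} t"
    proof (cases "t \<in> {0..1}")
      case True
      have "(\<integral>\<^sup>+x. (\<integral>\<^sup>+y. indicator K x * (indicator K y * h (y + t *\<^sub>R (x - y))) \<partial>lborel) \<partial>lborel) =
          (\<integral>\<^sup>+x. indicator K x * (\<integral>\<^sup>+y. indicator K y * h (y + t *\<^sub>R (x - y)) \<partial>lborel) \<partial>lborel)"
        by (intro nn_integral_cong nn_integral_cmult) measurable
      then show ?thesis using nn_integral_dividing_points_le[of h K t] True by simp
    qed simp
  qed
  also have "\<dots> = 4 * emeasure lborel K * ?H" by (subst nn_integral_cmult_indicator) auto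
  finally have le: "(\<integral>\<^sup>+y. indicator K y * I y \<partial>lborel) \<le> ennreal (d\<^sup>2) * (4 * emeasure lborel K * ?H)"
    by (simp add: mult_left_mono)
  define c0 where "c0 = 4 * d\<^sup>2 * (LINT x|lborel. indicator K x * (norm (g x))\<^sup>2)"
  have H: "?H = ennreal (LINT x|lborel. indicator K x * (norm (g x))\<^sup>2)"
    unfolding h_def by (intro nneq continuous_intros c) auto
  have c0: "c0 \<ge> 0" by (simp add: c0_def)
  have "ennreal (d\<^sup>2) * (4 * emeasure lborel K * ?H) = ennreal c0 * emeasure lborel K"
    unfolding H c0_def by (simp add: ennreal_mult' ac_simps)
  with le have le': "(\<integral>\<^sup>+y. indicator K y * I y \<partial>lborel) \<le> ennreal c0 * emeasure lborel K" by simp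
  have "\<exists>y\<in>K. I y \<le> ennreal c0"
  proof (rule ccontr)
    assume "\<not> ?thesis"
    then have gt: "ennreal c0 < I y" if "y \<in> K" for y using that by (auto simp: not_le)
    have "(\<integral>\<^sup>+y. ennreal c0 * indicator K y \<partial>lborel) < (\<integral>\<^sup>+y. indicator K y * I y \<partial>lborel)"
    proof (rule nn_integral_less)
      show "(\<integral>\<^sup>+y. ennreal c0 * indicator K y \<partial>lborel) \<noteq> \<infinity>"
        using Kfin by (subst nn_integral_cmult_indicator) (auto simp: ennreal_mult_eq_top_iff)
      show "AE y in lborel. ennreal c0 * indicator K y \<le> indicator K y * I y"
        using gt by (intro AE_I2) (auto simp: indicator_def intro: less_imp_le)
      show "\<not> (AE y in lborel. indicator K y * I y \<le> ennreal c0 * indicator K y)"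
      proof
        assume "AE y in lborel. indicator K y * I y \<le> ennreal c0 * indicator K y"
        then have "AE y in lborel. y \<notin> K"
        proof eventually_elim
          case (elim y)
          then show ?case using gt[of y] by (cases "y \<in> K") (auto simp flip: not_le)
        qed
        then show False using Kpos by (subst (asm) AE_iff_measurable[where N=K]) auto
      qed
    qed measurable
    then show False using le' by (subst (asm) nn_integral_cmult_indicator) auto
  qed
  then obtain y where y: "y \<in> K" "I y \<le> ennreal c0" by blast
  have "I y = ennreal (LINT x|lborel. indicator K x * (\<phi> x - \<phi> y)\<^sup>2)"
    unfolding I_def by (intro nneq continuous_intros c) auto
  with y(2) c0 have "(LINT x|lborel. indicator K x * (\<phi> x - \<phi> y)\<^sup>2) \<le> c0"
    by (simp add: ennreal_le_iff)
  with y(1) show ?thesis by (intro that[of y]) (auto simp: c0_def)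
qed

section \<open>Square integrable functions and uniqueness of weak derivatives\<close>

lemma L2_measurable: "L2 D f \<Longrightarrow> f \<in> borel_measurable (lebesgue_on D)"
  by (simp add: L2_def)

lemma young_inequality:
  fixes a b e :: real
  assumes "e > 0"
  shows "a * b \<le> e * a\<^sup>2 + b\<^sup>2 / (4 * e)"
proof -
  have "0 \<le> (2 * e * a - b)\<^sup>2 / (4 * e)" using assms by simp
  also have "\<dots> = e * a\<^sup>2 - a * b + b\<^sup>2 / (4 * e)"
    using assms by (simp add: power2_eq_square field_simps)
  finally show ?thesis by simp
qed

lemma L2_integrable_inner:
  assumes "L2 D f" "L2 D g"
  shows "integrable (lebesgue_on D) (\<lambda>x. f x \<bullet> g x)"
proof (rule Bochner_Integration.integrable_bound)
  show "integrable (lebesgue_on D) (\<lambda>x. (norm (f x))\<^sup>2 + (norm (g x))\<^sup>2)"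
    using assms by (auto simp: L2_def)
  show "(\<lambda>x. f x \<bullet> g x) \<in> borel_measurable (lebesgue_on D)"
    using assms by (intro borel_measurable_inner) (auto simp: L2_def)
  show "AE x in lebesgue_on D. norm (f x \<bullet> g x) \<le> norm ((norm (f x))\<^sup>2 + (norm (g x))\<^sup>2)"
  proof (rule AE_I2)
    fix x
    have "\<bar>f x \<bullet> g x\<bar> \<le> norm (f x) * norm (g x)" by (rule Cauchy_Schwarz_ineq2)
    also have "\<dots> \<le> (norm (f x))\<^sup>2 + (norm (g x))\<^sup>2"
    proof -
      have "2 * (norm (f x) * norm (g x)) \<le> (norm (f x))\<^sup>2 + (norm (g x))\<^sup>2"
        using sum_squares_bound[of "norm (f x)" "norm (g x)"] by (simp add: mult.assoc)
      moreover have "0 \<le> norm (f x) * norm (g x)" by simp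
      ultimately show ?thesis by linarith
    qed
    finally show "norm (f x \<bullet> g x) \<le> norm ((norm (f x))\<^sup>2 + (norm (g x))\<^sup>2)" by simp
  qed
qed

lemma L2_add:
  assumes f: "L2 D f" and g: "L2 D g"
  shows "L2 D (\<lambda>x. f x + g x)"
proof -
  have e: "(norm (f x + g x))\<^sup>2 = (norm (f x))\<^sup>2 + (norm (g x))\<^sup>2 + 2 * (f x \<bullet> g x)" for x
    by (simp add: power2_norm_eq_inner inner_add inner_commute)
  show ?thesis using assms L2_integrable_inner[OF f g] unfolding L2_def e by auto
qed

lemma L2_bounded_mult:
  assumes f: "L2 D f" and m: "m \<in> borel_measurable (lebesgue_on D)" and b: "\<And>x. x \<in> D \<Longrightarrow> \<bar>m x\<bar> \<le> (b::real)"
    and D: "D \<in> sets lebesgue"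
  shows "L2 D (\<lambda>x. m x *\<^sub>R f x)"
  unfolding L2_def
proof
  show meas: "(\<lambda>x. m x *\<^sub>R f x) \<in> borel_measurable (lebesgue_on D)"
    using f m by (auto simp: L2_def)
  show "integrable (lebesgue_on D) (\<lambda>x. (norm (m x *\<^sub>R f x))\<^sup>2)"
  proof (rule Bochner_Integration.integrable_bound)
    show "integrable (lebesgue_on D) (\<lambda>x. b\<^sup>2 * (norm (f x))\<^sup>2)" using f by (simp add: L2_def)
    show "AE x in lebesgue_on D. norm ((norm (m x *\<^sub>R f x))\<^sup>2) \<le> norm (b\<^sup>2 * (norm (f x))\<^sup>2)"
    proof (rule AE_I2)
      fix x assume "x \<in> space (lebesgue_on D)"
      then have "(m x)\<^sup>2 \<le> b\<^sup>2" using b[of x] by (intro abs_le_square_iff[THEN iffD1]) auto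
      then show "norm ((norm (m x *\<^sub>R f x))\<^sup>2) \<le> norm (b\<^sup>2 * (norm (f x))\<^sup>2)"
        by (auto simp: power_mult_distrib intro: mult_right_mono)
    qed
  qed (use meas in measurable)
qed

lemma L2_scaleR: "L2 D f \<Longrightarrow> L2 D (\<lambda>x. a *\<^sub>R f x)"
  by (auto simp: L2_def power_mult_distrib)

lemma L2_diff: "L2 D f \<Longrightarrow> L2 D g \<Longrightarrow> L2 D (\<lambda>x. f x - g x)"
  using L2_add[of D f "\<lambda>x. (-1) *\<^sub>R g x"] L2_scaleR[of D g "-1"] by simp

lemma L2_bounded:
  fixes f :: "'a::euclidean_space \<Rightarrow> 'b::euclidean_space"
  assumes f: "f \<in> borel_measurable (lebesgue_on D)" and b: "\<And>x. x \<in> D \<Longrightarrow> norm (f x) \<le> b"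
    and D: "D \<in> sets lebesgue" "bounded D"
  shows "L2 D f"
proof -
  have "D \<in> lmeasurable" using D by (simp add: bounded_set_imp_lmeasurable)
  then have c: "integrable (lebesgue_on D) (\<lambda>x. b\<^sup>2)" by (intro finite_measure.integrable_const finite_measure_lebesgue_on)
  have "integrable (lebesgue_on D) (\<lambda>x. (norm (f x))\<^sup>2)"
  proof (rule Bochner_Integration.integrable_bound[OF c])
    show "AE x in lebesgue_on D. norm ((norm (f x))\<^sup>2) \<le> norm (b\<^sup>2)"
      using b by (intro AE_I2) (auto intro: power_mono)
  qed (use f in measurable)
  with f show ?thesis by (simp add: L2_def)
qed

lemma L2_continuous:
  fixes f :: "'a::euclidean_space \<Rightarrow> 'b::euclidean_space"
  assumes f: "continuous_on UNIV f" and D: "D \<in> sets lebesgue" "bounded D"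
  shows "L2 D f"
proof -
  have "compact (f ` closure D)" using f D by (intro compact_continuous_image) (auto intro: continuous_on_subset)
  from compact_imp_bounded[OF this]
  obtain b where b: "\<forall>y\<in>f ` closure D. norm y \<le> b" unfolding bounded_iff by auto
  have "f \<in> borel_measurable borel" using f by (rule borel_measurable_continuous_onI)
  then have "f \<in> borel_measurable (lebesgue_on D)"
    by (intro measurable_restrict_space1 measurable_completion) simp
  then show ?thesis using b closure_subset D by (intro L2_bounded[of f D b]) (auto simp: subset_iff)
qed

lemma L2_component: "L2 D f \<Longrightarrow> L2 D (\<lambda>x. (f x :: plane) $ i)"
proof -
  assume f: "L2 D f"
  have m: "(\<lambda>x. f x $ i) \<in> borel_measurable (lebesgue_on D)"
  proof -
    have "(\<lambda>x. f x \<bullet> axis i 1) \<in> borel_measurable (lebesgue_on D)"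
      using f by (intro borel_measurable_inner) (auto simp: L2_def)
    then show ?thesis by (simp add: inner_axis)
  qed
  have "integrable (lebesgue_on D) (\<lambda>x. (f x $ i)\<^sup>2)"
  proof (rule Bochner_Integration.integrable_bound)
    show "integrable (lebesgue_on D) (\<lambda>x. (norm (f x))\<^sup>2)" using f by (simp add: L2_def)
    show "AE x in lebesgue_on D. norm ((f x $ i)\<^sup>2) \<le> norm ((norm (f x))\<^sup>2)"
    proof (rule AE_I2)
      fix x
      have "(f x $ i)\<^sup>2 \<le> (norm (f x))\<^sup>2"
        using component_le_norm_cart[of "f x" i] by (intro abs_le_square_iff[THEN iffD1]) auto
      then show "norm ((f x $ i)\<^sup>2) \<le> norm ((norm (f x))\<^sup>2)" by simp
    qed
  qed (use m in measurable)
  with m show ?thesis by (simp add: L2_def)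
qed

lemma borel_measurable_lebesgue_on_cong_AE:
  fixes f g :: "'a::euclidean_space \<Rightarrow> 'b::euclidean_space"
  assumes f: "f \<in> borel_measurable (lebesgue_on D)" and ae: "AE x in lebesgue_on D. f x = g x" and D: "D \<in> sets lebesgue"
  shows "g \<in> borel_measurable (lebesgue_on D)"
proof -
  have "AE x in lebesgue. indicator D x *\<^sub>R f x = indicator D x *\<^sub>R g x"
    using ae D by (subst (asm) AE_restrict_space_iff) (auto elim!: eventually_mono simp: indicator_def)
  note ae' = this
  have "(\<lambda>x. indicator D x *\<^sub>R f x) \<in> borel_measurable lebesgue"
    using f D by (subst (asm) borel_measurable_restrict_space_iff) auto
  from borel_measurable_AE[OF this ae'] have "(\<lambda>x. indicator D x *\<^sub>R g x) \<in> borel_measurable lebesgue" .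
  then show ?thesis using D by (subst borel_measurable_restrict_space_iff) auto
qed

lemma L2_cong_AE:
  fixes f g :: "'a::euclidean_space \<Rightarrow> 'b::euclidean_space"
  assumes f: "L2 D f" and ae: "AE x in lebesgue_on D. f x = g x" and D: "D \<in> sets lebesgue"
  shows "L2 D g"
proof -
  have g: "g \<in> borel_measurable (lebesgue_on D)"
    by (rule borel_measurable_lebesgue_on_cong_AE[OF L2_measurable[OF f] ae D])
  have "integrable (lebesgue_on D) (\<lambda>x. (norm (g x))\<^sup>2)"
    by (rule integrable_cong_AE_imp[where g="\<lambda>x. (norm (f x))\<^sup>2"])
      (use f g ae in \<open>auto simp: L2_def elim!: eventually_mono\<close>)
  with g show ?thesis by (simp add: L2_def)
qed

lemma ip_cong_AE:
  assumes "L2 D f" "L2 D f'" "L2 D g" "L2 D g'"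
    and "AE x in lebesgue_on D. f x = f' x" "AE x in lebesgue_on D. g x = g' x"
  shows "ip D f g = ip D f' g'"
  unfolding ip_def
proof (rule integral_cong_AE)
  show "AE x in lebesgue_on D. f x \<bullet> g x = f' x \<bullet> g' x" using assms(5,6) by eventually_elim simp
qed (use assms in \<open>auto simp: L2_def intro: borel_measurable_inner\<close>)

lemma ip_diff_left: "L2 D f \<Longrightarrow> L2 D f' \<Longrightarrow> L2 D g \<Longrightarrow> ip D (\<lambda>x. f x - f' x) g = ip D f g - ip D f' g"
  unfolding ip_def by (simp add: inner_diff_left L2_integrable_inner)

lemma ip_young:
  fixes f g :: "'a::euclidean_space \<Rightarrow> 'b::euclidean_space"
  assumes f: "L2 D f" and g: "L2 D g" and e: "e > 0"
  shows "\<bar>ip D f g\<bar> \<le> e * ip D f f + ip D g g / (4 * e)"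
proof -
  note i = L2_integrable_inner[OF f g] L2_integrable_inner[OF f f] L2_integrable_inner[OF g g]
  have "\<bar>ip D f g\<bar> \<le> (LINT x|lebesgue_on D. \<bar>f x \<bullet> g x\<bar>)" unfolding ip_def by (rule integral_abs_bound)
  also have "\<dots> \<le> (LINT x|lebesgue_on D. e * (f x \<bullet> f x) + (g x \<bullet> g x) / (4 * e))"
  proof (rule integral_mono)
    fix x
    have "\<bar>f x \<bullet> g x\<bar> \<le> norm (f x) * norm (g x)" by (rule Cauchy_Schwarz_ineq2)
    also have "\<dots> \<le> e * (norm (f x))\<^sup>2 + (norm (g x))\<^sup>2 / (4 * e)" by (rule young_inequality[OF e])
    finally show "\<bar>f x \<bullet> g x\<bar> \<le> e * (f x \<bullet> f x) + (g x \<bullet> g x) / (4 * e)" by (simp add: power2_norm_eq_inner)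
  qed (use i in auto)
  also have "\<dots> = e * ip D f f + ip D g g / (4 * e)" using i by (simp add: ip_def)
  finally show ?thesis .
qed

lemma ip_self_nonneg: "0 \<le> ip D f f"
  unfolding ip_def by simp

lemma L2_test_function:
  assumes "C1_with_gradient \<phi> g" "D \<in> sets lebesgue" "bounded D"
  shows "L2 D \<phi>" "L2 D (\<lambda>x. rotate (g x))" "L2 D g"
proof -
  note c = C1_with_gradientD[OF assms(1)]
  have e: "rotate v = v $ 2 *\<^sub>R axis 1 1 - v $ 1 *\<^sub>R axis 2 1" for v
    by (simp add: vec2_eq_iff axis_def)
  have cr: "continuous_on UNIV (\<lambda>x. rotate (g x))" unfolding e by (intro continuous_intros c(2))
  show "L2 D \<phi>" "L2 D (\<lambda>x. rotate (g x))" "L2 D g"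
    using L2_continuous[OF c(1) assms(2,3)] L2_continuous[OF c(2) assms(2,3)] L2_continuous[OF cr assms(2,3)] by auto
qed

lemma annihilates_test_functions_imp_AE_zero:
  fixes S :: "plane set"
  assumes S: "open S" "bounded S" "convex S" and c: "L2 S c"
    and ann: "\<And>\<phi> g. C1_with_gradient \<phi> g \<Longrightarrow> compact_support_in S \<phi> \<Longrightarrow> ip S c \<phi> = 0"
  shows "AE x in lebesgue_on S. c x = 0"
proof (cases "S = {}")
  case False
  then obtain p where "p \<in> S" by blast
  then obtain r where pr: "r > 0" "ball p r \<subseteq> S" using S(1) by (meson openE)
  obtain k k' L B where "smoothing_kernel S k k' L B"
    by (rule smoothing_kernel_exists[OF S pr(2,1)])
  then interpret smoothing_kernel S k k' L B .
  obtain f where f[measurable]: "f \<in> borel_measurable borel" and ae: "AE x in lebesgue_on S. c x = f x"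
    and f0: "\<And>x. x \<notin> S \<Longrightarrow> f x = 0" and int: "integrable lborel (\<lambda>x. (f x)\<^sup>2)"
    by (rule L2_borel_representative[OF c S_measurable]) (rule that; (assumption | simp))
  have sq: "square_integrable f" using f int by (simp add: square_integrable_def)
  have "AE x in lborel. f x = 0"
  proof (rule annihilates_test_functions_imp_zero[OF sq f0])
    fix \<phi> g assume \<phi>: "C1_with_gradient \<phi> g" "compact_support_in S \<phi>"
    have Sm: "S \<in> sets lebesgue" using S by simp
    have [measurable]: "\<phi> \<in> borel_measurable borel" using C1_with_gradientD[OF \<phi>(1)] by simp
    have "0 = ip S c \<phi>" using ann[OF \<phi>] by simp
    also have "\<dots> = ip S f \<phi>"
      using L2_test_function[OF \<phi>(1) Sm S(2)] L2_cong_AE[OF c ae Sm] ae c by (intro ip_cong_AE) auto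
    also have "\<dots> = (LINT x|lborel. indicator S x * (f x * \<phi> x))"
      unfolding ip_def inner_real_def by (rule integral_lebesgue_on_borel) measurable
    also have "\<dots> = (LINT x|lborel. f x * \<phi> x)"
      using f0 by (intro Bochner_Integration.integral_cong) (auto simp: indicator_def)
    finally show "(LINT y|lborel. f y * \<phi> y) = 0" by simp
  qed
  then have "AE x in lebesgue. f x = 0" by (rule AE_completion)
  then have "AE x in lebesgue_on S. f x = 0"
    using S by (subst AE_restrict_space_iff) (auto elim!: eventually_mono)
  with ae show ?thesis by eventually_elim simp
next
  case True
  then show ?thesis by (intro AE_I2) simp
qed

lemma weak_curl_unique:
  assumes S: "open S" "bounded S" "convex S" and c: "has_weak_curl S v c" and c': "has_weak_curl S v c'"
  shows "AE x in lebesgue_on S. c x = c' x"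
proof -
  have L: "L2 S c" "L2 S c'" using c c' by (auto simp: has_weak_curl_def)
  have "AE x in lebesgue_on S. c x - c' x = 0"
  proof (rule annihilates_test_functions_imp_AE_zero[OF S L2_diff[OF L]])
    fix \<phi> g assume \<phi>: "C1_with_gradient \<phi> g" "compact_support_in S \<phi>"
    have "L2 S \<phi>" using L2_test_function[OF \<phi>(1)] S by simp
    then show "ip S (\<lambda>x. c x - c' x) \<phi> = 0"
      using c c' \<phi> L by (subst ip_diff_left) (auto simp: has_weak_curl_def)
  qed
  then show ?thesis by eventually_elim simp
qed

lemma has_weak_curl_weak_curl: "v \<in> Hcurl D \<Longrightarrow> has_weak_curl D v (weak_curl D v)"
  unfolding Hcurl_def weak_curl_def by (drule CollectD, erule someI_ex)

lemma has_weak_curl_diff: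
  assumes D: "D \<in> sets lebesgue" "bounded D" and v: "has_weak_curl D v c" and w: "has_weak_curl D w b"
  shows "has_weak_curl D (\<lambda>x. v x - w x) (\<lambda>x. c x - b x)"
  using v w unfolding has_weak_curl_def
  by (auto intro!: L2_diff simp: ip_diff_left L2_test_function[OF _ D])

lemma compact_support_in_mono: "compact_support_in S \<phi> \<Longrightarrow> S \<subseteq> D \<Longrightarrow> compact_support_in D \<phi>"
  unfolding compact_support_in_def by auto

lemma compact_support_in_zero: "compact_support_in S \<phi> \<Longrightarrow> x \<notin> S \<Longrightarrow> \<phi> x = 0"
  unfolding compact_support_in_def using closure_subset[of "{x. \<phi> x \<noteq> 0}"] by auto

lemma compact_support_in_grad_zero:
  assumes C1: "C1_with_gradient \<phi> g" and \<phi>: "compact_support_in S \<phi>" and x: "x \<notin> S"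
  shows "g x = 0"
proof -
  let ?U = "- closure {x. \<phi> x \<noteq> 0}"
  have U: "open ?U" "x \<in> ?U" using \<phi> x by (auto simp: compact_support_in_def)
  have z: "\<phi> y = 0" if "y \<in> ?U" for y using that closure_subset[of "{x. \<phi> x \<noteq> 0}"] by auto
  have "((\<lambda>y. 0 :: real) has_derivative (\<lambda>h. h \<bullet> g x)) (at x)"
    by (rule has_derivative_transform_within_open[OF C1_with_gradientD(3)[OF C1] U]) (rule z)
  from has_derivative_unique[OF this has_derivative_const]
  have "g x \<bullet> g x = 0" by (rule fun_cong)
  then show ?thesis by simp
qed

lemma L2_subset:
  assumes f: "L2 D f" and S: "S \<in> sets lebesgue" "D \<in> sets lebesgue" "S \<subseteq> D"
  shows "L2 S f"
proof -
  have "f \<in> borel_measurable (lebesgue_on S)"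
    using measurable_restrict_mono[OF L2_measurable[OF f] S(3)] .
  moreover have "integrable (lebesgue_on S) (\<lambda>x. (norm (f x))\<^sup>2)"
  proof -
    have i: "integrable (lebesgue_on D) (\<lambda>x. (norm (f x))\<^sup>2)" using f by (simp add: L2_def)
    have D': "D \<inter> space lebesgue \<in> sets lebesgue" and S': "S \<inter> space lebesgue \<in> sets lebesgue" using S by simp_all
    have "set_integrable lebesgue D (\<lambda>x. (norm (f x))\<^sup>2)"
      unfolding set_integrable_def using i by (subst (asm) integrable_restrict_space[OF D'])
    then have "set_integrable lebesgue S (\<lambda>x. (norm (f x))\<^sup>2)" by (rule set_integrable_subset[OF _ S(1,3)])
    then show ?thesis unfolding set_integrable_def by (subst integrable_restrict_space[OF S'])
  qed
  ultimately show ?thesis by (simp add: L2_def)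
qed

lemma ip_eq_of_zero_outside:
  assumes S: "S \<in> sets lebesgue" "D \<in> sets lebesgue" "S \<subseteq> D" and z: "\<And>x. x \<notin> S \<Longrightarrow> g x = 0"
  shows "ip S f g = ip D f g"
proof -
  have "ip S f g = (LINT x|lebesgue. indicator S x *\<^sub>R (f x \<bullet> g x))"
    unfolding ip_def using S by (intro integral_restrict_space) auto
  also have "\<dots> = (LINT x|lebesgue. indicator D x *\<^sub>R (f x \<bullet> g x))"
    using z S by (intro Bochner_Integration.integral_cong) (auto simp: indicator_def)
  also have "\<dots> = ip D f g"
    unfolding ip_def using S by (intro integral_restrict_space[symmetric]) auto
  finally show ?thesis .
qed

text \<open>Test functions on the subset are test functions on the larger set, with the same integrals.\<close>

lemma has_weak_curl_subset:
  assumes v: "has_weak_curl D v c" and S: "S \<in> sets lebesgue" "D \<in> sets lebesgue" "S \<subseteq> D"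
  shows "has_weak_curl S v c"
  unfolding has_weak_curl_def
proof (intro conjI allI impI)
  show "L2 S v" "L2 S c" using v S by (auto simp: has_weak_curl_def intro: L2_subset)
  fix \<phi> g assume \<phi>: "C1_with_gradient \<phi> g \<and> compact_support_in S \<phi>"
  have "ip S c \<phi> = ip D c \<phi>"
    using compact_support_in_zero \<phi> S by (intro ip_eq_of_zero_outside) auto
  also have "\<dots> = ip D v (\<lambda>x. rotate (g x))"
    using v \<phi> compact_support_in_mono[OF _ S(3)] by (auto simp: has_weak_curl_def)
  also have "\<dots> = ip S v (\<lambda>x. rotate (g x))"
  proof (rule ip_eq_of_zero_outside[symmetric, OF S])
    fix x assume "x \<notin> S"
    then have "g x = 0" using compact_support_in_grad_zero \<phi> by blast
    then show "rotate (g x) = 0" by (simp add: vec2_eq_iff)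
  qed
  finally show "ip S c \<phi> = ip S v (\<lambda>x. rotate (g x))" .
qed

section \<open>Piecewise constant fields with a tangentially continuous jump\<close>

text \<open>Continuously differentiable functions that increase pointwise to the indicator of the positive
  half line.\<close>

definition soft_step :: "real \<Rightarrow> real \<Rightarrow> real" where
  "soft_step j s = j * (max 0 s)\<^sup>2 / (j * (max 0 s)\<^sup>2 + 1)"

definition soft_step_deriv :: "real \<Rightarrow> real \<Rightarrow> real" where
  "soft_step_deriv j s = 2 * j * max 0 s / (j * (max 0 s)\<^sup>2 + 1)\<^sup>2"

lemma soft_step_pos: "j \<ge> 0 \<Longrightarrow> j * (max 0 s)\<^sup>2 + 1 > (0::real)"
  by (simp add: add_nonneg_pos)

lemma DERIV_soft_step:
  assumes j: "j \<ge> 0"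
  shows "DERIV (soft_step j) s :> soft_step_deriv j s"
proof -
  have "((\<lambda>s. (max 0 s)\<^sup>2) has_derivative (\<lambda>h. 2 * max 0 s * h)) (at s)"
    by (rule has_derivative_of_quadratic_remainder[where L=1])
      (use max_square_taylor[of s] in \<open>auto intro: bounded_linear_mult_right\<close>)
  then have d: "DERIV (\<lambda>s. (max 0 s)\<^sup>2) s :> 2 * max 0 s" by (simp add: has_field_derivative_def)
  have d1: "DERIV (\<lambda>s. j * (max 0 s)\<^sup>2) s :> j * (2 * max 0 s)" by (rule DERIV_cmult[OF d])
  have d2: "DERIV (\<lambda>s. j * (max 0 s)\<^sup>2 + 1) s :> j * (2 * max 0 s)"
    using DERIV_add[OF d1 DERIV_const[of 1]] by simp
  have "DERIV (soft_step j) s :> ((j * (2 * max 0 s)) * (j * (max 0 s)\<^sup>2 + 1) - (j * (max 0 s)\<^sup>2) * (j * (2 * max 0 s))) / ((j * (max 0 s)\<^sup>2 + 1) * (j * (max 0 s)\<^sup>2 + 1))"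
    unfolding soft_step_def[abs_def] using soft_step_pos[OF j, of s] by (intro DERIV_divide[OF d1 d2]) simp
  moreover have "((j * (2 * max 0 s)) * (j * (max 0 s)\<^sup>2 + 1) - (j * (max 0 s)\<^sup>2) * (j * (2 * max 0 s))) / ((j * (max 0 s)\<^sup>2 + 1) * (j * (max 0 s)\<^sup>2 + 1)) = soft_step_deriv j s"
    by (simp add: soft_step_deriv_def power2_eq_square algebra_simps)
  ultimately show ?thesis by simp
qed

lemma continuous_soft_step_deriv:
  assumes "j \<ge> 0"
  shows "continuous_on UNIV (soft_step_deriv j)"
proof -
  have "j * (max 0 s)\<^sup>2 + 1 \<noteq> 0" for s using soft_step_pos[OF assms, of s] by linarith
  then show ?thesis unfolding soft_step_deriv_def[abs_def] by (intro continuous_intros) simp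
qed

lemma soft_step_bounds: "j \<ge> 0 \<Longrightarrow> 0 \<le> soft_step j s" "j \<ge> 0 \<Longrightarrow> soft_step j s \<le> 1"
  using soft_step_pos[of j s] by (auto simp: soft_step_def)

lemma soft_step_tendsto: "(\<lambda>j. soft_step (real j) s) \<longlonglongrightarrow> indicator {0<..} s"
proof (cases "s > 0")
  case True
  have "filterlim (\<lambda>j. 1 + s\<^sup>2 * real j) at_top sequentially"
    by (rule filterlim_tendsto_add_at_top[OF tendsto_const
          filterlim_tendsto_pos_mult_at_top[OF tendsto_const _ filterlim_real_sequentially]])
      (use True in simp)
  then have "(\<lambda>j. 1 / (1 + s\<^sup>2 * real j)) \<longlonglongrightarrow> 0"
    by (intro tendsto_divide_0[OF tendsto_const] filterlim_at_top_imp_at_infinity)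
  then have "(\<lambda>j. 1 - 1 / (1 + s\<^sup>2 * real j)) \<longlonglongrightarrow> 1 - 0"
    by (intro tendsto_diff tendsto_const)
  moreover have "1 - 1 / (1 + s\<^sup>2 * real j) = soft_step (real j) s" for j
    using True soft_step_pos[of "real j" s] by (simp add: soft_step_def field_simps)
  ultimately show ?thesis using True by simp
qed (simp add: soft_step_def)

lemma C1_times_soft_step:
  assumes C1: "C1_with_gradient \<phi> g" and j: "j \<ge> 0"
  shows "C1_with_gradient (\<lambda>x. soft_step j (n \<bullet> x - c) * \<phi> x)
    (\<lambda>x. soft_step j (n \<bullet> x - c) *\<^sub>R g x + (soft_step_deriv j (n \<bullet> x - c) * \<phi> x) *\<^sub>R n)"
  unfolding C1_with_gradient_def
proof (intro conjI allI)
  note d = C1_with_gradientD[OF C1]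
  have cs: "continuous_on UNIV (soft_step j)"
    using DERIV_soft_step[OF j] by (intro continuous_at_imp_continuous_on) (auto intro: DERIV_isCont)
  show "continuous_on UNIV (\<lambda>x. soft_step j (n \<bullet> x - c) *\<^sub>R g x + (soft_step_deriv j (n \<bullet> x - c) * \<phi> x) *\<^sub>R n)"
    by (intro continuous_intros d continuous_on_compose2[OF cs] continuous_on_compose2[OF continuous_soft_step_deriv[OF j]]) auto
  fix x
  have "((\<lambda>x. n \<bullet> x - c) has_derivative (\<lambda>h. n \<bullet> h)) (at x)"
    by (auto intro!: derivative_eq_intros)
  moreover have "(soft_step j has_derivative (\<lambda>h. soft_step_deriv j (n \<bullet> x - c) * h)) (at (n \<bullet> x - c))"
    using DERIV_soft_step[OF j] by (simp add: has_field_derivative_def)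
  ultimately have "((\<lambda>x. soft_step j (n \<bullet> x - c)) has_derivative (\<lambda>h. soft_step_deriv j (n \<bullet> x - c) * (n \<bullet> h))) (at x)"
    by (rule has_derivative_compose)
  then have "((\<lambda>x. soft_step j (n \<bullet> x - c) * \<phi> x) has_derivative
      (\<lambda>h. soft_step j (n \<bullet> x - c) * (h \<bullet> g x) + (soft_step_deriv j (n \<bullet> x - c) * (n \<bullet> h)) * \<phi> x)) (at x)"
    by (intro has_derivative_mult d)
  moreover have "(\<lambda>h. soft_step j (n \<bullet> x - c) * (h \<bullet> g x) + (soft_step_deriv j (n \<bullet> x - c) * (n \<bullet> h)) * \<phi> x) =
      (\<lambda>h. h \<bullet> (soft_step j (n \<bullet> x - c) *\<^sub>R g x + (soft_step_deriv j (n \<bullet> x - c) * \<phi> x) *\<^sub>R n))"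
    by (rule ext) (simp add: inner_add_right inner_commute algebra_simps)
  ultimately show "GDERIV (\<lambda>x. soft_step j (n \<bullet> x - c) * \<phi> x) x :>
      soft_step j (n \<bullet> x - c) *\<^sub>R g x + (soft_step_deriv j (n \<bullet> x - c) * \<phi> x) *\<^sub>R n"
    by (simp add: gderiv_def)
qed

text \<open>The gradient of a continuous function that is affine on both sides of the line \<open>n \<bullet> x = c\<close>.\<close>

definition ridge_field :: "plane \<Rightarrow> real \<Rightarrow> plane \<Rightarrow> real \<Rightarrow> vector_field" where
  "ridge_field p \<kappa> n c x = p + (\<kappa> * indicator {x. c < n \<bullet> x} x) *\<^sub>R n"

lemma half_plane_borel [measurable]: "{x :: plane. c < n \<bullet> x} \<in> sets borel"
  by (intro borel_open open_Collect_less continuous_intros)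

lemma ridge_field_measurable [measurable]: "ridge_field p \<kappa> n c \<in> borel_measurable borel"
  unfolding ridge_field_def[abs_def] by measurable

lemma ridge_field_bound: "norm (ridge_field p \<kappa> n c x) \<le> norm p + \<bar>\<kappa>\<bar> * norm n"
proof -
  have "norm (ridge_field p \<kappa> n c x) \<le> norm p + norm ((\<kappa> * indicator {x. c < n \<bullet> x} x) *\<^sub>R n)"
    unfolding ridge_field_def by (rule norm_triangle_ineq)
  also have "\<dots> \<le> norm p + \<bar>\<kappa>\<bar> * norm n" by (auto simp: indicator_def)
  finally show ?thesis .
qed

lemma borel_imp_lebesgue_on: "f \<in> borel_measurable borel \<Longrightarrow> f \<in> borel_measurable (lebesgue_on D)"
  by (intro measurable_restrict_space1 measurable_completion) simp

lemma L2_ridge_field: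
  assumes "D \<in> sets lebesgue" "bounded D"
  shows "L2 D (ridge_field p \<kappa> n c)" "L2 D (\<lambda>x. rotate (ridge_field p \<kappa> n c x))"
proof -
  show "L2 D (ridge_field p \<kappa> n c)"
    by (rule L2_bounded[OF borel_imp_lebesgue_on[OF ridge_field_measurable] ridge_field_bound assms])
  have "rotate (ridge_field p \<kappa> n c x) = ridge_field p \<kappa> n c x $ 2 *\<^sub>R axis 1 1 - ridge_field p \<kappa> n c x $ 1 *\<^sub>R axis 2 1" for x
    by (simp add: vec2_eq_iff axis_def)
  then have e: "rotate (ridge_field p \<kappa> n c x) = (ridge_field p \<kappa> n c x \<bullet> axis 2 1) *\<^sub>R axis 1 1 - (ridge_field p \<kappa> n c x \<bullet> axis 1 1) *\<^sub>R axis 2 1" for x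
    by (simp add: inner_axis)
  have "(\<lambda>x. rotate (ridge_field p \<kappa> n c x)) \<in> borel_measurable borel"
    unfolding e by measurable
  then show "L2 D (\<lambda>x. rotate (ridge_field p \<kappa> n c x))"
    using ridge_field_bound by (intro L2_bounded[OF borel_imp_lebesgue_on _ assms]) (auto simp: norm_rotate)
qed

lemma AE_unit_interval_interior: "AE s in lebesgue_on {0..1::real}. 0 < s \<and> s < 1"
proof -
  have "AE s in lborel. s \<noteq> 0 \<and> s \<noteq> (1::real)"
    using AE_lborel_singleton[of "0::real"] AE_lborel_singleton[of "1::real"] by eventually_elim auto
  then have "AE s in lebesgue. s \<noteq> 0 \<and> s \<noteq> (1::real)" by (rule AE_completion)
  then have "AE s in lebesgue. s \<in> {0..1} \<longrightarrow> 0 < s \<and> s < (1::real)"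
    by (rule eventually_mono) (simp add: less_le)
  then show ?thesis by (subst AE_restrict_space_iff) simp_all
qed

context triangle
begin

abbreviation "S \<equiv> interior K"

lemma S_facts: "open S" "convex S" "bounded S" "S \<in> sets lebesgue"
  using K_convex K_compact by (auto simp: convex_interior compact_imp_bounded bounded_interior)

text \<open>Multiplying a test function by a function of \<open>n \<bullet> x\<close> changes its gradient only in direction
  \<open>n\<close>, which the field \<open>n\<close> does not see after rotation. So Green's formula for \<open>n\<close> survives
  multiplication by a soft step, and in the limit by the indicator of a half plane.\<close>

lemma green_formula_half_plane:
  assumes C1: "C1_with_gradient \<phi> g" and M: "finite M" "M \<subseteq> frontier K"
  shows "(\<Sum>e\<in>boundary_segments K ({A, B, C} \<union> M). (n \<bullet> (snd e - fst e)) *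
        seg_mean (\<lambda>x. indicator {x. c < n \<bullet> x} x * \<phi> x) (fst e) (snd e)) =
    - (LINT x|lebesgue_on S. indicator {x. c < n \<bullet> x} x * (n \<bullet> rotate (g x)))"
proof -
  note d = C1_with_gradientD[OF C1]
  let ?E = "boundary_segments K ({A, B, C} \<union> M)"
  let ?st = "\<lambda>j x. soft_step (real j) (n \<bullet> x - c)"
  have st: "continuous_on UNIV (?st j)" for j
  proof -
    have "continuous_on UNIV (soft_step (real j))"
      using DERIV_soft_step[of "real j"] by (intro continuous_at_imp_continuous_on) (auto intro: DERIV_isCont)
    then show ?thesis by (rule continuous_on_compose2) (auto intro!: continuous_intros)
  qed
  have lim: "(\<lambda>j. ?st j x) \<longlonglongrightarrow> indicator {x. c < n \<bullet> x} x" for x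
    using soft_step_tendsto[of "n \<bullet> x - c"] by (simp add: indicator_def)
  have b: "\<bar>?st j x * y\<bar> \<le> \<bar>y\<bar>" for j x y
    using soft_step_bounds[of "real j" "n \<bullet> x - c"] by (simp add: abs_mult mult_left_le_one_le)
  have eq: "(\<Sum>e\<in>?E. (n \<bullet> (snd e - fst e)) * seg_mean (\<lambda>x. ?st j x * \<phi> x) (fst e) (snd e)) =
      - (LINT x|lebesgue_on S. ?st j x * (n \<bullet> rotate (g x)))" for j
  proof -
    have "n \<bullet> rotate (?st j x *\<^sub>R g x + (soft_step_deriv (real j) (n \<bullet> x - c) * \<phi> x) *\<^sub>R n) = ?st j x * (n \<bullet> rotate (g x))" for x
      by (simp add: inner_rotate cross2_simps)
    then show ?thesis using green_formula[OF C1_times_soft_step[OF C1, of "real j" n c] M, of n] by simp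
  qed
  have [measurable]: "\<phi> \<in> borel_measurable borel" using d by simp
  have "(\<lambda>j. seg_mean (\<lambda>x. ?st j x * \<phi> x) a b) \<longlonglongrightarrow> seg_mean (\<lambda>x. indicator {x. c < n \<bullet> x} x * \<phi> x) a b" for a b
    unfolding seg_mean_def
  proof (rule integral_dominated_convergence[where w="\<lambda>s. \<bar>\<phi> (a + s *\<^sub>R (b - a))\<bar>"])
    show "(\<lambda>s. indicator {x. c < n \<bullet> x} (a + s *\<^sub>R (b - a)) * \<phi> (a + s *\<^sub>R (b - a))) \<in> borel_measurable (lebesgue_on {0..1})"
      by (rule borel_imp_lebesgue_on) measurable
    show "(\<lambda>s. ?st j (a + s *\<^sub>R (b - a)) * \<phi> (a + s *\<^sub>R (b - a))) \<in> borel_measurable (lebesgue_on {0..1})" for j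
      by (rule borel_imp_lebesgue_on[OF borel_measurable_continuous_onI[OF
            continuous_on_mult[OF continuous_on_seg[OF st] continuous_on_seg[OF d(1)]]]])
    show "integrable (lebesgue_on {0..1}) (\<lambda>s. \<bar>\<phi> (a + s *\<^sub>R (b - a))\<bar>)"
      using seg_integrable[OF d(1)] by (rule integrable_abs)
    show "AE s in lebesgue_on {0..1}. (\<lambda>j. ?st j (a + s *\<^sub>R (b - a)) * \<phi> (a + s *\<^sub>R (b - a))) \<longlonglongrightarrow>
        indicator {x. c < n \<bullet> x} (a + s *\<^sub>R (b - a)) * \<phi> (a + s *\<^sub>R (b - a))"
      by (intro AE_I2 tendsto_intros lim)
    show "AE s in lebesgue_on {0..1}. norm (?st j (a + s *\<^sub>R (b - a)) * \<phi> (a + s *\<^sub>R (b - a))) \<le> \<bar>\<phi> (a + s *\<^sub>R (b - a))\<bar>" for j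
      using b by (intro AE_I2) simp
  qed
  then have l1: "(\<lambda>j. \<Sum>e\<in>?E. (n \<bullet> (snd e - fst e)) * seg_mean (\<lambda>x. ?st j x * \<phi> x) (fst e) (snd e)) \<longlonglongrightarrow>
      (\<Sum>e\<in>?E. (n \<bullet> (snd e - fst e)) * seg_mean (\<lambda>x. indicator {x. c < n \<bullet> x} x * \<phi> x) (fst e) (snd e))"
    by (intro tendsto_sum tendsto_mult tendsto_const)
  have cr: "continuous_on UNIV (\<lambda>x. n \<bullet> rotate (g x))"
    unfolding inner_rotate cross2_def by (intro continuous_intros d)
  have "(\<lambda>j. LINT x|lebesgue_on S. ?st j x * (n \<bullet> rotate (g x))) \<longlonglongrightarrow>
      (LINT x|lebesgue_on S. indicator {x. c < n \<bullet> x} x * (n \<bullet> rotate (g x)))"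
  proof (rule integral_dominated_convergence[where w="\<lambda>x. \<bar>n \<bullet> rotate (g x)\<bar>"])
    have [measurable]: "(\<lambda>x. n \<bullet> rotate (g x)) \<in> borel_measurable borel"
      using cr by (rule borel_measurable_continuous_onI)
    show "(\<lambda>x. indicator {x. c < n \<bullet> x} x * (n \<bullet> rotate (g x))) \<in> borel_measurable (lebesgue_on S)"
      by (rule borel_imp_lebesgue_on) measurable
    show "(\<lambda>x. ?st j x * (n \<bullet> rotate (g x))) \<in> borel_measurable (lebesgue_on S)" for j
      by (rule borel_imp_lebesgue_on[OF borel_measurable_continuous_onI[OF continuous_on_mult[OF st cr]]])
    show "integrable (lebesgue_on S) (\<lambda>x. \<bar>n \<bullet> rotate (g x)\<bar>)"
      using integral_interior_K(1)[OF cr] by (rule integrable_abs)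
    show "AE x in lebesgue_on S. (\<lambda>j. ?st j x * (n \<bullet> rotate (g x))) \<longlonglongrightarrow> indicator {x. c < n \<bullet> x} x * (n \<bullet> rotate (g x))"
      by (intro AE_I2 tendsto_intros lim)
    show "AE x in lebesgue_on S. norm (?st j x * (n \<bullet> rotate (g x))) \<le> \<bar>n \<bullet> rotate (g x)\<bar>" for j
      using b by (intro AE_I2) simp
  qed
  then have l2: "(\<lambda>j. - (LINT x|lebesgue_on S. ?st j x * (n \<bullet> rotate (g x)))) \<longlonglongrightarrow>
      - (LINT x|lebesgue_on S. indicator {x. c < n \<bullet> x} x * (n \<bullet> rotate (g x)))"
    by (rule tendsto_minus)
  from l1 l2 show ?thesis unfolding eq by (rule LIMSEQ_unique)
qed

lemma green_formula_ridge_field: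
  assumes C1: "C1_with_gradient \<phi> g" and M: "finite M" "M \<subseteq> frontier K"
  shows "(\<Sum>e\<in>boundary_segments K ({A, B, C} \<union> M). (p \<bullet> (snd e - fst e)) * seg_mean \<phi> (fst e) (snd e) +
        \<kappa> * ((n \<bullet> (snd e - fst e)) * seg_mean (\<lambda>x. indicator {x. c < n \<bullet> x} x * \<phi> x) (fst e) (snd e))) =
    - ip S (ridge_field p \<kappa> n c) (\<lambda>x. rotate (g x))"
proof -
  note d = C1_with_gradientD[OF C1]
  have cr: "continuous_on UNIV (\<lambda>x. w \<bullet> rotate (g x))" for w
    unfolding inner_rotate cross2_def by (intro continuous_intros d)
  have i1: "integrable (lebesgue_on S) (\<lambda>x. p \<bullet> rotate (g x))"
    by (rule integral_interior_K(1)[OF cr])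
  have i2: "integrable (lebesgue_on S) (\<lambda>x. indicator {x. c < n \<bullet> x} x * (n \<bullet> rotate (g x)))"
  proof (rule Bochner_Integration.integrable_bound[OF integral_interior_K(1)[OF cr[of n]]])
    have [measurable]: "(\<lambda>x. n \<bullet> rotate (g x)) \<in> borel_measurable borel"
      using cr by (rule borel_measurable_continuous_onI)
    show "(\<lambda>x. indicator {x. c < n \<bullet> x} x * (n \<bullet> rotate (g x))) \<in> borel_measurable (lebesgue_on S)"
      by (rule borel_imp_lebesgue_on) measurable
  qed (auto simp: indicator_def)
  have "ip S (ridge_field p \<kappa> n c) (\<lambda>x. rotate (g x)) =
      (LINT x|lebesgue_on S. p \<bullet> rotate (g x) + \<kappa> * (indicator {x. c < n \<bullet> x} x * (n \<bullet> rotate (g x))))"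
    unfolding ip_def ridge_field_def by (simp add: inner_add_left mult.assoc)
  also have "\<dots> = (LINT x|lebesgue_on S. p \<bullet> rotate (g x)) +
      \<kappa> * (LINT x|lebesgue_on S. indicator {x. c < n \<bullet> x} x * (n \<bullet> rotate (g x)))"
    using i1 i2 by simp
  finally show ?thesis
    using green_formula[OF C1 M, of p] green_formula_half_plane[OF C1 M, of n c]
    by (simp add: sum.distrib flip: sum_distrib_left)
qed

lemma seg_mean_zero_on_boundary:
  assumes "closed_segment a b \<subseteq> frontier K" "compact_support_in S \<phi>"
  shows "seg_mean (\<lambda>x. f x * \<phi> x) a b = 0"
proof -
  have z: "f (a + s *\<^sub>R (b - a)) * \<phi> (a + s *\<^sub>R (b - a)) = 0" if "s \<in> {0..1}" for s
  proof -
    have "a + s *\<^sub>R (b - a) \<in> closed_segment a b" using that by (auto simp: in_segment algebra_simps)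
    then have "a + s *\<^sub>R (b - a) \<notin> S" using assms(1) by (auto simp: frontier_def)
    then show ?thesis using compact_support_in_zero[OF assms(2)] by simp
  qed
  have "(LINT s|lebesgue_on {0..1}. f (a + s *\<^sub>R (b - a)) * \<phi> (a + s *\<^sub>R (b - a))) = (LINT s|lebesgue_on {0..1::real}. 0)"
  proof (rule Bochner_Integration.integral_cong[OF refl])
    fix s assume "s \<in> space (lebesgue_on {0..1::real})"
    then have "s \<in> {0..1}" by simp
    then show "f (a + s *\<^sub>R (b - a)) * \<phi> (a + s *\<^sub>R (b - a)) = 0" by (rule z)
  qed
  then show ?thesis by (simp add: seg_mean_def)
qed

lemma ridge_field_annihilates:
  assumes C1: "C1_with_gradient \<phi> g" and supp: "compact_support_in S \<phi>"
  shows "ip S (ridge_field p \<kappa> n c) (\<lambda>x. rotate (g x)) = 0"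
proof -
  let ?E = "boundary_segments K ({A, B, C} \<union> {})"
  have "(\<Sum>e\<in>?E. (p \<bullet> (snd e - fst e)) * seg_mean \<phi> (fst e) (snd e) +
        \<kappa> * ((n \<bullet> (snd e - fst e)) * seg_mean (\<lambda>x. indicator {x. c < n \<bullet> x} x * \<phi> x) (fst e) (snd e))) = 0"
  proof (rule sum.neutral, rule ballI)
    fix e assume "e \<in> ?E"
    then have "closed_segment (fst e) (snd e) \<subseteq> frontier K"
      by (cases e) (auto simp: boundary_segments_iff)
    then show "(p \<bullet> (snd e - fst e)) * seg_mean \<phi> (fst e) (snd e) +
        \<kappa> * ((n \<bullet> (snd e - fst e)) * seg_mean (\<lambda>x. indicator {x. c < n \<bullet> x} x * \<phi> x) (fst e) (snd e)) = 0"
      using seg_mean_zero_on_boundary[OF _ supp, of "fst e" "snd e" "\<lambda>_. 1"]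
        seg_mean_zero_on_boundary[OF _ supp, of "fst e" "snd e"] by simp
  qed
  then show ?thesis using green_formula_ridge_field[OF C1, of "{}" p \<kappa> n c] by simp
qed

lemma ridge_field_weak_curl: "has_weak_curl S (ridge_field p \<kappa> n c) (\<lambda>_. 0)"
proof -
  have "L2 S (\<lambda>_. 0 :: real)" by (rule L2_continuous[OF continuous_on_const S_facts(4,3)])
  then show ?thesis unfolding has_weak_curl_def
    using L2_ridge_field[OF S_facts(4,3)] ridge_field_annihilates by (auto simp: ip_def)
qed

lemma ridge_field_weak_div: "has_weak_div S (\<lambda>x. rotate (ridge_field p \<kappa> n c x)) (\<lambda>_. 0)"
proof -
  have "ip S (\<lambda>x. rotate (ridge_field p \<kappa> n c x)) g = - ip S (ridge_field p \<kappa> n c) (\<lambda>x. rotate (g x))" for g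
    unfolding ip_def by (simp add: inner_plane flip: Bochner_Integration.integral_minus)
  moreover have "L2 S (\<lambda>_. 0 :: real)" by (rule L2_continuous[OF continuous_on_const S_facts(4,3)])
  ultimately show ?thesis unfolding has_weak_div_def
    using L2_ridge_field[OF S_facts(4,3)] ridge_field_annihilates by (auto simp: ip_def)
qed

text \<open>The trace is read off edge by edge; distinct boundary segments have disjoint interiors, so these
  values fit together to one function on the boundary.\<close>

lemma ridge_field_has_trace:
  assumes M: "finite M" "M \<subseteq> frontier K"
  shows "\<exists>\<gamma>. has_tangential_trace K (boundary_segments K ({A, B, C} \<union> M)) (ridge_field p \<kappa> n c) \<gamma>"
proof -
  let ?E = "boundary_segments K ({A, B, C} \<union> M)"
  let ?q = "ridge_field p \<kappa> n c"
  define on where "on x e \<longleftrightarrow> e \<in> ?E \<and> x \<in> open_segment (fst e) (snd e)" for x e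
  define tv where "tv e x = (?q x \<bullet> (snd e - fst e)) / dist (fst e) (snd e)" for e x
  define \<gamma> where "\<gamma> x = tv (SOME e. on x e) x" for x
  have \<gamma>: "\<gamma> (edge_point e s) = tv e (edge_point e s)" if e: "e \<in> ?E" and s: "0 < s" "s < 1" for e s
  proof -
    have "fst e \<noteq> snd e" using e by (cases e) (auto simp: boundary_segments_iff)
    then have on: "on (edge_point e s) e"
      unfolding edge_point_def on_def using e s open_segment_pointI by auto
    then have "on (edge_point e s) (SOME f. on (edge_point e s) f)"
      by (rule someI[of "on (edge_point e s)" e])
    then have "(SOME f. on (edge_point e s) f) = e"
      using boundary_segment_unique[of "fst e" "snd e" _ "fst (SOME f. on (edge_point e s) f)" "snd (SOME f. on (edge_point e s) f)"] on
      by (auto simp: prod_eq_iff on_def)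
    then show ?thesis by (simp add: \<gamma>_def)
  qed
  have ep: "(\<lambda>s. edge_point e s) \<in> borel_measurable borel" for e
    unfolding edge_point_def by (intro borel_measurable_continuous_onI continuous_intros)
  have tvm: "(\<lambda>s. tv e (edge_point e s)) \<in> borel_measurable borel" for e
    unfolding tv_def using measurable_compose[OF ep ridge_field_measurable] by (intro borel_measurable_divide borel_measurable_inner) auto
  have I: "{0..1::real} \<in> sets lebesgue" "bounded {0..1::real}" by auto
  have L2tv: "L2 {0..1} (\<lambda>s. tv e (edge_point e s))" if e: "e \<in> ?E" for e
  proof (rule L2_bounded[OF borel_imp_lebesgue_on[OF tvm] _ I])
    fix s
    have ne: "fst e \<noteq> snd e" using e by (cases e) (auto simp: boundary_segments_iff)
    have "\<bar>?q (edge_point e s) \<bullet> (snd e - fst e)\<bar> \<le> norm (?q (edge_point e s)) * norm (snd e - fst e)"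
      by (rule Cauchy_Schwarz_ineq2)
    also have "\<dots> \<le> (norm p + \<bar>\<kappa>\<bar> * norm n) * norm (snd e - fst e)"
      by (intro mult_right_mono ridge_field_bound) simp
    finally show "norm (tv e (edge_point e s)) \<le> norm p + \<bar>\<kappa>\<bar> * norm n"
      using ne by (simp add: tv_def abs_divide dist_norm norm_minus_commute divide_le_eq)
  qed
  have ae: "AE s in lebesgue_on {0..1}. tv e (edge_point e s) = \<gamma> (edge_point e s)" if "e \<in> ?E" for e
    using AE_unit_interval_interior by eventually_elim (simp add: \<gamma>[OF that])
  have L2\<gamma>: "L2 {0..1} (\<lambda>s. \<gamma> (edge_point e s))" if "e \<in> ?E" for e
    by (rule L2_cong_AE[OF L2tv[OF that] ae[OF that] I(1)])
  have H: "?q \<in> Hcurl S"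
    unfolding Hcurl_def by (rule CollectI, rule exI, rule ridge_field_weak_curl)
  have "has_tangential_trace K ?E ?q \<gamma>"
    unfolding has_tangential_trace_def
  proof (intro conjI ballI allI impI H L2\<gamma>)
    fix \<phi> g assume C1: "C1_with_gradient \<phi> g"
    note d = C1_with_gradientD[OF C1]
    have [measurable]: "\<phi> \<in> borel_measurable borel" using d by simp
    have "edge_ip e \<gamma> \<phi> = (p \<bullet> (snd e - fst e)) * seg_mean \<phi> (fst e) (snd e) +
        \<kappa> * ((n \<bullet> (snd e - fst e)) * seg_mean (\<lambda>x. indicator {x. c < n \<bullet> x} x * \<phi> x) (fst e) (snd e))" if e: "e \<in> ?E" for e
    proof -
      have ne: "fst e \<noteq> snd e" using e by (cases e) (auto simp: boundary_segments_iff)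
      have cont: "continuous_on UNIV (\<lambda>s. \<phi> (edge_point e s))"
        unfolding edge_point_def by (rule continuous_on_seg[OF d(1)])
      have L2\<phi>: "L2 {0..1} (\<lambda>s. \<phi> (edge_point e s))"
        by (rule L2_continuous[OF cont I])
      have i1: "integrable (lebesgue_on {0..1}) (\<lambda>s. \<phi> (edge_point e s))"
        unfolding edge_point_def by (rule seg_integrable[OF d(1)])
      have i2: "integrable (lebesgue_on {0..1}) (\<lambda>s. indicator {x. c < n \<bullet> x} (edge_point e s) * \<phi> (edge_point e s))"
      proof (rule Bochner_Integration.integrable_bound[OF i1])
        show "(\<lambda>s. indicator {x. c < n \<bullet> x} (edge_point e s) * \<phi> (edge_point e s)) \<in> borel_measurable (lebesgue_on {0..1})"
          by (intro borel_imp_lebesgue_on borel_measurable_times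
              measurable_compose[OF ep borel_measurable_indicator[OF half_plane_borel]] measurable_compose[OF ep d(4)])
      qed (auto simp: indicator_def)
      have "ip {0..1} (\<lambda>s. \<gamma> (edge_point e s)) (\<lambda>s. \<phi> (edge_point e s)) = ip {0..1} (\<lambda>s. tv e (edge_point e s)) (\<lambda>s. \<phi> (edge_point e s))"
        using ae[OF e] by (intro ip_cong_AE L2\<gamma> L2tv L2\<phi> e) (auto elim: eventually_mono)
      also have "\<dots> = (LINT s|lebesgue_on {0..1}. ((p \<bullet> (snd e - fst e)) / dist (fst e) (snd e)) * \<phi> (edge_point e s) +
          (\<kappa> * (n \<bullet> (snd e - fst e)) / dist (fst e) (snd e)) * (indicator {x. c < n \<bullet> x} (edge_point e s) * \<phi> (edge_point e s)))"
        unfolding ip_def tv_def ridge_field_def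
        by (intro Bochner_Integration.integral_cong refl) (simp add: inner_add_left divide_inverse distrib_left distrib_right ac_simps)
      also have "\<dots> = ((p \<bullet> (snd e - fst e)) / dist (fst e) (snd e)) * seg_mean \<phi> (fst e) (snd e) +
          (\<kappa> * (n \<bullet> (snd e - fst e)) / dist (fst e) (snd e)) * seg_mean (\<lambda>x. indicator {x. c < n \<bullet> x} x * \<phi> x) (fst e) (snd e)"
        using i1 i2 by (simp add: seg_mean_def edge_point_def)
      finally show ?thesis using ne by (simp add: edge_ip_def field_simps)
    qed
    then have "(\<Sum>e\<in>?E. edge_ip e \<gamma> \<phi>) = - ip S ?q (\<lambda>x. rotate (g x))"
      using green_formula_ridge_field[OF C1 M, of p \<kappa> n c] by simp
    moreover have "ip S (weak_curl S ?q) \<phi> = 0"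
    proof -
      have wc: "has_weak_curl S ?q (weak_curl S ?q)" using H by (rule has_weak_curl_weak_curl)
      have "AE x in lebesgue_on S. weak_curl S ?q x = 0"
        by (rule weak_curl_unique[OF S_facts(1,3,2) wc ridge_field_weak_curl])
      then have "AE x in lebesgue_on S. weak_curl S ?q x \<bullet> \<phi> x = 0" by eventually_elim simp
      then show ?thesis unfolding ip_def by (rule integral_eq_zero_AE)
    qed
    ultimately show "(\<Sum>e\<in>?E. edge_ip e \<gamma> \<phi>) = ip S (weak_curl S ?q) \<phi> - ip S ?q (\<lambda>x. rotate (g x))" by simp
  qed
  then show ?thesis by blast
qed

end

section \<open>Control of a field by its curl and its tangential trace\<close>

lemma edge_ip_self_nonneg: "0 \<le> edge_ip e f f"
  unfolding edge_ip_def by (intro mult_nonneg_nonneg ip_self_nonneg) simp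

lemma edge_ip_young:
  assumes "L2 {0..1} (\<lambda>s. f (edge_point e s))" "L2 {0..1} (\<lambda>s. g (edge_point e s))" "a > 0"
  shows "\<bar>edge_ip e f g\<bar> \<le> a * edge_ip e f f + edge_ip e g g / (4 * a)"
proof -
  have "\<bar>edge_ip e f g\<bar> \<le> dist (fst e) (snd e) *
      (a * ip {0..1} (\<lambda>s. f (edge_point e s)) (\<lambda>s. f (edge_point e s)) +
        ip {0..1} (\<lambda>s. g (edge_point e s)) (\<lambda>s. g (edge_point e s)) / (4 * a))"
    unfolding edge_ip_def abs_mult using ip_young[OF assms] by (simp add: mult_left_mono)
  then show ?thesis by (simp add: edge_ip_def algebra_simps)
qed

context triangle
begin

text \<open>The components of \<open>F\<close> are smoothed by contraction. The divergence of the smoothed field vanishes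
  pointwise, so that it has a potential, and its closeness to \<open>F\<close> in the mean square carries over to
  the pairing with \<open>w\<close>.\<close>

lemma divergence_free_approximation:
  assumes F: "has_weak_div S F (\<lambda>_. 0)" and w: "L2 S w" and \<epsilon>: "\<epsilon> > 0" and ne: "S \<noteq> {}"
  obtains \<psi> g where "C1_with_gradient \<psi> g" "ip S g g \<le> 4 * ip S F F"
    "\<bar>ip S F w - ip S (\<lambda>x. rotate (g x)) w\<bar> \<le> \<epsilon>"
proof -
  obtain p where p: "p \<in> S" using ne by blast
  then obtain r where pr: "r > 0" "ball p r \<subseteq> S" using S_facts(1) by (meson openE)
  obtain k k' L B where "smoothing_kernel S k k' L B"
    by (rule smoothing_kernel_exists[OF S_facts(1,3,2) pr(2,1)])
  then interpret smoothing_kernel S k k' L B .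
  have L2F: "L2 S F" using F by (simp add: has_weak_div_def)
  have rep: "\<exists>f. square_integrable f \<and> (AE x in lebesgue_on S. F x $ i = f x) \<and> (\<forall>x. x \<notin> S \<longrightarrow> f x = 0)" for i
    by (rule L2_borel_representative[OF L2_component[OF L2F, of i] S_measurable])
      (auto simp: square_integrable_def)
  obtain F1 where F1: "square_integrable F1" "AE x in lebesgue_on S. F x $ 1 = F1 x" "\<And>x. x \<notin> S \<Longrightarrow> F1 x = 0"
    using rep[of 1] by auto
  obtain F2 where F2: "square_integrable F2" "AE x in lebesgue_on S. F x $ 2 = F2 x" "\<And>x. x \<notin> S \<Longrightarrow> F2 x = 0"
    using rep[of 2] by auto
  have [measurable]: "F1 \<in> borel_measurable borel" "F2 \<in> borel_measurable borel"
    using F1 F2 by (auto simp: square_integrable_def)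
  have FF: "ip S F F = (LINT x|lborel. (F1 x)\<^sup>2) + (LINT x|lborel. (F2 x)\<^sup>2)"
  proof -
    have "ip S F F = (LINT x|lebesgue_on S. (F1 x)\<^sup>2 + (F2 x)\<^sup>2)"
      unfolding ip_def
    proof (rule integral_cong_AE)
      show "(\<lambda>x. F x \<bullet> F x) \<in> borel_measurable (lebesgue_on S)"
        using L2_integrable_inner[OF L2F L2F] by (rule borel_measurable_integrable)
      show "(\<lambda>x. (F1 x)\<^sup>2 + (F2 x)\<^sup>2) \<in> borel_measurable (lebesgue_on S)"
        by (rule borel_imp_lebesgue_on) measurable
      show "AE x in lebesgue_on S. F x \<bullet> F x = (F1 x)\<^sup>2 + (F2 x)\<^sup>2"
        using F1(2) F2(2) by eventually_elim (simp add: inner_plane power2_eq_square)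
    qed
    also have "\<dots> = (LINT x|lborel. indicator S x * ((F1 x)\<^sup>2 + (F2 x)\<^sup>2))"
      by (rule integral_lebesgue_on_borel) measurable
    also have "\<dots> = (LINT x|lborel. (F1 x)\<^sup>2 + (F2 x)\<^sup>2)"
      using F1(3) F2(3) by (intro Bochner_Integration.integral_cong) (auto simp: indicator_def)
    finally show ?thesis using F1(1) F2(1) by (simp add: square_integrable_def)
  qed
  define W where "W = ip S w w"
  have W: "W \<ge> 0" unfolding W_def by (rule ip_self_nonneg)
  \<comment> \<open>The weight in Young's inequality: the part with \<open>w\<close> stays below \<open>\<epsilon> / 2\<close>, and the other part is
    made small by the smoothing parameter.\<close>
  define a where "a = \<epsilon> / (2 * (W + 1))"
  have a: "a > 0" "a * W \<le> \<epsilon> / 2" using \<epsilon> W by (auto simp: a_def field_simps)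
  let ?D = "\<lambda>f l. LINT x|lborel. indicator S x * (smooth l f x - f x)\<^sup>2"
  have "((\<lambda>l. ?D F1 l + ?D F2 l) \<longlongrightarrow> 0 + 0) (at_left 1)"
    by (intro tendsto_add smooth_tendsto_L2 F1 F2)
  then have "\<forall>\<^sub>F l in at_left 1. ?D F1 l + ?D F2 l < 2 * a * \<epsilon>"
    using a \<epsilon> by (intro order_tendstoD(2)) auto
  moreover have "\<forall>\<^sub>F l in at_left (1::real). 1 / 2 < l \<and> l < 1"
    using eventually_at_left_real[of "1/2" "1::real"] by (auto elim: eventually_mono)
  ultimately have "\<forall>\<^sub>F l in at_left 1. ?D F1 l + ?D F2 l < 2 * a * \<epsilon> \<and> 1 / 2 < l \<and> l < 1"
    by (rule eventually_conj)
  then obtain l where l: "?D F1 l + ?D F2 l < 2 * a * \<epsilon>" "1 / 2 \<le> l" "l < 1"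
    using eventually_happens[of _ "at_left (1::real)"] by fastforce
  note C1s = smooth_C1[OF F1(1,3) l(3)] smooth_C1[OF F2(1,3) l(3)]
  have div0: "smooth_grad l F1 x $ 1 + smooth_grad l F2 x $ 2 = 0" if x: "x \<in> S" for x
  proof -
    let ?G = "shifted_kernel_grad l x"
    have l0: "0 < l" using l by simp
    note test = shifted_kernel_C1[OF l(3), of x] shifted_kernel_support[OF l0 l(3) x]
    have i: "integrable lborel (\<lambda>y. f y *\<^sub>R ?G y)" if f: "square_integrable f" "\<And>x. x \<notin> S \<Longrightarrow> f x = 0" for f
    proof (rule Bochner_Integration.integrable_bound[where f="\<lambda>y. (B / (1 - l)) * f y"])
      have [measurable]: "f \<in> borel_measurable borel" using f by (simp add: square_integrable_def)
      have [measurable]: "?G \<in> borel_measurable borel" using C1_with_gradientD(5)[OF test(1)] .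
      show "(\<lambda>y. f y *\<^sub>R ?G y) \<in> borel_measurable lborel" by measurable
      show "integrable lborel (\<lambda>y. (B / (1 - l)) * f y)"
        using integrable_of_square_integrable[OF f] by simp
      show "AE y in lborel. norm (f y *\<^sub>R ?G y) \<le> norm ((B / (1 - l)) * f y)"
      proof (rule AE_I2)
        fix y
        have B: "norm (?G y) \<le> B / (1 - l)"
          using k'_le[of "(y - l *\<^sub>R x) /\<^sub>R (1 - l)"] l(3)
          by (simp add: shifted_kernel_grad_def divide_inverse_commute mult_left_mono)
        then have "0 \<le> B / (1 - l)" using norm_ge_zero order_trans by blast
        then have "\<bar>B / (1 - l)\<bar> = B / (1 - l)" by (rule abs_of_nonneg)
        then show "norm (f y *\<^sub>R ?G y) \<le> norm ((B / (1 - l)) * f y)"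
          using mult_left_mono[OF B, of "\<bar>f y\<bar>"] by (simp only: norm_scaleR real_norm_def abs_mult) (simp add: mult.commute)
      qed
    qed
    have comp: "(LINT y|lborel. f y *\<^sub>R ?G y) $ j = (LINT y|lborel. f y * ?G y $ j)"
      "integrable lborel (\<lambda>y. f y * ?G y $ j)"
      if f: "square_integrable f" "\<And>x. x \<notin> S \<Longrightarrow> f x = 0" for f j
    proof -
      have "(LINT y|lborel. f y *\<^sub>R ?G y) \<bullet> axis j 1 = (LINT y|lborel. (f y *\<^sub>R ?G y) \<bullet> axis j 1)"
        using integral_inner_left[OF i[OF f], of "axis j 1"] by simp
      then show "(LINT y|lborel. f y *\<^sub>R ?G y) $ j = (LINT y|lborel. f y * ?G y $ j)"
        by (simp add: inner_axis)
      have "integrable lborel (\<lambda>y. (f y *\<^sub>R ?G y) \<bullet> axis j 1)"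
        using integrable_inner_left[OF i[OF f], of "axis j 1"] by simp
      then show "integrable lborel (\<lambda>y. f y * ?G y $ j)" by (simp add: inner_axis)
    qed
    note c1 = comp[OF F1(1,3), of 1] and c2 = comp[OF F2(1,3), of 2]
    have "(LINT y|lborel. F1 y * ?G y $ 1) + (LINT y|lborel. F2 y * ?G y $ 2) = (LINT y|lborel. F1 y * ?G y $ 1 + F2 y * ?G y $ 2)"
      using c1 c2 by simp
    also have "\<dots> = (LINT y|lborel. indicator S y * (F1 y * ?G y $ 1 + F2 y * ?G y $ 2))"
      using F1(3) F2(3) by (intro Bochner_Integration.integral_cong) (auto simp: indicator_def)
    also have "\<dots> = (LINT y|lebesgue_on S. F1 y * ?G y $ 1 + F2 y * ?G y $ 2)"
      using c1(2) c2(2) by (intro integral_lebesgue_on_borel[symmetric]) (auto dest: borel_measurable_integrable)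
    also have "\<dots> = ip S F ?G"
      unfolding ip_def
    proof (rule integral_cong_AE)
      show "(\<lambda>y. F1 y * ?G y $ 1 + F2 y * ?G y $ 2) \<in> borel_measurable (lebesgue_on S)"
        using c1(2) c2(2) by (intro borel_imp_lebesgue_on borel_measurable_add) (auto dest: borel_measurable_integrable)
      show "(\<lambda>y. F y \<bullet> ?G y) \<in> borel_measurable (lebesgue_on S)"
        by (rule borel_measurable_integrable[OF L2_integrable_inner[OF L2F L2_test_function(3)[OF test(1) S_facts(4,3)]]])
      show "AE y in lebesgue_on S. F1 y * ?G y $ 1 + F2 y * ?G y $ 2 = F y \<bullet> ?G y"
        using F1(2) F2(2) by eventually_elim (simp add: inner_plane)
    qed
    also have "\<dots> = 0"
    proof -
      have "ip S (\<lambda>_. 0) (shifted_kernel l x) = - ip S F ?G"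
        using F test unfolding has_weak_div_def by blast
      then show ?thesis by (simp add: ip_def)
    qed
    finally have z: "(LINT y|lborel. F1 y * ?G y $ 1) + (LINT y|lborel. F2 y * ?G y $ 2) = 0" .
    have "smooth_grad l F1 x $ 1 + smooth_grad l F2 x $ 2 =
        (- l / (1 - l)\<^sup>2) * ((LINT y|lborel. F1 y * ?G y $ 1) + (LINT y|lborel. F2 y * ?G y $ 2))"
      using c1(1) c2(1) by (simp add: smooth_grad_def distrib_left)
    then show ?thesis by (simp only: z mult_zero_right)
  qed
  obtain \<psi> g where \<psi>: "C1_with_gradient \<psi> g" and g: "\<And>x. x \<in> S \<Longrightarrow> rotate (g x) = vector [smooth l F1 x, smooth l F2 x]"
    by (rule divergence_free_potential[OF C1s S_facts(2) p div0]) blast+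
  have g1: "g x $ 2 = smooth l F1 x" "g x $ 1 = - smooth l F2 x" if "x \<in> S" for x
    using arg_cong[OF g[OF that], of "\<lambda>v. v $ 1"] arg_cong[OF g[OF that], of "\<lambda>v. v $ 2"] by auto
  note L2g = L2_test_function[OF \<psi> S_facts(4,3)]
  have gg: "ip S g g \<le> 4 * ip S F F"
  proof -
    note b1 = smooth_L2_bound[OF F1(1) l(2,3)] and b2 = smooth_L2_bound[OF F2(1) l(2,3)]
    have i: "integrable lborel (\<lambda>x. (smooth l F1 x)\<^sup>2)" "integrable lborel (\<lambda>x. (smooth l F2 x)\<^sup>2)"
      using b1 b2 by (auto simp: square_integrable_def)
    have "ip S g g = (LINT x|lebesgue_on S. (smooth l F1 x)\<^sup>2 + (smooth l F2 x)\<^sup>2)"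
      unfolding ip_def by (intro Bochner_Integration.integral_cong) (auto simp: inner_plane g1 power2_eq_square)
    also have "\<dots> = (LINT x|lborel. indicator S x * ((smooth l F1 x)\<^sup>2 + (smooth l F2 x)\<^sup>2))"
      by (rule integral_lebesgue_on_borel) measurable
    also have "\<dots> \<le> (LINT x|lborel. (smooth l F1 x)\<^sup>2 + (smooth l F2 x)\<^sup>2)"
      using i by (intro integral_mono' ) (auto simp: indicator_def)
    also have "\<dots> \<le> 4 * ip S F F" unfolding FF using i b1(2) b2(2) by simp
    finally show ?thesis .
  qed
  let ?R = "\<lambda>x. rotate (g x)"
  have L2R: "L2 S ?R" by (rule L2g)
  have L2d: "L2 S (\<lambda>x. F x - ?R x)" by (rule L2_diff[OF L2F L2R])
  have dd: "ip S (\<lambda>x. F x - ?R x) (\<lambda>x. F x - ?R x) = ?D F1 l + ?D F2 l"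
  proof -
    have "AE x in lebesgue_on S. x \<in> S" by (rule AE_I2) simp
    then have ae: "AE x in lebesgue_on S. (F x - ?R x) \<bullet> (F x - ?R x) = (smooth l F1 x - F1 x)\<^sup>2 + (smooth l F2 x - F2 x)\<^sup>2"
      using F1(2) F2(2) by eventually_elim (simp add: inner_plane g1 power2_eq_square algebra_simps)
    have i: "integrable lborel (\<lambda>x. indicator S x * (smooth l f x - f x)\<^sup>2)" if f: "square_integrable f" for f
    proof -
      have fm[measurable]: "f \<in> borel_measurable borel" using f by (simp add: square_integrable_def)
      have "integrable lborel (\<lambda>x. 2 * (smooth l f x)\<^sup>2 + 2 * (f x)\<^sup>2)"
        using f smooth_L2_bound(1)[OF f l(2,3)] by (simp add: square_integrable_def)
      then show ?thesis
      proof (rule Bochner_Integration.integrable_bound)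
        show "AE x in lborel. norm (indicator S x * (smooth l f x - f x)\<^sup>2) \<le> norm (2 * (smooth l f x)\<^sup>2 + 2 * (f x)\<^sup>2)"
        proof (rule AE_I2)
          fix x
          have "(smooth l f x - f x)\<^sup>2 \<le> 2 * (smooth l f x)\<^sup>2 + 2 * (f x)\<^sup>2"
            using square_sum2_le[of "smooth l f x" "- f x"] by simp
          then show "norm (indicator S x * (smooth l f x - f x)\<^sup>2) \<le> norm (2 * (smooth l f x)\<^sup>2 + 2 * (f x)\<^sup>2)"
            by (auto simp: indicator_def)
        qed
      qed measurable
    qed
    have "ip S (\<lambda>x. F x - ?R x) (\<lambda>x. F x - ?R x) = (LINT x|lebesgue_on S. (smooth l F1 x - F1 x)\<^sup>2 + (smooth l F2 x - F2 x)\<^sup>2)"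
      unfolding ip_def
    proof (rule integral_cong_AE[OF _ _ ae])
      show "(\<lambda>x. (F x - ?R x) \<bullet> (F x - ?R x)) \<in> borel_measurable (lebesgue_on S)"
        by (rule borel_measurable_integrable[OF L2_integrable_inner[OF L2d L2d]])
      show "(\<lambda>x. (smooth l F1 x - F1 x)\<^sup>2 + (smooth l F2 x - F2 x)\<^sup>2) \<in> borel_measurable (lebesgue_on S)"
        by (rule borel_imp_lebesgue_on) measurable
    qed
    also have "\<dots> = (LINT x|lborel. indicator S x * ((smooth l F1 x - F1 x)\<^sup>2 + (smooth l F2 x - F2 x)\<^sup>2))"
      by (rule integral_lebesgue_on_borel) measurable
    also have "\<dots> = ?D F1 l + ?D F2 l"
      using i[OF F1(1)] i[OF F2(1)] by (simp add: distrib_left)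
    finally show ?thesis .
  qed
  have "\<bar>ip S F w - ip S ?R w\<bar> = \<bar>ip S w (\<lambda>x. F x - ?R x)\<bar>"
    unfolding ip_diff_left[OF L2F L2R w, symmetric] by (simp add: ip_def inner_commute)
  also have "\<dots> \<le> a * W + (?D F1 l + ?D F2 l) / (4 * a)"
    using ip_young[OF w L2d a(1)] by (simp add: W_def dd)
  also have "(?D F1 l + ?D F2 l) / (4 * a) \<le> (2 * a * \<epsilon>) / (4 * a)"
    using l(1) a by (intro divide_right_mono) auto
  also have "a * W + (2 * a * \<epsilon>) / (4 * a) \<le> \<epsilon>" using a by simp
  finally show ?thesis by (intro that[OF \<psi> gg]) simp
qed

lemma C1_minus_constant: "C1_with_gradient \<psi> g \<Longrightarrow> C1_with_gradient (\<lambda>x. \<psi> x - m) g"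
  unfolding C1_with_gradient_def gderiv_def by (auto intro!: derivative_eq_intros)

text \<open>Green's formula turns the pairing into a term with the curl of \<open>w\<close> and one with its trace. Poincare
  and trace inequality bound their other factor, once a constant has been subtracted from \<open>\<psi>\<close>.\<close>

lemma rotated_gradient_pairing:
  assumes M: "finite M" "M \<subseteq> frontier K" and w: "has_tangential_trace K (boundary_segments K ({A, B, C} \<union> M)) w \<gamma>"
    and ball: "cball x0 r \<subseteq> K" "r > 0" and diam: "diameter K \<le> \<sigma> * r" and \<psi>: "C1_with_gradient \<psi> g" and a: "a > 0"
  shows "\<bar>ip S (\<lambda>x. rotate (g x)) w\<bar> \<le>
    a * ((diameter K)\<^sup>2 * ip S (weak_curl S w) (weak_curl S w) +
      \<sigma> * diameter K * (\<Sum>e\<in>boundary_segments K ({A, B, C} \<union> M). edge_ip e \<gamma> \<gamma>)) + 5 / a * ip S g g"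
proof -
  let ?E = "boundary_segments K ({A, B, C} \<union> M)"
  define d where "d = diameter K"
  have dpos: "d > 0"
  proof -
    have "2 * r = diameter (cball x0 r)" using ball by (simp add: diameter_cball)
    also have "\<dots> \<le> d" unfolding d_def using ball K_compact by (intro diameter_subset compact_imp_bounded)
    finally show ?thesis using ball by simp
  qed
  have \<sigma>: "\<sigma> > 0" using dpos diam ball by (simp add: d_def) (metis less_le_trans zero_less_mult_pos2)
  have Sne: "S \<noteq> {}"
  proof -
    have "x0 \<in> interior (cball x0 r)" using ball by simp
    then show ?thesis using interior_mono[OF ball(1)] by blast
  qed
  obtain y where y: "(LINT x|lborel. indicator K x * (\<psi> x - \<psi> y)\<^sup>2) \<le> 4 * d\<^sup>2 * (LINT x|lborel. indicator K x * (norm (g x))\<^sup>2)"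
    by (rule poincare_inequality[OF \<psi> K_compact K_convex Sne, of d]) (auto simp: d_def)
  define \<phi> where "\<phi> x = \<psi> x - \<psi> y" for x
  have \<phi>: "C1_with_gradient \<phi> g" unfolding \<phi>_def by (rule C1_minus_constant[OF \<psi>])
  note c = C1_with_gradientD[OF \<phi>]
  have lK: "(LINT x|lborel. indicator K x * f x) = (LINT x|lebesgue_on S. f x)" if "continuous_on UNIV f" for f :: scalar_field
  proof -
    have "set_integrable lborel K f"
      unfolding set_integrable_def
      by (rule borel_integrable_compact[OF K_compact continuous_on_subset[OF that]]) simp
    from set_borel_integral_eq_integral(2)[OF this] show ?thesis
      using integral_interior_K(2)[OF that] by (simp add: set_lebesgue_integral_def)
  qed
  define G where "G = ip S g g"
  have G0: "G \<ge> 0" unfolding G_def by (rule ip_self_nonneg)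
  have Gn: "(LINT x|lebesgue_on S. (norm (g x))\<^sup>2) = G"
    by (simp add: G_def ip_def power2_norm_eq_inner)
  have \<phi>\<phi>: "ip S \<phi> \<phi> = (LINT x|lebesgue_on S. (\<phi> x)\<^sup>2)" by (simp add: ip_def power2_eq_square)
  have P: "ip S \<phi> \<phi> \<le> 4 * d\<^sup>2 * G"
  proof -
    have "(LINT x|lborel. indicator K x * (\<phi> x)\<^sup>2) = ip S \<phi> \<phi>"
      unfolding \<phi>\<phi> by (intro lK continuous_intros c)
    moreover have "(LINT x|lborel. indicator K x * (norm (g x))\<^sup>2) = G"
      unfolding Gn[symmetric] by (intro lK continuous_intros c)
    ultimately show ?thesis using y by (simp add: \<phi>_def)
  qed
  have eip: "edge_ip e \<phi> \<phi> = dist (fst e) (snd e) * seg_mean (\<lambda>x. (\<phi> x)\<^sup>2) (fst e) (snd e)" for e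
    by (simp add: edge_ip_def ip_def seg_mean_def edge_point_def power2_eq_square)
  define T where "T = (\<Sum>e\<in>?E. edge_ip e \<phi> \<phi>)"
  have T: "T \<le> 13 * \<sigma> * d * G"
  proof -
    have "r * T \<le> 3 * ip S \<phi> \<phi> + d\<^sup>2 * G"
      using trace_inequality[OF \<phi> M ball, of d] by (simp add: d_def T_def eip Gn \<phi>\<phi>)
    also have "\<dots> \<le> 13 * d\<^sup>2 * G" using P unfolding mult.assoc by linarith
    also have "\<dots> = d * (13 * d * G)" by (simp add: power2_eq_square)
    also have "\<dots> \<le> (\<sigma> * r) * (13 * d * G)"
      using diam dpos G0 by (intro mult_right_mono) (auto simp: d_def)
    finally have "r * T \<le> r * (13 * \<sigma> * d * G)" by (simp add: ac_simps)
    then show ?thesis using ball by simp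
  qed
  have wH: "w \<in> Hcurl S" and L2\<gamma>: "\<And>e. e \<in> ?E \<Longrightarrow> L2 {0..1} (\<lambda>s. \<gamma> (edge_point e s))"
    and green: "(\<Sum>e\<in>?E. edge_ip e \<gamma> \<phi>) = ip S (weak_curl S w) \<phi> - ip S w (\<lambda>x. rotate (g x))"
    using w \<phi> unfolding has_tangential_trace_def by blast+
  let ?c = "weak_curl S w"
  have L2c: "L2 S ?c" using has_weak_curl_weak_curl[OF wH] by (simp add: has_weak_curl_def)
  have L2\<phi>: "L2 S \<phi>" by (rule L2_test_function(1)[OF \<phi> S_facts(4,3)])
  have L2e: "L2 {0..1} (\<lambda>s. \<phi> (edge_point e s))" for e
    unfolding edge_point_def by (rule L2_continuous[OF continuous_on_seg[OF c(1)]]) auto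
  define \<Gamma> where "\<Gamma> = (\<Sum>e\<in>?E. edge_ip e \<gamma> \<gamma>)"
  \<comment> \<open>The weights \<open>a d\<^sup>2\<close> and \<open>a \<sigma> d\<close> compensate the scaling of Poincare and trace inequality, so
    that both terms with \<open>\<phi>\<close> become multiples of \<open>G / a\<close>.\<close>
  have "\<bar>ip S ?c \<phi>\<bar> \<le> (a * d\<^sup>2) * ip S ?c ?c + ip S \<phi> \<phi> / (4 * (a * d\<^sup>2))"
    using a dpos by (intro ip_young[OF L2c L2\<phi>]) simp
  also have "ip S \<phi> \<phi> / (4 * (a * d\<^sup>2)) \<le> (4 * d\<^sup>2 * G) / (4 * (a * d\<^sup>2))"
    using P a by (intro divide_right_mono) auto
  also have "(4 * d\<^sup>2 * G) / (4 * (a * d\<^sup>2)) = G / a" using dpos by simp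
  finally have t1: "\<bar>ip S ?c \<phi>\<bar> \<le> a * d\<^sup>2 * ip S ?c ?c + G / a" by simp
  have "\<bar>\<Sum>e\<in>?E. edge_ip e \<gamma> \<phi>\<bar> \<le> (\<Sum>e\<in>?E. (a * \<sigma> * d) * edge_ip e \<gamma> \<gamma> + edge_ip e \<phi> \<phi> / (4 * (a * \<sigma> * d)))"
    using a \<sigma> dpos by (intro order_trans[OF sum_abs] sum_mono edge_ip_young L2\<gamma> L2e) auto
  also have "\<dots> = (a * \<sigma> * d) * \<Gamma> + T / (4 * (a * \<sigma> * d))"
    by (simp add: \<Gamma>_def T_def sum.distrib sum_distrib_left sum_divide_distrib)
  also have "T / (4 * (a * \<sigma> * d)) \<le> (13 * \<sigma> * d * G) / (4 * (a * \<sigma> * d))"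
    using T a \<sigma> dpos by (intro divide_right_mono) auto
  also have "(13 * \<sigma> * d * G) / (4 * (a * \<sigma> * d)) = 13 / 4 * (G / a)" using \<sigma> dpos by simp
  finally have t2: "\<bar>\<Sum>e\<in>?E. edge_ip e \<gamma> \<phi>\<bar> \<le> a * \<sigma> * d * \<Gamma> + 13 / 4 * (G / a)" by simp
  have "ip S (\<lambda>x. rotate (g x)) w = ip S ?c \<phi> - (\<Sum>e\<in>?E. edge_ip e \<gamma> \<phi>)"
    using green by (simp add: ip_def inner_commute)
  then have "\<bar>ip S (\<lambda>x. rotate (g x)) w\<bar> \<le> (a * d\<^sup>2 * ip S ?c ?c + G / a) + (a * \<sigma> * d * \<Gamma> + 13 / 4 * (G / a))"
    using t1 t2 by linarith
  also have "\<dots> \<le> a * (d\<^sup>2 * ip S ?c ?c + \<sigma> * d * \<Gamma>) + 5 / a * G"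
  proof -
    have "G / a \<ge> 0" using G0 a by simp
    moreover have "5 / a * G = 5 * (G / a)" by simp
    ultimately show ?thesis by (simp add: algebra_simps)
  qed
  finally show ?thesis by (simp add: d_def G_def \<Gamma>_def)
qed

text \<open>The gradient in the previous estimate is that of an approximation, whose square integral is at
  most four times that of \<open>F\<close>.\<close>

lemma divergence_free_pairing:
  assumes M: "finite M" "M \<subseteq> frontier K" and w: "has_tangential_trace K (boundary_segments K ({A, B, C} \<union> M)) w \<gamma>"
    and ball: "cball x0 r \<subseteq> K" "r > 0" and diam: "diameter K \<le> \<sigma> * r" and F: "has_weak_div S F (\<lambda>_. 0)" and a: "a > 0"
  shows "ip S F w \<le>
    a * ((diameter K)\<^sup>2 * ip S (weak_curl S w) (weak_curl S w) +
      \<sigma> * diameter K * (\<Sum>e\<in>boundary_segments K ({A, B, C} \<union> M). edge_ip e \<gamma> \<gamma>)) + 20 / a * ip S F F"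
proof (rule field_le_epsilon)
  fix \<epsilon> :: real assume \<epsilon>: "\<epsilon> > 0"
  have "w \<in> Hcurl S" using w by (simp add: has_tangential_trace_def)
  then have L2w: "L2 S w" by (auto simp: Hcurl_def has_weak_curl_def)
  have "x0 \<in> interior (cball x0 r)" using ball by simp
  then have Sne: "S \<noteq> {}" using interior_mono[OF ball(1)] by blast
  obtain \<psi> g where \<psi>: "C1_with_gradient \<psi> g" "ip S g g \<le> 4 * ip S F F"
    "\<bar>ip S F w - ip S (\<lambda>x. rotate (g x)) w\<bar> \<le> \<epsilon>"
    by (rule divergence_free_approximation[OF F L2w \<epsilon> Sne])
  have "5 / a * ip S g g \<le> 5 / a * (4 * ip S F F)" using \<psi>(2) a by (intro mult_left_mono) auto
  then show "ip S F w \<le>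
    a * ((diameter K)\<^sup>2 * ip S (weak_curl S w) (weak_curl S w) +
      \<sigma> * diameter K * (\<Sum>e\<in>boundary_segments K ({A, B, C} \<union> M). edge_ip e \<gamma> \<gamma>)) + 20 / a * ip S F F + \<epsilon>"
    using rotated_gradient_pairing[OF M w ball diam \<psi>(1) a] \<psi>(3) by simp
qed

text \<open>The parameter is chosen so that the term with \<open>F\<close> on the right is absorbed on the left.\<close>

lemma curl_and_trace_control:
  assumes M: "finite M" "M \<subseteq> frontier K" and w: "has_tangential_trace K (boundary_segments K ({A, B, C} \<union> M)) w \<gamma>"
    and ball: "cball x0 r \<subseteq> K" "r > 0" and diam: "diameter K \<le> \<sigma> * r"
    and b: "b \<in> borel_measurable (lebesgue_on S)" "\<And>x. x \<in> S \<Longrightarrow> lo \<le> b x" "\<And>x. x \<in> S \<Longrightarrow> b x \<le> hi" "0 < lo"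
    and div: "has_weak_div S (\<lambda>x. b x *\<^sub>R w x) (\<lambda>_. 0)"
  shows "ip S w w \<le> 80 * (hi / lo)\<^sup>2 *
    ((diameter K)\<^sup>2 * ip S (weak_curl S w) (weak_curl S w) +
      \<sigma> * diameter K * (\<Sum>e\<in>boundary_segments K ({A, B, C} \<union> M). edge_ip e \<gamma> \<gamma>))"
proof -
  let ?F = "\<lambda>x. b x *\<^sub>R w x"
  let ?Q = "(diameter K)\<^sup>2 * ip S (weak_curl S w) (weak_curl S w) +
      \<sigma> * diameter K * (\<Sum>e\<in>boundary_segments K ({A, B, C} \<union> M). edge_ip e \<gamma> \<gamma>)"
  have "x0 \<in> interior (cball x0 r)" using ball by simp
  then have "x0 \<in> S" using interior_mono[OF ball(1)] by blast
  then have hi: "hi > 0" using b(2)[of x0] b(3)[of x0] b(4) by linarith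
  have "w \<in> Hcurl S" using w by (simp add: has_tangential_trace_def)
  then have L2w: "L2 S w" by (auto simp: Hcurl_def has_weak_curl_def)
  have L2F: "L2 S ?F" using div by (simp add: has_weak_div_def)
  note i = L2_integrable_inner[OF L2w L2w] L2_integrable_inner[OF L2F L2w] L2_integrable_inner[OF L2F L2F]
  have lower: "lo * ip S w w \<le> ip S ?F w"
  proof -
    have "(LINT x|lebesgue_on S. lo * (w x \<bullet> w x)) \<le> (LINT x|lebesgue_on S. ?F x \<bullet> w x)"
      using i b(2) by (intro integral_mono) (auto intro: mult_right_mono)
    then show ?thesis by (simp add: ip_def)
  qed
  have upper: "ip S ?F ?F \<le> hi\<^sup>2 * ip S w w"
  proof -
    have "(LINT x|lebesgue_on S. ?F x \<bullet> ?F x) \<le> (LINT x|lebesgue_on S. hi\<^sup>2 * (w x \<bullet> w x))"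
    proof (rule integral_mono)
      fix x assume "x \<in> space (lebesgue_on S)"
      then have "0 \<le> b x" "b x \<le> hi" using b(2)[of x] b(3)[of x] b(4) by auto
      then have "(b x)\<^sup>2 \<le> hi\<^sup>2" by (intro power_mono)
      then show "?F x \<bullet> ?F x \<le> hi\<^sup>2 * (w x \<bullet> w x)"
        using mult_right_mono[of "(b x)\<^sup>2" "hi\<^sup>2" "w x \<bullet> w x"] by (simp add: power2_eq_square mult.assoc)
    qed (use i in auto)
    then show ?thesis by (simp add: ip_def)
  qed
  define a where "a = 40 * hi\<^sup>2 / lo"
  have a: "a > 0" using hi b(4) by (simp add: a_def)
  have "lo * ip S w w \<le> a * ?Q + 20 / a * ip S ?F ?F"
    using lower divergence_free_pairing[OF M w ball diam div a] by linarith
  also have "20 / a * ip S ?F ?F \<le> 20 / a * (hi\<^sup>2 * ip S w w)"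
    using upper a by (intro mult_left_mono) auto
  also have "20 / a * (hi\<^sup>2 * ip S w w) = lo / 2 * ip S w w" using hi b(4) by (simp add: a_def)
  finally have "lo / 2 * ip S w w \<le> a * ?Q" by simp
  then have "2 / lo * (lo / 2 * ip S w w) \<le> 2 / lo * (a * ?Q)" using b(4) by (intro mult_left_mono) auto
  then show ?thesis using b(4) by (simp add: a_def power2_eq_square)
qed

end

section \<open>Traces and weak derivatives of differences\<close>

lemma has_weak_curl_cong_AE:
  assumes D: "D \<in> sets lebesgue" "bounded D" and v: "has_weak_curl D v c" and ae: "AE x in lebesgue_on D. v x = v' x"
  shows "has_weak_curl D v' c"
proof -
  have L: "L2 D v" "L2 D v'" using v L2_cong_AE[OF _ ae D(1)] by (auto simp: has_weak_curl_def)
  have "ip D v' (\<lambda>x. rotate (g x)) = ip D v (\<lambda>x. rotate (g x))" if "C1_with_gradient \<phi> g" for \<phi> g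
    using ae by (intro ip_cong_AE L L2_test_function(2)[OF that D]) (auto elim: eventually_mono)
  then show ?thesis using v L unfolding has_weak_curl_def by metis
qed

lemma has_weak_div_cong_AE:
  assumes D: "D \<in> sets lebesgue" "bounded D" and v: "has_weak_div D v c" and ae: "AE x in lebesgue_on D. v x = v' x"
  shows "has_weak_div D v' c"
proof -
  have L: "L2 D v" "L2 D v'" using v L2_cong_AE[OF _ ae D(1)] by (auto simp: has_weak_div_def)
  have "ip D v' g = ip D v g" if "C1_with_gradient \<phi> g" for \<phi> g
    using ae by (intro ip_cong_AE L L2_test_function(3)[OF that D]) (auto elim: eventually_mono)
  then show ?thesis using v L unfolding has_weak_div_def by metis
qed

lemma has_weak_div_diff_zero:
  assumes D: "D \<in> sets lebesgue" "bounded D" and v: "has_weak_div D v (\<lambda>_. 0)" and w: "has_weak_div D w (\<lambda>_. 0)"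
  shows "has_weak_div D (\<lambda>x. v x - w x) (\<lambda>_. 0)"
proof -
  have L: "L2 D v" "L2 D w" "L2 D (\<lambda>_. 0 :: real)" using v w by (auto simp: has_weak_div_def)
  have "ip D (\<lambda>_. 0) \<phi> = - ip D (\<lambda>x. v x - w x) g" if t: "C1_with_gradient \<phi> g" "compact_support_in D \<phi>" for \<phi> g
  proof -
    have "ip D (\<lambda>_. 0) \<phi> = - ip D v g" "ip D (\<lambda>_. 0) \<phi> = - ip D w g"
      using v w t unfolding has_weak_div_def by blast+
    then show ?thesis
      using ip_diff_left[OF L(1,2) L2_test_function(3)[OF t(1) D]] by (simp add: ip_def)
  qed
  then show ?thesis using L2_diff[OF L(1,2)] L(3) unfolding has_weak_div_def by blast
qed

lemma weighted_ip_lower: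
  assumes f: "L2 D f" and m: "m \<in> borel_measurable (lebesgue_on D)" and D: "D \<in> sets lebesgue"
    and b: "\<And>x. lo \<le> m x" "\<And>x. m x \<le> hi" and lo: "0 < lo"
  shows "lo * ip D f f \<le> ip D (\<lambda>x. m x *\<^sub>R f x) f"
proof -
  have "L2 D (\<lambda>x. m x *\<^sub>R f x)"
  proof (rule L2_bounded_mult[OF f m _ D])
    show "\<bar>m x\<bar> \<le> hi" for x using b(1)[of x] b(2)[of x] lo by simp
  qed
  then have "integrable (lebesgue_on D) (\<lambda>x. (m x *\<^sub>R f x) \<bullet> f x)" by (rule L2_integrable_inner[OF _ f])
  then have "(LINT x|lebesgue_on D. lo * (f x \<bullet> f x)) \<le> (LINT x|lebesgue_on D. (m x *\<^sub>R f x) \<bullet> f x)"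
    using L2_integrable_inner[OF f f] b(1) by (intro integral_mono) (auto intro: mult_right_mono)
  then show ?thesis by (simp add: ip_def)
qed

lemma ip_sum_le:
  assumes f: "L2 D f" and g: "L2 D g"
  shows "ip D f f \<le> 2 * ip D g g + 2 * ip D (\<lambda>x. f x - g x) (\<lambda>x. f x - g x)"
proof -
  note d = L2_diff[OF f g]
  note i = L2_integrable_inner[OF f f] L2_integrable_inner[OF g g] L2_integrable_inner[OF d d]
  have "(LINT x|lebesgue_on D. f x \<bullet> f x) \<le>
      (LINT x|lebesgue_on D. 2 * (g x \<bullet> g x) + 2 * ((f x - g x) \<bullet> (f x - g x)))"
  proof (rule integral_mono)
    fix x
    have "0 \<le> (2 *\<^sub>R g x - f x) \<bullet> (2 *\<^sub>R g x - f x)" by simp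
    then show "f x \<bullet> f x \<le> 2 * (g x \<bullet> g x) + 2 * ((f x - g x) \<bullet> (f x - g x))"
      by (simp add: inner_diff_left inner_diff_right inner_commute algebra_simps)
  qed (use i in auto)
  then show ?thesis using i by (simp add: ip_def)
qed

context triangle
begin

lemma has_tangential_trace_cong_AE:
  assumes v: "has_tangential_trace K E v \<gamma>" and ae: "AE x in lebesgue_on S. v x = v' x"
  shows "has_tangential_trace K E v' \<gamma>"
proof -
  have wc: "has_weak_curl S v (weak_curl S v)"
    using v by (intro has_weak_curl_weak_curl) (simp add: has_tangential_trace_def)
  have wc': "has_weak_curl S v' (weak_curl S v)" by (rule has_weak_curl_cong_AE[OF S_facts(4,3) wc ae])
  then have H: "v' \<in> Hcurl S" unfolding Hcurl_def by blast
  note wc'' = has_weak_curl_weak_curl[OF H]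
  have L: "L2 S v" "L2 S v'" "L2 S (weak_curl S v)" "L2 S (weak_curl S v')"
    using wc wc' wc'' by (auto simp: has_weak_curl_def)
  have ac: "AE x in lebesgue_on S. weak_curl S v x = weak_curl S v' x"
    by (rule weak_curl_unique[OF S_facts(1,3,2) wc' wc''])
  have "ip S (weak_curl S v) \<phi> - ip S v (\<lambda>x. rotate (g x)) = ip S (weak_curl S v') \<phi> - ip S v' (\<lambda>x. rotate (g x))"
    if "C1_with_gradient \<phi> g" for \<phi> g
    using ip_cong_AE[OF L(3,4) L2_test_function(1)[OF that S_facts(4,3)] L2_test_function(1)[OF that S_facts(4,3)] ac]
      ip_cong_AE[OF L(1,2) L2_test_function(2)[OF that S_facts(4,3)] L2_test_function(2)[OF that S_facts(4,3)] ae]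
    by simp
  then show ?thesis using v H unfolding has_tangential_trace_def by metis
qed

lemma has_tangential_trace_diff:
  assumes v: "has_tangential_trace K E v \<gamma>" and w: "has_tangential_trace K E w \<delta>"
  shows "has_tangential_trace K E (\<lambda>x. v x - w x) (\<lambda>x. \<gamma> x - \<delta> x)"
    "AE x in lebesgue_on S. weak_curl S (\<lambda>x. v x - w x) x = weak_curl S v x - weak_curl S w x"
proof -
  have wv: "has_weak_curl S v (weak_curl S v)" and ww: "has_weak_curl S w (weak_curl S w)"
    using v w by (auto intro!: has_weak_curl_weak_curl simp: has_tangential_trace_def)
  note wd = has_weak_curl_diff[OF S_facts(4,3) wv ww]
  then have H: "(\<lambda>x. v x - w x) \<in> Hcurl S" unfolding Hcurl_def by blast
  note wd' = has_weak_curl_weak_curl[OF H]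
  have L: "L2 S v" "L2 S w" "L2 S (weak_curl S v)" "L2 S (weak_curl S w)" "L2 S (weak_curl S (\<lambda>x. v x - w x))"
    using wv ww wd' by (auto simp: has_weak_curl_def)
  show ac: "AE x in lebesgue_on S. weak_curl S (\<lambda>x. v x - w x) x = weak_curl S v x - weak_curl S w x"
    by (rule weak_curl_unique[OF S_facts(1,3,2) wd' wd])
  have Le: "L2 {0..1} (\<lambda>s. \<gamma> (edge_point e s))" "L2 {0..1} (\<lambda>s. \<delta> (edge_point e s))" if "e \<in> E" for e
    using v w that by (auto simp: has_tangential_trace_def)
  show "has_tangential_trace K E (\<lambda>x. v x - w x) (\<lambda>x. \<gamma> x - \<delta> x)"
    unfolding has_tangential_trace_def
  proof (intro conjI ballI allI impI H)
    show "L2 {0..1} (\<lambda>s. \<gamma> (edge_point e s) - \<delta> (edge_point e s))" if "e \<in> E" for e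
      by (rule L2_diff[OF Le[OF that]])
    fix \<phi> g assume C1: "C1_with_gradient \<phi> g"
    note t = L2_test_function[OF C1 S_facts(4,3)]
    have L\<phi>: "L2 {0..1} (\<lambda>s. \<phi> (edge_point e s))" for e
      unfolding edge_point_def by (rule L2_continuous[OF continuous_on_seg[OF C1_with_gradientD(1)[OF C1]]]) auto
    have "(\<Sum>e\<in>E. edge_ip e (\<lambda>x. \<gamma> x - \<delta> x) \<phi>) = (\<Sum>e\<in>E. edge_ip e \<gamma> \<phi> - edge_ip e \<delta> \<phi>)"
    proof (rule sum.cong[OF refl])
      fix e assume "e \<in> E"
      then show "edge_ip e (\<lambda>x. \<gamma> x - \<delta> x) \<phi> = edge_ip e \<gamma> \<phi> - edge_ip e \<delta> \<phi>"
        unfolding edge_ip_def using ip_diff_left[OF Le L\<phi>] by (simp add: right_diff_distrib)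
    qed
    also have "\<dots> = (ip S (weak_curl S v) \<phi> - ip S v (\<lambda>x. rotate (g x))) - (ip S (weak_curl S w) \<phi> - ip S w (\<lambda>x. rotate (g x)))"
      using v w C1 unfolding has_tangential_trace_def sum_subtractf by metis
    also have "\<dots> = ip S (\<lambda>x. weak_curl S v x - weak_curl S w x) \<phi> - ip S (\<lambda>x. v x - w x) (\<lambda>x. rotate (g x))"
      using ip_diff_left[OF L(3,4) t(1)] ip_diff_left[OF L(1,2) t(2)] by simp
    also have "ip S (\<lambda>x. weak_curl S v x - weak_curl S w x) \<phi> = ip S (weak_curl S (\<lambda>x. v x - w x)) \<phi>"
      using ac by (intro ip_cong_AE L2_diff L t(1)) (auto elim: eventually_mono)
    finally show "(\<Sum>e\<in>E. edge_ip e (\<lambda>x. \<gamma> x - \<delta> x) \<phi>) =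
      ip S (weak_curl S (\<lambda>x. v x - w x)) \<phi> - ip S (\<lambda>x. v x - w x) (\<lambda>x. rotate (g x))" .
  qed
qed

end

section \<open>Interface elements\<close>

lemma orthogonal_to_same_imp_parallel:
  fixes u :: plane
  assumes "a \<bullet> u = 0" "n \<bullet> u = 0" "u \<noteq> 0" "n \<noteq> 0"
  obtains t where "a = t *\<^sub>R n"
proof -
  have e: "a $ 1 * u $ 1 = - (a $ 2 * u $ 2)" "n $ 1 * u $ 1 = - (n $ 2 * u $ 2)"
    using assms(1,2) by (auto simp: inner_plane)
  have "u $ 1 * cross2 a n = (a $ 1 * u $ 1) * n $ 2 - a $ 2 * (n $ 1 * u $ 1)" by (simp add: cross2_def algebra_simps)
  also have "\<dots> = 0" unfolding e by simp
  finally have 1: "u $ 1 * cross2 a n = 0" .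
  have "u $ 2 * cross2 a n = a $ 1 * (n $ 2 * u $ 2) - (a $ 2 * u $ 2) * n $ 1" by (simp add: cross2_def algebra_simps)
  also have "\<dots> = 0"
  proof -
    have e2: "a $ 2 * u $ 2 = - (a $ 1 * u $ 1)" "n $ 2 * u $ 2 = - (n $ 1 * u $ 1)" using e by simp_all
    show ?thesis unfolding e2 by (simp add: algebra_simps)
  qed
  finally have "u $ 2 * cross2 a n = 0" .
  with 1 have "cross2 a n = 0" using assms(3) by (auto simp: vec2_eq_iff)
  then show ?thesis using assms(4) that by (rule cross2_eq_0_imp_parallel)
qed

lemma GDERIV_affine: "GDERIV (\<lambda>x. c + g \<bullet> x) x :> g"
  unfolding gderiv_def by (auto intro!: derivative_eq_intros simp: inner_commute)

lemma GDERIV_cong_open: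
  assumes "GDERIV f x :> g" "open U" "x \<in> U" "\<And>y. y \<in> U \<Longrightarrow> f y = f' y"
  shows "GDERIV f' x :> g"
  using assms unfolding gderiv_def by (rule has_derivative_transform_within_open) 

lemma GDERIV_unique_inner: "GDERIV f x :> g \<Longrightarrow> GDERIV f x :> g' \<Longrightarrow> g = g'"
proof -
  assume "GDERIV f x :> g" "GDERIV f x :> g'"
  then have "(\<lambda>h. h \<bullet> g) = (\<lambda>h. h \<bullet> g')" unfolding gderiv_def by (rule has_derivative_unique)
  then have "(g - g') \<bullet> g = (g - g') \<bullet> g'" by (rule fun_cong)
  then have "(g - g') \<bullet> (g - g') = 0" by (simp add: inner_diff_right)
  then show ?thesis by simp
qed

text \<open>The data of a cut triangle: the cut is a level line of the unit normal \<open>n\<close>.\<close>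

locale cut_triangle = triangle +
  fixes P :: interface_problem and n :: plane and c :: real and b1 b2 :: plane
  assumes interface: "interface_element P K"
    and n_def: "n = nbar P K" and norm_n: "norm n = 1"
    and b12: "b1 \<noteq> b2" and cut: "cut_points P K = {b1, b2}"
    and level: "\<And>y. y \<in> Gamma_h P K \<Longrightarrow> n \<bullet> y = c"
    and beta_pos: "beta_p P > 0" "beta_m P > 0" and alpha_pos: "alpha_p P > 0" "alpha_m P > 0"
    and extreme: "{a. a extreme_point_of K} = {A, B, C}"
begin

lemma b_in_Gamma_h: "b1 \<in> Gamma_h P K" "b2 \<in> Gamma_h P K"
  by (auto simp: Gamma_h_def cut hull_inc)

lemma K_hp_eq: "K_hp P K = {x \<in> S. c < n \<bullet> x}"
  using b_in_Gamma_h level unfolding K_hp_def n_def[symmetric] by (auto simp: inner_diff_right)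

lemma K_hm_eq: "K_hm P K = {x \<in> S. n \<bullet> x < c}"
  using b_in_Gamma_h level unfolding K_hm_def n_def[symmetric] by (auto simp: inner_diff_right)

lemma open_K_hpm: "open (K_hp P K)" "open (K_hm P K)"
proof -
  have "open (S \<inter> {x. c < n \<bullet> x})" "open (S \<inter> {x. n \<bullet> x < c})"
    by (intro open_Int open_interior open_Collect_less continuous_intros)+
  then show "open (K_hp P K)" "open (K_hm P K)" by (simp_all add: K_hp_eq K_hm_eq Int_def)
qed

lemma n_nonzero: "n \<noteq> 0" using norm_n by auto

lemma n_n: "n \<bullet> n = 1" using norm_n by (simp add: dot_square_norm)

lemma normal_tangential_decomposition: "p = (p \<bullet> n) *\<^sub>R n + (p \<bullet> rotate n) *\<^sub>R rotate n"
proof -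
  have "p $ 1 * (n $ 1 * n $ 1 + n $ 2 * n $ 2) = p $ 1" "p $ 2 * (n $ 1 * n $ 1 + n $ 2 * n $ 2) = p $ 2"
    using n_n by (simp_all add: inner_plane)
  then show ?thesis by (simp add: vec2_eq_iff inner_plane algebra_simps)
qed

lemma AE_off_cut: "AE x in lebesgue_on S. x \<in> K_hp P K \<union> K_hm P K"
proof -
  have "negligible {x. n \<bullet> x = c}" using n_nonzero by (simp add: negligible_hyperplane)
  then have "AE x in lebesgue. x \<notin> {x. n \<bullet> x = c}"
    by (intro AE_not_in) (simp add: negligible_iff_null_sets)
  then have "AE x in lebesgue. x \<in> S \<longrightarrow> x \<in> K_hp P K \<union> K_hm P K"
    by (rule eventually_mono) (auto simp: K_hp_eq K_hm_eq)
  then show ?thesis using S_facts(4) by (subst AE_restrict_space_iff) auto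
qed

text \<open>Continuity along the cut forces the jump of the gradient to be normal to it.\<close>

lemma grad_Sn_local_ridge:
  assumes w: "w \<in> grad_Sn_local P K"
  obtains p \<kappa> where "AE x in lebesgue_on S. w x = ridge_field p \<kappa> n c x"
    "beta_p P * ((p + \<kappa> *\<^sub>R n) \<bullet> n) = beta_m P * (p \<bullet> n)"
proof -
  obtain v where v: "v \<in> Sn_local P K" and gd: "\<And>x. x \<in> K_hp P K \<union> K_hm P K \<Longrightarrow> GDERIV v x :> w x"
    using w by (auto simp: grad_Sn_local_def)
  from v obtain cp gp cm gm where vp: "\<forall>x\<in>K_hp P K. v x = cp + gp \<bullet> x" and vm: "\<forall>x\<in>K_hm P K. v x = cm + gm \<bullet> x"
    and jump: "\<forall>x\<in>Gamma_h P K. cp + gp \<bullet> x = cm + gm \<bullet> x"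
    and flux: "beta_p P * (gp \<bullet> nbar P K) = beta_m P * (gm \<bullet> nbar P K)"
    unfolding Sn_local_def by blast
  have wp: "w x = gp" if "x \<in> K_hp P K" for x
  proof (rule GDERIV_unique_inner[OF gd])
    show "GDERIV v x :> gp"
      by (rule GDERIV_cong_open[OF GDERIV_affine[of cp gp x] open_K_hpm(1) that]) (use vp in simp)
  qed (use that in simp)
  have wm: "w x = gm" if "x \<in> K_hm P K" for x
  proof (rule GDERIV_unique_inner[OF gd])
    show "GDERIV v x :> gm"
      by (rule GDERIV_cong_open[OF GDERIV_affine[of cm gm x] open_K_hpm(2) that]) (use vm in simp)
  qed (use that in simp)
  have "cp + gp \<bullet> b1 = cm + gm \<bullet> b1" "cp + gp \<bullet> b2 = cm + gm \<bullet> b2" using jump b_in_Gamma_h by auto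
  then have "(gp - gm) \<bullet> (b1 - b2) = 0" by (simp add: inner_diff_left inner_diff_right)
  moreover have "n \<bullet> (b1 - b2) = 0" using level b_in_Gamma_h by (simp add: inner_diff_right)
  ultimately obtain \<kappa> where \<kappa>: "gp - gm = \<kappa> *\<^sub>R n"
    using b12 n_nonzero orthogonal_to_same_imp_parallel[of "gp - gm" "b1 - b2" n] by auto
  then have gp: "gp = gm + \<kappa> *\<^sub>R n" by (simp add: algebra_simps)
  show ?thesis
  proof (rule that[of gm \<kappa>])
    show "AE x in lebesgue_on S. w x = ridge_field gm \<kappa> n c x"
      using AE_off_cut
    proof eventually_elim
      case (elim x)
      then show ?case using wp[of x] wm[of x] by (auto simp: K_hp_eq K_hm_eq ridge_field_def gp)
    qed
    show "beta_p P * ((gm + \<kappa> *\<^sub>R n) \<bullet> n) = beta_m P * (gm \<bullet> n)"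
      using flux by (simp add: gp n_def)
  qed
qed

lemma ridge_in_grad_Sn_local:
  assumes flux: "beta_p P * ((p + \<kappa> *\<^sub>R n) \<bullet> n) = beta_m P * (p \<bullet> n)"
  shows "ridge_field p \<kappa> n c \<in> grad_Sn_local P K"
proof -
  define v where "v x = p \<bullet> x + \<kappa> * max 0 (n \<bullet> x - c)" for x
  have vp: "v x = - (\<kappa> * c) + (p + \<kappa> *\<^sub>R n) \<bullet> x" if "c \<le> n \<bullet> x" for x
    using that by (simp add: v_def inner_add_left algebra_simps)
  have vm: "v x = 0 + p \<bullet> x" if "n \<bullet> x \<le> c" for x
    using that by (simp add: v_def)
  have "v \<in> Sn_local P K"
    unfolding Sn_local_def
  proof (intro CollectI exI conjI ballI)
    show "v x = - (\<kappa> * c) + (p + \<kappa> *\<^sub>R n) \<bullet> x" if "x \<in> K_hp P K" for x using that vp by (simp add: K_hp_eq)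
    show "v x = 0 + p \<bullet> x" if "x \<in> K_hm P K" for x using that vm by (simp add: K_hm_eq)
    show "- (\<kappa> * c) + (p + \<kappa> *\<^sub>R n) \<bullet> x = 0 + p \<bullet> x" if "x \<in> Gamma_h P K" for x
      using level[OF that] by (simp add: inner_add_left)
    show "beta_p P * ((p + \<kappa> *\<^sub>R n) \<bullet> nbar P K) = beta_m P * (p \<bullet> nbar P K)"
      using flux by (simp add: n_def)
  qed
  moreover have "GDERIV v x :> ridge_field p \<kappa> n c x" if x: "x \<in> K_hp P K \<union> K_hm P K" for x
  proof (cases "x \<in> K_hp P K")
    case True
    have "GDERIV v x :> p + \<kappa> *\<^sub>R n"
      by (rule GDERIV_cong_open[OF GDERIV_affine[of "- (\<kappa> * c)" "p + \<kappa> *\<^sub>R n" x] open_K_hpm(1) True])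
        (use vp in \<open>simp add: K_hp_eq\<close>)
    then show ?thesis using True by (simp add: K_hp_eq ridge_field_def)
  next
    case False
    then have m: "x \<in> K_hm P K" using x by simp
    have "GDERIV v x :> p"
      by (rule GDERIV_cong_open[OF GDERIV_affine[of 0 p x] open_K_hpm(2) m]) (use vm in \<open>simp add: K_hm_eq\<close>)
    then show ?thesis using m by (simp add: K_hm_eq ridge_field_def)
  qed
  ultimately show ?thesis unfolding grad_Sn_local_def by blast
qed

lemma coeff_h_cut: "x \<in> S \<Longrightarrow> coeff_h P cp cm K x = (if c < n \<bullet> x then cp else cm)"
  using interface by (simp add: coeff_h_def K_hp_eq)

text \<open>The fields in the range of the projection are spanned by the constant tangent field and a
  piecewise constant normal field, which are pointwise orthogonal. Hence the weighted projection
  exists and is given by two Fourier coefficients.\<close>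

lemma proj_in_grad_Sn_local:
  assumes u: "L2 S u"
  shows "proj P K u \<in> grad_Sn_local P K"
proof -
  define b where "b x = (if c < n \<bullet> x then beta_p P else beta_m P)" for x
  define q where "q x = (if c < n \<bullet> x then beta_m P else beta_p P)" for x
  have bS: "beta_h P K x = b x" if "x \<in> S" for x
    using coeff_h_cut[OF that] by (simp add: beta_h_def b_def)
  have [measurable]: "Measurable.pred borel (\<lambda>x. c < n \<bullet> x)" using half_plane_borel[of c n] by (simp add: pred_def)
  have bm[measurable]: "b \<in> borel_measurable borel" "q \<in> borel_measurable borel"
    unfolding b_def[abs_def] q_def[abs_def] by measurable
  let ?t = "rotate n"
  have tn: "?t \<bullet> n = 0" "?t \<bullet> ?t = 1" "n \<bullet> ?t = 0" using n_n by (auto simp: inner_plane)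
  define hi where "hi = max (beta_p P) (beta_m P)"
  have bnd: "\<bar>b x\<bar> \<le> hi" "\<bar>q x\<bar> \<le> hi" for x using beta_pos by (auto simp: b_def q_def hi_def)
  have L2r: "L2 S f" if "f \<in> borel_measurable borel" "\<And>x. \<bar>f x\<bar> \<le> h" for f :: "plane \<Rightarrow> real" and h
    using that by (intro L2_bounded[OF borel_imp_lebesgue_on _ S_facts(4,3)]) auto
  have ib: "integrable (lebesgue_on S) b" and ibq: "integrable (lebesgue_on S) (\<lambda>x. b x * (q x)\<^sup>2)"
  proof -
    have one: "L2 S (\<lambda>_. 1 :: real)" by (rule L2_continuous[OF continuous_on_const S_facts(4,3)])
    show "integrable (lebesgue_on S) b" using L2_integrable_inner[OF L2r[OF bm(1) bnd(1)] one] by simp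
    have "L2 S (\<lambda>x. b x * q x)"
    proof (rule L2r)
      show "\<bar>b x * q x\<bar> \<le> hi * hi" for x unfolding abs_mult using bnd by (intro mult_mono) (auto intro: order_trans[OF abs_ge_zero])
    qed measurable
    from L2_integrable_inner[OF this L2r[OF bm(2) bnd(2)]]
    show "integrable (lebesgue_on S) (\<lambda>x. b x * (q x)\<^sup>2)" by (simp add: power2_eq_square mult.assoc)
  qed
  define I1 where "I1 = (LINT x|lebesgue_on S. b x)"
  define I2 where "I2 = (LINT x|lebesgue_on S. b x * (q x)\<^sup>2)"
  have pos: "(LINT x|lebesgue_on S. f x) \<noteq> 0" if "integrable (lebesgue_on S) f" "\<And>x. f x > 0" for f :: scalar_field
  proof
    assume "(LINT x|lebesgue_on S. f x) = 0"
    moreover have "AE x in lebesgue_on S. 0 \<le> f x" by (rule AE_I2) (simp add: that(2) less_imp_le)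
    ultimately have "AE x in lebesgue_on S. f x = 0"
      using integral_nonneg_eq_0_iff_AE[OF that(1)] by blast
    then have "AE x in lebesgue_on S. False" by (rule eventually_mono) (metis that(2) less_irrefl)
    then have "AE x in lebesgue. x \<notin> S" using S_facts(4) by (subst (asm) AE_restrict_space_iff) auto
    then have "S \<in> null_sets lebesgue" using S_facts(4) by (subst (asm) AE_iff_null_sets[symmetric]) auto
    then have "S = {}" using open_not_negligible[OF S_facts(1)] by (auto simp: negligible_iff_null_sets)
    moreover have "measure lebesgue (K \<inter> Omega_p P) > 0" using interface by (simp add: interface_element_def)
    then have "\<not> negligible K"
      using negligible_subset[of K "K \<inter> Omega_p P"] by (auto simp: negligible_imp_measure0)
    moreover have "K \<subseteq> frontier K \<union> S" using K_compact by (auto simp: frontier_def compact_imp_closed)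
    ultimately show False using negligible_frontier_K negligible_subset by auto
  qed
  have I: "I1 \<noteq> 0" "I2 \<noteq> 0"
    unfolding I1_def I2_def by (rule pos[OF ib], use beta_pos in \<open>simp add: b_def\<close>)
      (rule pos[OF ibq], use beta_pos in \<open>simp add: b_def q_def\<close>)
  have Lbu: "L2 S (\<lambda>x. b x *\<^sub>R u x)"
    by (rule L2_bounded_mult[OF u borel_imp_lebesgue_on[OF bm(1)] bnd(1) S_facts(4)])
  have Lbqu: "L2 S (\<lambda>x. (b x * q x) *\<^sub>R u x)"
  proof -
    have "L2 S (\<lambda>x. q x *\<^sub>R (b x *\<^sub>R u x))"
      by (rule L2_bounded_mult[OF Lbu borel_imp_lebesgue_on[OF bm(2)] bnd(2) S_facts(4)])
    then show ?thesis by (simp add: mult.commute)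
  qed
  \<comment> \<open>The Fourier coefficients of \<open>u\<close> with respect to the tangent field and the normal field \<open>q n\<close>.\<close>
  define a1 where "a1 = ip S (\<lambda>x. b x *\<^sub>R u x) (\<lambda>_. ?t) / I1"
  define a2 where "a2 = ip S (\<lambda>x. (b x * q x) *\<^sub>R u x) (\<lambda>_. n) / I2"
  define w where "w = ridge_field (a1 *\<^sub>R ?t + (a2 * beta_p P) *\<^sub>R n) (a2 * (beta_m P - beta_p P)) n c"
  have w: "w x = a1 *\<^sub>R ?t + (a2 * q x) *\<^sub>R n" for x
    by (simp add: w_def ridge_field_def q_def algebra_simps flip: scaleR_add_left)
  have wg: "w \<in> grad_Sn_local P K"
    unfolding w_def by (rule ridge_in_grad_Sn_local) (simp add: inner_add_left tn n_n algebra_simps)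
  have orth: "ip S (\<lambda>x. beta_h P K x *\<^sub>R w x) z = ip S (\<lambda>x. beta_h P K x *\<^sub>R u x) z"
    if z: "z \<in> grad_Sn_local P K" for z
  proof -
    obtain p \<kappa> where zr: "AE x in lebesgue_on S. z x = ridge_field p \<kappa> n c x"
      and flux: "beta_p P * ((p + \<kappa> *\<^sub>R n) \<bullet> n) = beta_m P * (p \<bullet> n)"
      using grad_Sn_local_ridge[OF z] by metis
    define s1 where "s1 = p \<bullet> ?t"
    define s2 where "s2 = (p \<bullet> n) / beta_p P"
    have p: "p = s1 *\<^sub>R ?t + (s2 * beta_p P) *\<^sub>R n"
      using normal_tangential_decomposition[of p] beta_pos by (simp add: s1_def s2_def add.commute)
    have "beta_p P * ((p \<bullet> n) + \<kappa>) = beta_m P * (p \<bullet> n)" using flux by (simp add: inner_add_left n_n)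
    then have k: "\<kappa> = s2 * (beta_m P - beta_p P)" using beta_pos by (simp add: s2_def field_simps)
    have zS: "AE x in lebesgue_on S. z x = s1 *\<^sub>R ?t + (s2 * q x) *\<^sub>R n \<and> beta_h P K x = b x"
    proof -
      have "AE x in lebesgue_on S. x \<in> S" by (rule AE_I2) simp
      with zr show ?thesis
      proof eventually_elim
        case (elim x)
        have "ridge_field p \<kappa> n c x = s1 *\<^sub>R ?t + (s2 * q x) *\<^sub>R n"
          unfolding k by (subst p) (simp add: ridge_field_def q_def algebra_simps flip: scaleR_add_left)
        then show ?case using elim bS by simp
      qed
    qed
    have zL: "L2 S z"
    proof (rule L2_cong_AE[OF L2_ridge_field(1)[OF S_facts(4,3)] _ S_facts(4)])
      show "AE x in lebesgue_on S. ridge_field p \<kappa> n c x = z x" using zr by eventually_elim simp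
    qed
    have bhm: "beta_h P K \<in> borel_measurable (lebesgue_on S)"
      by (rule borel_measurable_lebesgue_on_cong_AE[OF borel_imp_lebesgue_on[OF bm(1)] _ S_facts(4)])
        (rule AE_I2, simp add: bS)
    have bhb: "\<bar>beta_h P K x\<bar> \<le> hi" if "x \<in> S" for x using bS[OF that] bnd by simp
    have wL: "L2 S w" unfolding w_def by (rule L2_ridge_field(1)[OF S_facts(4,3)])
    have Lw: "L2 S (\<lambda>x. beta_h P K x *\<^sub>R w x)"
      by (rule L2_bounded_mult[OF wL bhm bhb S_facts(4)])
    have Lu: "L2 S (\<lambda>x. beta_h P K x *\<^sub>R u x)"
      by (rule L2_bounded_mult[OF u bhm bhb S_facts(4)])
    have tL: "L2 S (\<lambda>_. ?t)" and nL: "L2 S (\<lambda>_. n)"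
      by (rule L2_continuous[OF continuous_on_const S_facts(4,3)])+
    have "ip S (\<lambda>x. beta_h P K x *\<^sub>R w x) z = (LINT x|lebesgue_on S. a1 * s1 * b x + a2 * s2 * (b x * (q x)\<^sup>2))"
      unfolding ip_def
    proof (rule integral_cong_AE)
      show "AE x in lebesgue_on S. beta_h P K x *\<^sub>R w x \<bullet> z x = a1 * s1 * b x + a2 * s2 * (b x * (q x)\<^sup>2)"
        using zS
      proof eventually_elim
        case (elim x)
        then show ?case
          by (simp add: w inner_add_left inner_add_right tn n_n power2_eq_square algebra_simps)
      qed
    qed (use L2_integrable_inner[OF Lw zL] ib ibq in \<open>auto dest: borel_measurable_integrable\<close>)
    also have "\<dots> = a1 * s1 * I1 + a2 * s2 * I2" using ib ibq by (simp add: I1_def I2_def)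
    also have "\<dots> = s1 * ip S (\<lambda>x. b x *\<^sub>R u x) (\<lambda>_. ?t) + s2 * ip S (\<lambda>x. (b x * q x) *\<^sub>R u x) (\<lambda>_. n)"
      using I by (simp add: a1_def a2_def)
    also have "\<dots> = (LINT x|lebesgue_on S. s1 * (b x *\<^sub>R u x \<bullet> ?t) + s2 * ((b x * q x) *\<^sub>R u x \<bullet> n))"
      using L2_integrable_inner[OF Lbu tL] L2_integrable_inner[OF Lbqu nL]
      by (simp add: ip_def del: inner_scaleR_left)
    also have "\<dots> = ip S (\<lambda>x. beta_h P K x *\<^sub>R u x) z"
      unfolding ip_def
    proof (rule integral_cong_AE)
      show "AE x in lebesgue_on S. s1 * (b x *\<^sub>R u x \<bullet> ?t) + s2 * ((b x * q x) *\<^sub>R u x \<bullet> n) = beta_h P K x *\<^sub>R u x \<bullet> z x"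
        using zS
      proof eventually_elim
        case (elim x)
        then show ?case by (simp add: inner_add_right algebra_simps)
      qed
    qed (use L2_integrable_inner[OF Lu zL] L2_integrable_inner[OF Lbu tL] L2_integrable_inner[OF Lbqu nL]
        in \<open>auto intro!: borel_measurable_add borel_measurable_times dest: borel_measurable_integrable simp del: inner_scaleR_left\<close>)
    finally show ?thesis .
  qed
  have "\<exists>w. w \<in> grad_Sn_local P K \<and> (\<forall>z\<in>grad_Sn_local P K.
      ip (interior K) (\<lambda>x. beta_h P K x *\<^sub>R w x) z = ip (interior K) (\<lambda>x. beta_h P K x *\<^sub>R u x) z)"
    using wg orth by blast
  from someI_ex[OF this] show ?thesis unfolding proj_def by blast
qed

text \<open>After weighting, the normal component is constant by the flux condition and only the tangential
  component jumps. So the weighted field is a rotated ridge field.\<close>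

lemma ridge_weighted_weak_div:
  assumes flux: "beta_p P * ((p + \<kappa> *\<^sub>R n) \<bullet> n) = beta_m P * (p \<bullet> n)"
  shows "has_weak_div S (\<lambda>x. beta_h P K x *\<^sub>R ridge_field p \<kappa> n c x) (\<lambda>_. 0)"
proof -
  let ?t = "rotate n"
  define N T where "N = beta_m P * (p \<bullet> n)" and "T = p \<bullet> ?t"
  have p: "p = (p \<bullet> n) *\<^sub>R n + T *\<^sub>R ?t"
    unfolding T_def by (rule normal_tangential_decomposition)
  have f: "beta_p P * (p \<bullet> n + \<kappa>) = N" using flux by (simp add: inner_add_left n_n N_def)
  let ?r = "ridge_field ((- N) *\<^sub>R ?t + (beta_m P * T) *\<^sub>R n) ((beta_p P - beta_m P) * T) n c"
  have rot: "rotate (x + y) = rotate x + rotate y" "rotate (x - y) = rotate x - rotate y" "rotate (s *\<^sub>R x) = s *\<^sub>R rotate x" "rotate ?t = - n" for x y s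
    by (simp_all add: vec2_eq_iff)
  have "rotate (?r x) = beta_h P K x *\<^sub>R ridge_field p \<kappa> n c x" if x: "x \<in> S" for x
  proof (cases "c < n \<bullet> x")
    case True
    have "rotate (?r x) = N *\<^sub>R n + (beta_p P * T) *\<^sub>R ?t"
      using True by (simp add: ridge_field_def rot algebra_simps)
    also have "\<dots> = beta_p P *\<^sub>R (((p \<bullet> n) *\<^sub>R n + T *\<^sub>R ?t) + \<kappa> *\<^sub>R n)"
      unfolding f[symmetric] by (simp add: algebra_simps)
    also have "\<dots> = beta_h P K x *\<^sub>R ridge_field p \<kappa> n c x"
      unfolding p[symmetric] using True coeff_h_cut[OF x] by (simp add: ridge_field_def beta_h_def)
    finally show ?thesis .
  next
    case False
    have "rotate (?r x) = beta_m P *\<^sub>R ((p \<bullet> n) *\<^sub>R n + T *\<^sub>R ?t)"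
      using False by (simp add: ridge_field_def rot N_def algebra_simps)
    also have "\<dots> = beta_h P K x *\<^sub>R ridge_field p \<kappa> n c x"
      unfolding p[symmetric] using False coeff_h_cut[OF x] by (simp add: ridge_field_def beta_h_def)
    finally show ?thesis .
  qed
  then have "AE x in lebesgue_on S. rotate (?r x) = beta_h P K x *\<^sub>R ridge_field p \<kappa> n c x"
    by (intro AE_I2) simp
  then show ?thesis by (rule has_weak_div_cong_AE[OF S_facts(4,3) ridge_field_weak_div])
qed

lemma edges_eq: "edges P K = boundary_segments K ({A, B, C} \<union> {b1, b2})"
  by (simp add: edges_def extreme cut)

lemma cut_points_on_frontier: "{b1, b2} \<subseteq> frontier K"
  using cut by (auto simp: cut_points_def)

lemma coeff_h_measurable: "coeff_h P cp cm K \<in> borel_measurable (lebesgue_on S)"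
proof (rule borel_measurable_lebesgue_on_cong_AE[OF _ _ S_facts(4)])
  have [measurable]: "Measurable.pred borel (\<lambda>x. c < n \<bullet> x)" using half_plane_borel[of c n] by (simp add: pred_def)
  show "(\<lambda>x. if c < n \<bullet> x then cp else cm :: real) \<in> borel_measurable (lebesgue_on S)"
    by (rule borel_imp_lebesgue_on) measurable
  show "AE x in lebesgue_on S. (if c < n \<bullet> x then cp else cm) = coeff_h P cp cm K x"
    by (rule AE_I2) (simp add: coeff_h_cut)
qed

text \<open>Both \<open>v\<close> and its projection are divergence free after weighting, and the projection is curl
  free, so the residual is controlled by the curl of \<open>v\<close> and the stabilisation.\<close>

lemma local_estimate:
  assumes v: "v \<in> Ve_local P K" and ball: "cball x0 r \<subseteq> K" "r > 0" and diam: "diameter K \<le> \<sigma> * r" "diameter K \<le> h"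
    and lo: "0 < lo" "lo \<le> beta_p P" "lo \<le> beta_m P" and hi: "beta_p P \<le> hi" "beta_m P \<le> hi"
    and al: "0 < al" "al \<le> alpha_p P" "al \<le> alpha_m P"
  shows "al * ip S (weak_curl S v) (weak_curl S v) \<le> a_local P K v v"
    "ip S v v \<le> (2 / lo + 160 * (hi / lo)\<^sup>2 * (h\<^sup>2 / al + \<bar>\<sigma>\<bar> * \<bar>h\<bar> / lo)) * a_local P K v v"
proof -
  let ?c = "weak_curl S v"
  let ?\<Pi> = "proj P K v"
  let ?w = "\<lambda>x. v x - ?\<Pi> x"
  let ?\<gamma> = "residual_trace P K v"
  have vH: "v \<in> Hcurl S" and vdiv: "has_weak_div S (\<lambda>x. beta_h P K x *\<^sub>R v x) (\<lambda>_. 0)"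
    using v by (auto simp: Ve_local_def)
  obtain \<gamma>v where \<gamma>v: "has_tangential_trace K (edges P K) v \<gamma>v" using v by (auto simp: Ve_local_def)
  note wcv = has_weak_curl_weak_curl[OF vH]
  have Lv: "L2 S v" and Lc: "L2 S ?c" using wcv by (auto simp: has_weak_curl_def)
  obtain p \<kappa> where \<Pi>: "AE x in lebesgue_on S. ?\<Pi> x = ridge_field p \<kappa> n c x"
    and flux: "beta_p P * ((p + \<kappa> *\<^sub>R n) \<bullet> n) = beta_m P * (p \<bullet> n)"
    using grad_Sn_local_ridge[OF proj_in_grad_Sn_local[OF Lv]] by metis
  let ?R = "ridge_field p \<kappa> n c"
  have LR: "L2 S ?R" by (rule L2_ridge_field(1)[OF S_facts(4,3)])
  have \<Pi>': "AE x in lebesgue_on S. ?R x = ?\<Pi> x" using \<Pi> by eventually_elim simp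
  have L\<Pi>: "L2 S ?\<Pi>" by (rule L2_cong_AE[OF LR \<Pi>' S_facts(4)])
  obtain \<delta> where \<delta>: "has_tangential_trace K (edges P K) ?R \<delta>"
    using ridge_field_has_trace[of "{b1, b2}" p \<kappa> n c] cut_points_on_frontier unfolding edges_eq by auto
  have "has_tangential_trace K (edges P K) ?\<Pi> \<delta>" by (rule has_tangential_trace_cong_AE[OF \<delta> \<Pi>'])
  note wt = has_tangential_trace_diff[OF \<gamma>v this]
  have tr: "has_tangential_trace K (edges P K) ?w ?\<gamma>"
    unfolding residual_trace_def tangential_trace_def by (rule someI[where P="has_tangential_trace K (edges P K) ?w", OF wt(1)])
  have "?w \<in> Hcurl S" using tr by (simp add: has_tangential_trace_def)
  note wcw = has_weak_curl_weak_curl[OF this]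
  have cw: "ip S (weak_curl S ?w) (weak_curl S ?w) = ip S ?c ?c"
  proof -
    have "has_weak_curl S (\<lambda>x. v x - ?R x) (\<lambda>x. ?c x - 0)"
      by (rule has_weak_curl_diff[OF S_facts(4,3) wcv ridge_field_weak_curl])
    then have "has_weak_curl S (\<lambda>x. v x - ?R x) ?c" by simp
    moreover have "AE x in lebesgue_on S. v x - ?R x = ?w x" using \<Pi>' by eventually_elim simp
    ultimately have "has_weak_curl S ?w ?c" by (rule has_weak_curl_cong_AE[OF S_facts(4,3)])
    from weak_curl_unique[OF S_facts(1,3,2) wcw this] have ae: "AE x in lebesgue_on S. weak_curl S ?w x = ?c x" .
    have "L2 S (weak_curl S ?w)" using wcw by (simp add: has_weak_curl_def)
    then show ?thesis by (intro ip_cong_AE Lc ae)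
  qed
  have div: "has_weak_div S (\<lambda>x. beta_h P K x *\<^sub>R ?w x) (\<lambda>_. 0)"
  proof (rule has_weak_div_cong_AE[OF S_facts(4,3) has_weak_div_diff_zero[OF S_facts(4,3) vdiv ridge_weighted_weak_div[OF flux]]])
    show "AE x in lebesgue_on S. beta_h P K x *\<^sub>R v x - beta_h P K x *\<^sub>R ?R x = beta_h P K x *\<^sub>R ?w x"
      using \<Pi>' by eventually_elim (simp add: scaleR_diff_right)
  qed
  have bb: "lo \<le> beta_h P K x" "beta_h P K x \<le> hi" for x
    using lo hi by (auto simp: beta_h_def coeff_h_def)
  have ab: "al \<le> alpha_h P K x" "alpha_h P K x \<le> max (alpha_p P) (alpha_m P)" for x
    using al by (auto simp: alpha_h_def coeff_h_def)
  have bm: "beta_h P K \<in> borel_measurable (lebesgue_on S)" "alpha_h P K \<in> borel_measurable (lebesgue_on S)"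
    unfolding beta_h_def alpha_h_def by (rule coeff_h_measurable)+
  define E where "E = (\<Sum>e\<in>edges P K. edge_ip e ?\<gamma> ?\<gamma>)"
  define X where "X = ip S ?c ?c"
  define Y where "Y = ip S ?\<Pi> ?\<Pi>"
  define a where "a = a_local P K v v"
  have nn: "E \<ge> 0" "X \<ge> 0" "Y \<ge> 0"
    unfolding E_def X_def Y_def by (auto intro!: sum_nonneg edge_ip_self_nonneg ip_self_nonneg)
  have t1: "al * X \<le> ip S (\<lambda>x. alpha_h P K x * ?c x) ?c"
    using weighted_ip_lower[OF Lc bm(2) S_facts(4) ab al(1)] by (simp add: X_def)
  have t2: "lo * Y \<le> ip S (\<lambda>x. beta_h P K x *\<^sub>R ?\<Pi> x) ?\<Pi>"
    using weighted_ip_lower[OF L\<Pi> bm(1) S_facts(4) bb lo(1)] by (simp add: Y_def)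
  have t3: "lo * E \<le> (\<Sum>e\<in>edges P K. beta_edge P K e * edge_ip e ?\<gamma> ?\<gamma>)"
    unfolding E_def sum_distrib_left using lo by (intro sum_mono mult_right_mono edge_ip_self_nonneg) (auto simp: beta_edge_def)
  have sum: "al * X + lo * Y + lo * E \<le> a"
    using t1 t2 t3 interface by (simp add: a_def a_local_def)
  have pr: "0 \<le> al * X" "0 \<le> lo * Y" "0 \<le> lo * E" using nn al lo by auto
  then have a: "al * X \<le> a" "lo * Y \<le> a" "lo * E \<le> a" "0 \<le> a" using sum by linarith+
  show "al * ip S ?c ?c \<le> a_local P K v v" using a(1) by (simp add: X_def a_def)
  have d0: "0 \<le> diameter K" using K_compact by (simp add: diameter_ge_0 compact_imp_bounded)
  have "ip S ?w ?w \<le> 80 * (hi / lo)\<^sup>2 * ((diameter K)\<^sup>2 * X + \<sigma> * diameter K * E)"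
    using curl_and_trace_control[of "{b1, b2}" ?w ?\<gamma> x0 r \<sigma> "beta_h P K" lo hi] cut_points_on_frontier tr ball diam(1) bm(1) bb lo(1) div
    unfolding cw edges_eq E_def X_def by auto
  also have "\<dots> \<le> 80 * (hi / lo)\<^sup>2 * ((h\<^sup>2 / al + \<bar>\<sigma>\<bar> * \<bar>h\<bar> / lo) * a)"
  proof (rule mult_left_mono)
    have X: "X \<le> a / al" and E: "E \<le> a / lo" using a al lo by (simp_all add: field_simps)
    have "(diameter K)\<^sup>2 * X \<le> h\<^sup>2 * (a / al)" using X d0 diam(2) nn by (intro mult_mono power_mono) auto
    moreover have "\<sigma> * diameter K * E \<le> \<bar>\<sigma>\<bar> * \<bar>h\<bar> * (a / lo)"
      using E d0 diam(2) nn by (intro mult_mono) auto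
    ultimately show "(diameter K)\<^sup>2 * X + \<sigma> * diameter K * E \<le> (h\<^sup>2 / al + \<bar>\<sigma>\<bar> * \<bar>h\<bar> / lo) * a"
      by (simp add: distrib_right)
  qed simp
  finally have w: "ip S ?w ?w \<le> 80 * (hi / lo)\<^sup>2 * ((h\<^sup>2 / al + \<bar>\<sigma>\<bar> * \<bar>h\<bar> / lo) * a)" .
  have "Y \<le> a / lo" using a lo by (simp add: field_simps)
  then have "ip S v v \<le> 2 * (a / lo) + 2 * (80 * (hi / lo)\<^sup>2 * ((h\<^sup>2 / al + \<bar>\<sigma>\<bar> * \<bar>h\<bar> / lo) * a))"
    using ip_sum_le[OF Lv L\<Pi>] w unfolding Y_def by linarith
  also have "\<dots> = (2 / lo + 160 * (hi / lo)\<^sup>2 * (h\<^sup>2 / al + \<bar>\<sigma>\<bar> * \<bar>h\<bar> / lo)) * a"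
    by (simp add: distrib_right)
  finally show "ip S v v \<le> (2 / lo + 160 * (hi / lo)\<^sup>2 * (h\<^sup>2 / al + \<bar>\<sigma>\<bar> * \<bar>h\<bar> / lo)) * a_local P K v v"
    by (simp add: a_def)
qed

end

section \<open>Summation over the mesh\<close>

lemma two_simplex_triangle:
  assumes "2 simplex K"
  obtains A B C where "triangle A B C" "K = triangle.K A B C" "{a. a extreme_point_of K} = {A, B, C}"
proof -
  obtain V where V: "\<not> affine_dependent V" "int (card V) = 2 + 1" "K = convex hull V"
    using assms unfolding simplex_def by blast
  then have "card V = 3" by simp
  then obtain a b c where abc: "V = {a, b, c}" "a \<noteq> b" "b \<noteq> c" "a \<noteq> c" by (auto simp: card_3_iff)
  have ext: "{x. x extreme_point_of K} = {a, b, c}"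
    using V(1,3) abc(1) extreme_point_of_convex_hull_affine_independent[of V] by auto
  have nz: "cross2 (b - a) (c - a) \<noteq> 0"
  proof
    assume "cross2 (b - a) (c - a) = 0"
    then have "cross2 (c - a) (b - a) = 0" using cross2_commute[of "c - a" "b - a"] by simp
    then obtain t where "c - a = t *\<^sub>R (b - a)" using abc(2) cross2_eq_0_imp_parallel[of "c - a" "b - a"] by auto
    then have "c = (1 - t) *\<^sub>R a + t *\<^sub>R b" by (simp add: algebra_simps)
    then have "c \<in> affine hull {a, b}" unfolding affine_hull_2 mem_Collect_eq
      by - (rule exI[of _ "1 - t"], rule exI[of _ t], simp)
    moreover have "V - {c} = {a, b}" using abc by auto
    ultimately have "affine_dependent V" using abc(1) unfolding affine_dependent_def by auto
    then show False using V(1) by simp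
  qed
  show ?thesis
  proof (cases "cross2 (b - a) (c - a) > 0")
    case True
    then have t: "triangle a b c" by unfold_locales
    from that[OF t] show ?thesis using V(3) abc(1) ext by (simp add: triangle.K_def[OF t])
  next
    case False
    then have "cross2 (c - a) (b - a) > 0" using nz by (simp add: cross2_def algebra_simps)
    then have t: "triangle a c b" by unfold_locales
    from that[OF t] show ?thesis using V(3) abc(1) ext by (simp add: triangle.K_def[OF t] insert_commute)
  qed
qed

text \<open>The normal is a choice among the admissible ones, and its level on the cut can be read off at
  either cut point.\<close>

lemma interface_triangle:
  assumes P: "valid_problem P" and res: "resolved_mesh P T" and K: "triangle.K A B C \<in> T" and t: "triangle A B C"
    and i: "interface_element P (triangle.K A B C)" and ext: "{a. a extreme_point_of (triangle.K A B C)} = {A, B, C}"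
  obtains c b1 b2 where "cut_triangle A B C P (nbar P (triangle.K A B C)) c b1 b2"
proof -
  let ?K = "triangle.K A B C"
  let ?n = "nbar P ?K"
  obtain b1 b2 where b: "cut_points P ?K = {b1, b2}" "b1 \<noteq> b2" and ex: "\<exists>n. segment_normal P ?K n"
    using res K i unfolding resolved_mesh_def by blast
  have sn: "segment_normal P ?K ?n" unfolding nbar_def by (rule someI_ex[OF ex])
  have b1: "b1 \<in> Gamma_h P ?K" using b by (auto simp: Gamma_h_def hull_inc)
  have level: "?n \<bullet> y = ?n \<bullet> b1" if "y \<in> Gamma_h P ?K" for y
  proof -
    have "?n \<bullet> (y - b1) = 0" using sn that b1 unfolding segment_normal_def by blast
    then show ?thesis by (simp add: inner_diff_right)
  qed
  have "cut_triangle A B C P ?n (?n \<bullet> b1) b1 b2"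
    using t i b ext level sn P
    by (intro cut_triangle.intro cut_triangle_axioms.intro) (auto simp: segment_normal_def valid_problem_def)
  then show ?thesis by (rule that)
qed

text \<open>Almost every point of \<open>D\<close> lies in the interior of some element, because the boundaries of convex
  sets are null sets.\<close>

lemma ip_le_sum_over_cover:
  fixes f :: "'a::euclidean_space \<Rightarrow> 'b::euclidean_space"
  assumes f: "L2 D f" and D: "D \<in> sets lebesgue" and T: "finite T" "D \<subseteq> \<Union>T" "\<And>K. K \<in> T \<Longrightarrow> convex K"
    and closed: "\<And>K. K \<in> T \<Longrightarrow> closed K" and sub: "\<And>K. K \<in> T \<Longrightarrow> interior K \<subseteq> D"
  shows "ip D f f \<le> (\<Sum>K\<in>T. ip (interior K) f f)"
proof -
  have S: "interior K \<in> sets lebesgue" for K by simp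
  have e: "ip A f f = (LINT x|lebesgue. indicator A x *\<^sub>R (f x \<bullet> f x))" if "A \<in> sets lebesgue" for A
    unfolding ip_def using that by (intro integral_restrict_space) simp
  have i: "integrable lebesgue (\<lambda>x. indicator A x *\<^sub>R (f x \<bullet> f x))" if A: "A \<in> sets lebesgue" "A \<subseteq> D" for A
  proof -
    have A': "A \<inter> space lebesgue \<in> sets lebesgue" using A by simp
    have LA: "L2 A f" by (rule L2_subset[OF f A(1) D A(2)])
    show ?thesis using L2_integrable_inner[OF LA LA] by (subst (asm) integrable_restrict_space[OF A'])
  qed
  have "negligible (\<Union>K\<in>T. frontier K)"
    using T by (intro negligible_Union) (auto intro: negligible_convex_frontier)
  then have ae: "AE x in lebesgue. x \<notin> (\<Union>K\<in>T. frontier K)"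
    by (intro AE_not_in) (simp add: negligible_iff_null_sets)
  have "ip D f f \<le> (LINT x|lebesgue. (\<Sum>K\<in>T. indicator (interior K) x *\<^sub>R (f x \<bullet> f x)))"
    unfolding e[OF D]
  proof (rule integral_mono_AE)
    show "integrable lebesgue (\<lambda>x. indicator D x *\<^sub>R (f x \<bullet> f x))" by (rule i[OF D order_refl])
    show "integrable lebesgue (\<lambda>x. \<Sum>K\<in>T. indicator (interior K) x *\<^sub>R (f x \<bullet> f x))"
      using i[OF S sub] by (intro Bochner_Integration.integrable_sum)
    show "AE x in lebesgue. indicator D x *\<^sub>R (f x \<bullet> f x) \<le> (\<Sum>K\<in>T. indicator (interior K) x *\<^sub>R (f x \<bullet> f x))"
      using ae
    proof eventually_elim
      fix x assume x: "x \<notin> (\<Union>K\<in>T. frontier K)"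
      have nn: "0 \<le> indicator (interior K) x *\<^sub>R (f x \<bullet> f x)" for K by simp
      show "indicator D x *\<^sub>R (f x \<bullet> f x) \<le> (\<Sum>K\<in>T. indicator (interior K) x *\<^sub>R (f x \<bullet> f x))"
      proof (cases "x \<in> D")
        case True
        then obtain K where K: "K \<in> T" "x \<in> K" using T(2) by blast
        then have "x \<in> interior K" using x closed[OF K(1)] by (auto simp: frontier_def)
        then have "indicator D x *\<^sub>R (f x \<bullet> f x) \<le> indicator (interior K) x *\<^sub>R (f x \<bullet> f x)" using True by simp
        also have "\<dots> \<le> (\<Sum>K\<in>T. indicator (interior K) x *\<^sub>R (f x \<bullet> f x))"
          using nn by (intro member_le_sum[OF K(1) _ T(1)]) auto
        finally show ?thesis .
      next
        case False
        then show ?thesis using nn by (simp add: sum_nonneg)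
      qed
    qed
  qed
  also have "\<dots> = (\<Sum>K\<in>T. LINT x|lebesgue. indicator (interior K) x *\<^sub>R (f x \<bullet> f x))"
    using i[OF S sub] by (intro Bochner_Integration.integral_sum)
  also have "\<dots> = (\<Sum>K\<in>T. ip (interior K) f f)" by (simp add: e[OF S])
  finally show ?thesis .
qed

lemma noninterface_estimate:
  fixes S :: "plane set"
  assumes P: "valid_problem P" and ni: "\<not> interface_element P K" and v: "v \<in> Hcurl (interior K)"
    and lo: "0 < lo" "lo \<le> beta_p P" "lo \<le> beta_m P" and al: "0 < al" "al \<le> alpha_p P" "al \<le> alpha_m P"
  shows "al * ip (interior K) (weak_curl (interior K) v) (weak_curl (interior K) v) \<le> a_local P K v v"
    "lo * ip (interior K) v v \<le> a_local P K v v"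
proof -
  let ?S = "interior K"
  let ?c = "weak_curl ?S v"
  have S: "?S \<in> sets lebesgue" by simp
  have L: "L2 ?S v" "L2 ?S ?c" using has_weak_curl_weak_curl[OF v] by (auto simp: has_weak_curl_def)
  have Op: "Omega_p P \<in> sets borel" using P by (simp add: valid_problem_def)
  have m: "coeff_h P cp cm K \<in> borel_measurable (lebesgue_on ?S)" for cp cm
  proof (rule borel_imp_lebesgue_on)
    have "coeff_h P cp cm K = (\<lambda>x. if x \<in> Omega_p P then cp else cm)"
      using ni by (auto simp: coeff_h_def)
    also have "\<dots> \<in> borel_measurable borel" using Op by (intro measurable_If_set) auto
    finally show "coeff_h P cp cm K \<in> borel_measurable borel" .
  qed
  have b: "lo \<le> beta_h P K x" "beta_h P K x \<le> max (beta_p P) (beta_m P)"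
    "al \<le> alpha_h P K x" "alpha_h P K x \<le> max (alpha_p P) (alpha_m P)" for x
    using lo al by (auto simp: beta_h_def alpha_h_def coeff_h_def)
  have 1: "al * ip ?S ?c ?c \<le> ip ?S (\<lambda>x. alpha_h P K x * ?c x) ?c"
    using weighted_ip_lower[OF L(2) m[of "alpha_p P" "alpha_m P", folded alpha_h_def] S b(3,4) al(1)] by simp
  have 2: "lo * ip ?S v v \<le> ip ?S (\<lambda>x. beta_h P K x *\<^sub>R v x) v"
    using weighted_ip_lower[OF L(1) m[of "beta_p P" "beta_m P", folded beta_h_def] S b(1,2) lo(1)] by simp
  have "0 \<le> al * ip ?S ?c ?c" "0 \<le> lo * ip ?S v v" using al lo ip_self_nonneg[of ?S ?c] ip_self_nonneg[of ?S v] by auto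
  with 1 2 show "al * ip ?S ?c ?c \<le> a_local P K v v" "lo * ip ?S v v \<le> a_local P K v v"
    using ni by (auto simp: a_local_def)
qed

theorem lemma25:
  fixes P :: interface_problem and \<sigma> h0 :: real
  assumes "valid_problem P"
  shows "\<exists>C>0. \<forall>T. mesh_of (Omega P) T \<and> shape_regular \<sigma> T \<and> mesh_size T \<le> h0 \<and> resolved_mesh P T
           \<longrightarrow> (\<forall>v\<in>Ve P T. Hcurl_norm (Omega P) v \<le> C * energy_norm P T v)"
proof -
  define lo where "lo = min (beta_p P) (beta_m P)"
  define hi where "hi = max (beta_p P) (beta_m P)"
  define al where "al = min (alpha_p P) (alpha_m P)"
  have lo: "0 < lo" "lo \<le> beta_p P" "lo \<le> beta_m P" and hi: "beta_p P \<le> hi" "beta_m P \<le> hi"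
    and al: "0 < al" "al \<le> alpha_p P" "al \<le> alpha_m P"
    using assms by (auto simp: lo_def hi_def al_def valid_problem_def)
  define M where "M = 2 / lo + 160 * (hi / lo)\<^sup>2 * (h0\<^sup>2 / al + \<bar>\<sigma>\<bar> * \<bar>h0\<bar> / lo)"
  have M: "1 / lo \<le> M" "0 < M"
  proof -
    have "0 \<le> 160 * (hi / lo)\<^sup>2 * (h0\<^sup>2 / al + \<bar>\<sigma>\<bar> * \<bar>h0\<bar> / lo)" using lo al by simp
    moreover have "0 < 1 / lo" "1 / lo \<le> 2 / lo" using lo by (auto simp: divide_right_mono)
    ultimately show "1 / lo \<le> M" "0 < M" unfolding M_def by linarith+
  qed
  have open_Om: "open (Omega P)" and conv_Om: "convex (Omega P)"
  proof -
    obtain Q where "polytope Q" "Omega P = interior Q"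
      using assms by (auto simp: valid_problem_def convex_polygon_def)
    then show "open (Omega P)" "convex (Omega P)" by (auto intro: convex_interior polytope_imp_convex)
  qed
  have Om: "Omega P \<in> sets lebesgue" using open_Om by simp
  have bound: "Hcurl_norm (Omega P) v \<le> sqrt (1 / al + M) * energy_norm P T v"
    if T: "mesh_of (Omega P) T" "shape_regular \<sigma> T" "mesh_size T \<le> h0" "resolved_mesh P T" and v: "v \<in> Ve P T" for T v
  proof -
    let ?c = "weak_curl (Omega P) v"
    have fin: "finite T" using T(1) by (simp add: mesh_of_def triangulation_def)
    have vH: "v \<in> Hcurl (Omega P)" using v by (simp add: Ve_def)
    note wc = has_weak_curl_weak_curl[OF vH]
    have L: "L2 (Omega P) v" "L2 (Omega P) ?c" using wc by (auto simp: has_weak_curl_def)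
    have loc: "convex K" "closed K" "interior K \<subseteq> Omega P"
      "ip (interior K) v v \<le> M * a_local P K v v" "ip (interior K) ?c ?c \<le> 1 / al * a_local P K v v"
      if K: "K \<in> T" for K
    proof -
      have "2 simplex K" using T(1) K by (simp add: mesh_of_def)
      then obtain A B C where tri: "triangle A B C" and KK: "K = triangle.K A B C"
        and ext: "{a. a extreme_point_of K} = {A, B, C}" by (rule two_simplex_triangle)
      interpret tri: triangle A B C by (rule tri)
      show "convex K" "closed K" unfolding KK using tri.K_convex tri.K_compact by (auto simp: compact_imp_closed)
      have "K \<subseteq> closure (Omega P)" using T(1) K by (auto simp: mesh_of_def)
      then have "interior K \<subseteq> interior (closure (Omega P))" by (rule interior_mono)
      also have "\<dots> = Omega P" using convex_interior_closure[OF conv_Om] open_Om by (simp add: interior_open)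
      finally show sub: "interior K \<subseteq> Omega P" .
      have wK: "has_weak_curl (interior K) v ?c" by (rule has_weak_curl_subset[OF wc _ Om sub]) simp
      then have vK: "v \<in> Hcurl (interior K)" unfolding Hcurl_def by blast
      note wK' = has_weak_curl_weak_curl[OF vK]
      have "AE x in lebesgue_on (interior K). ?c x = weak_curl (interior K) v x"
        unfolding KK by (rule weak_curl_unique[OF tri.S_facts(1,3,2) wK[unfolded KK] wK'[unfolded KK]])
      then have cc: "ip (interior K) ?c ?c = ip (interior K) (weak_curl (interior K) v) (weak_curl (interior K) v)"
        using wK wK' by (intro ip_cong_AE) (auto simp: has_weak_curl_def)
      have both: "al * ip (interior K) ?c ?c \<le> a_local P K v v \<and> ip (interior K) v v \<le> M * a_local P K v v"
      proof (cases "interface_element P K")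
        case True
        obtain c b1 b2 where ct: "cut_triangle A B C P (nbar P K) c b1 b2"
          using interface_triangle[OF assms T(4) K[unfolded KK] tri True[unfolded KK] ext[unfolded KK]] unfolding KK by blast
        obtain x r where xr: "r > 0" "cball x r \<subseteq> K" "diameter K \<le> \<sigma> * r"
          using T(2) K unfolding shape_regular_def by blast
        have d: "diameter K \<le> h0"
        proof -
          have "diameter K \<le> mesh_size T" unfolding mesh_size_def using fin K by (intro Max_ge) auto
          then show ?thesis using T(3) by simp
        qed
        have "v \<in> Ve_local P K" using v K True by (auto simp: Ve_def)
        note est = cut_triangle.local_estimate[OF ct this[unfolded KK] xr(2)[unfolded KK] xr(1) xr(3)[unfolded KK] d[unfolded KK] lo hi al]
        have "al * ip (interior K) (weak_curl (interior K) v) (weak_curl (interior K) v) \<le> a_local P K v v"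
          "ip (interior K) v v \<le> M * a_local P K v v"
          using est unfolding M_def KK by simp_all
        then show ?thesis unfolding cc by simp
      next
        case False
        note ne = noninterface_estimate[OF assms False vK lo al]
        have "0 \<le> a_local P K v v" using ne(2) lo ip_self_nonneg[of "interior K" v] by (meson mult_nonneg_nonneg less_imp_le order_trans)
        then have "1 / lo * a_local P K v v \<le> M * a_local P K v v" using M by (intro mult_right_mono)
        moreover have "ip (interior K) v v \<le> 1 / lo * a_local P K v v" using ne(2) lo by (simp add: field_simps)
        ultimately show ?thesis using ne(1) unfolding cc by simp
      qed
      then show "ip (interior K) v v \<le> M * a_local P K v v" "ip (interior K) ?c ?c \<le> 1 / al * a_local P K v v"
        using al by (auto simp: field_simps)
    qed
    have cover: "Omega P \<subseteq> \<Union>T" using T(1) closure_subset by (auto simp: mesh_of_def)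
    have "ip (Omega P) v v + ip (Omega P) ?c ?c \<le> (\<Sum>K\<in>T. ip (interior K) v v) + (\<Sum>K\<in>T. ip (interior K) ?c ?c)"
      by (intro add_mono ip_le_sum_over_cover L Om fin cover loc(1-3))
    also have "\<dots> \<le> (\<Sum>K\<in>T. M * a_local P K v v) + (\<Sum>K\<in>T. 1 / al * a_local P K v v)"
      by (intro add_mono sum_mono loc(4,5))
    also have "\<dots> = (1 / al + M) * a_h P T v v"
      by (simp only: a_h_def distrib_right flip: sum_distrib_left)
    finally have "sqrt (ip (Omega P) v v + ip (Omega P) ?c ?c) \<le> sqrt ((1 / al + M) * a_h P T v v)"
      by (rule real_sqrt_le_mono)
    then show ?thesis by (simp add: Hcurl_norm_def energy_norm_def real_sqrt_mult)
  qed
  have "0 < sqrt (1 / al + M)" using M al by (simp add: add_pos_pos)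
  with bound show ?thesis by blast
qed

end
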